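(* Let $K\subset\mathbb R^n$ be a zero-dimensional compact set, $n\geqslant3$. Suppose that for some $2$-plane $\Pi\subset\mathbb R^n$ there exists a subset $X\subset\Pi$ homeomorphic to a one-dimensional polyhedron such that $p_\Pi(K)\subset X$. Then $K$ is tame in $\mathbb R^n$.
   Context: A $2$-plane in $\mathbb R^n$ is a $2$-dimensional affine subspace; $p_\Pi:\mathbb R^n\to\Pi$ is the orthogonal projection onto $\Pi$. Dimension is topological (covering) dimension. A polyhedron is a subset of some Euclidean space which is the union of a finite collection of simplices. A zero-dimensional compact set $K\subset\mathbb R^n$ is called tame if there exists a homeomorphism $h$ of $\mathbb R^n$ onto itself such that $h(K)$ is a subset of a straight line in $\mathbb R^n$. *)

theory Defs
  imports "HOL-Analysis.Analysis"
begin

(* Finite covers are the usual convention for normal spaces, which is the only use here.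
   The order of V at x is card {B \<in> V. x \<in> B}, so "order at most n + 1" says that any n + 2
   distinct members of V have empty intersection.  The library's dim_le is the small
   inductive dimension. *)
definition covering_dim_le :: "'a topology \<Rightarrow> int \<Rightarrow> bool" where
  "covering_dim_le X n \<longleftrightarrow> -1 \<le> n \<and>
     (\<forall>\<U>. finite \<U> \<and> (\<forall>U\<in>\<U>. openin X U) \<and> \<Union>\<U> = topspace X \<longrightarrow>
       (\<exists>\<V>. finite \<V> \<and> (\<forall>V\<in>\<V>. openin X V) \<and> \<Union>\<V> = topspace X \<and>
            (\<forall>V\<in>\<V>. \<exists>U\<in>\<U>. V \<subseteq> U) \<and>
            (\<forall>x\<in>topspace X. int (card {V\<in>\<V>. x \<in> V}) \<le> n + 1)))"

definition has_covering_dim :: "'a topology \<Rightarrow> int \<Rightarrow> bool" where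
  "has_covering_dim X n \<longleftrightarrow> covering_dim_le X n \<and> \<not> covering_dim_le X (n - 1)"

(* The dimension of the empty space is -1, and -1 is the dimension of no other space. *)
lemma covering_dim_le_minus_one: "covering_dim_le X (-1) \<longleftrightarrow> X = trivial_topology"
proof
  assume L: "covering_dim_le X (-1)"
  have "\<exists>\<V>. finite \<V> \<and> \<Union>\<V> = topspace X \<and> (\<forall>x\<in>topspace X. card {V\<in>\<V>. x \<in> V} = 0)"
    using L[unfolded covering_dim_le_def, THEN conjunct2, rule_format, of "{topspace X}"]
    by auto
  then obtain \<V> where V: "finite \<V>" "\<Union>\<V> = topspace X"
    "\<And>x. x \<in> topspace X \<Longrightarrow> card {V\<in>\<V>. x \<in> V} = 0" by blast
  have "topspace X = {}"
  proof (rule equals0I)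
    fix x assume x: "x \<in> topspace X"
    then have "{V\<in>\<V>. x \<in> V} = {}" using V(3)[OF x] V(1) by simp
    then show False using x V(2) by blast
  qed
  then show "X = trivial_topology" by simp
next
  assume "X = trivial_topology"
  then show "covering_dim_le X (-1)"
    unfolding covering_dim_le_def by (auto intro!: exI[of _ "{}"])
qed

(* Not the library's polyhedron, which is a finite intersection of half-spaces. *)
definition simplicial_polyhedron :: "'a::euclidean_space set \<Rightarrow> bool" where
  "simplicial_polyhedron P \<longleftrightarrow> (\<exists>\<S>. finite \<S> \<and> (\<forall>S\<in>\<S>. \<exists>d. d simplex S) \<and> P = \<Union>\<S>)"

definition two_plane :: "'a::euclidean_space set \<Rightarrow> bool" where
  "two_plane A \<longleftrightarrow> affine A \<and> aff_dim A = 2"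

definition straight_line :: "'a::euclidean_space set \<Rightarrow> bool" where
  "straight_line A \<longleftrightarrow> affine A \<and> aff_dim A = 1"

definition orth_proj :: "'a::euclidean_space set \<Rightarrow> 'a \<Rightarrow> 'a" where
  "orth_proj A x = (THE y. y \<in> A \<and> (\<forall>u\<in>A. \<forall>v\<in>A. orthogonal (x - y) (u - v)))"

lemma orth_proj_unique_exists:
  fixes A :: "'a::euclidean_space set"
  assumes "affine A" "A \<noteq> {}"
  shows "\<exists>!y. y \<in> A \<and> (\<forall>u\<in>A. \<forall>v\<in>A. orthogonal (x - y) (u - v))"
proof -
  obtain a where a: "a \<in> A" using assms by blast
  let ?T = "(+) (-a) ` A"
  have T: "subspace ?T" using affine_diffs_subspace[OF assms(1) a] by simp
  obtain y z where y: "y \<in> span ?T" and z: "\<And>w. w \<in> span ?T \<Longrightarrow> orthogonal z w"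
    and xyz: "x - a = y + z"
    using orthogonal_subspace_decomp_exists[of ?T "x - a"] by metis
  have sp: "span ?T = ?T" using T by (simp add: span_eq_iff)
  have "y \<in> ?T" using y unfolding sp .
  then have mem: "a + y \<in> A" by auto
  have "orthogonal (x - (a + y)) (u - v)" if "u \<in> A" "v \<in> A" for u v
  proof -
    have "(-a + u) - (-a + v) \<in> ?T" using that by (intro subspace_diff[OF T]) auto
    then have "u - v \<in> ?T" by simp
    then have "orthogonal z (u - v)" using z[of "u - v"] unfolding sp by blast
    moreover have "x - (a + y) = z" using xyz by (simp add: algebra_simps)
    ultimately show ?thesis by simp
  qed
  moreover have "y1 = y2" if "y1 \<in> A" "y2 \<in> A"
    "\<forall>u\<in>A. \<forall>v\<in>A. orthogonal (x - y1) (u - v)" "\<forall>u\<in>A. \<forall>v\<in>A. orthogonal (x - y2) (u - v)" for y1 y2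
  proof -
    have "orthogonal (x - y1) (y1 - y2)" "orthogonal (x - y2) (y1 - y2)" using that by blast+
    then have "(y1 - y2) \<bullet> (y1 - y2) = 0"
      by (simp add: orthogonal_def algebra_simps)
    then show ?thesis by simp
  qed
  ultimately show ?thesis using mem by blast
qed

definition tame :: "'a::euclidean_space set \<Rightarrow> bool" where
  "tame K \<longleftrightarrow> (\<exists>(h::'a \<Rightarrow> 'a) g L. homeomorphism UNIV UNIV h g \<and> straight_line L \<and> h ` K \<subseteq> L)"

end

(* Call a compact set K movable if for every closed nowhere dense S it can be pushed off S by a
   homeomorphism supported in a prescribed neighbourhood of K. A zero-dimensional compactum all of
   whose compact subsets are movable is tame: pushing it off finer and finer grids of hyperplanes and
   shrinking the grid cells yields homeomorphisms that separate the levels of a linear functional on K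
   at smaller and smaller scales, their limit makes the functional injective on K, and a shear then
   carries K into a line. Movability of zero-dimensional compacta is a local property, passes to
   finite unions, and holds in a hyperplane, where the pieces of a clopen partition are first lifted
   to different heights. This settles the part of K over the vertices of X. Over an interior point
   of an edge of X, the edge is locally flat in the plane by the Schoenflies theorem for a crosscut of
   a disc, and the product structure carries the corresponding part of K into a hyperplane. The
   Schoenflies theorem comes from Caratheodory's extension of the Riemann map, proved here by Koebe's
   argument with the maximum principle rather than by length-area estimates. The edges of X have
   dimension at most 1 because, by Brouwer's theorem, a triangle does not have covering dimension 1. *)
theory Submission
  imports Defs "HOL-Complex_Analysis.Complex_Analysis"
begin

section \<open>Homeomorphisms with compact support\<close>

text \<open>Wild zero-dimensional compacta exist (Antoine's necklace in three-space), so the small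
  clopen pieces of \<open>K\<close> cannot in general be enclosed in disjoint small balls;
  movability is the substitute that can be verified from the hypothesis. It asks for avoidance of
  every closed nowhere dense set, not just of hyperplanes, because that class is invariant under
  homeomorphisms between open sets; charts and previously built homeomorphisms may then be used
  freely. What makes a hyperplane easy is its normal direction: pieces raised to different heights
  lie in disjoint convex slabs, and inside a bounded convex open set a compactum can be squeezed
  towards any point. The arcs of \<open>X\<close> act through charts \<open>G\<close> of open sets
  of the plane, extended to space as a translation parallel to the plane that depends only on the
  projection. An endpoint of an edge needs no chart, since the fibre over a single point already
  lies in a hyperplane. The charts must exist for arbitrary, possibly nowhere smooth arcs; this is
  the reason for the excursion into conformal maps.\<close>

definition supp_homeo :: "'a::euclidean_space set \<Rightarrow> ('a \<Rightarrow> 'a) \<Rightarrow> bool" where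
  "supp_homeo U f \<longleftrightarrow> continuous_on UNIV f \<and> inj f \<and> (\<exists>C. compact C \<and> C \<subseteq> U \<and> (\<forall>x. x \<notin> C \<longrightarrow> f x = x))"

lemma supp_homeo_id: "supp_homeo U (\<lambda>x. x)"
  unfolding supp_homeo_def by (auto intro!: exI[of _ "{}"])

lemma supp_homeo_mono: "supp_homeo U f \<Longrightarrow> U \<subseteq> V \<Longrightarrow> supp_homeo V f"
  unfolding supp_homeo_def by blast

lemma supp_homeo_outside: "supp_homeo U f \<Longrightarrow> x \<notin> U \<Longrightarrow> f x = x"
  unfolding supp_homeo_def by blast

lemma supp_homeo_compose:
  assumes "supp_homeo U f" "supp_homeo U g"
  shows "supp_homeo U (\<lambda>x. f (g x))"
proof -
  obtain C D where C: "compact C" "C \<subseteq> U" "\<And>x. x \<notin> C \<Longrightarrow> f x = x"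
    and D: "compact D" "D \<subseteq> U" "\<And>x. x \<notin> D \<Longrightarrow> g x = x"
    and cont: "continuous_on UNIV f" "continuous_on UNIV g" "inj f" "inj g"
    using assms unfolding supp_homeo_def by blast
  have "continuous_on UNIV (\<lambda>x. f (g x))"
    using continuous_on_compose2[OF cont(1,2)] by simp
  moreover have "inj (\<lambda>x. f (g x))" using inj_compose[OF cont(3,4)] by (simp add: comp_def)
  moreover have "compact (C \<union> D)" "C \<union> D \<subseteq> U" "\<forall>x. x \<notin> C \<union> D \<longrightarrow> f (g x) = x"
    using C D by auto
  ultimately show ?thesis unfolding supp_homeo_def by blast
qed

lemma supp_homeo_surj:
  fixes f :: "'a::euclidean_space \<Rightarrow> 'a"
  assumes "supp_homeo U f"
  shows "surj f"
proof -
  obtain C where C: "compact C" "\<And>x. x \<notin> C \<Longrightarrow> f x = x"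
    and cont: "continuous_on UNIV f" "inj f"
    using assms unfolding supp_homeo_def by blast
  have op: "open (range f)" using invariance_of_domain[OF cont(1)] cont(2) by simp
  have eq: "range f = f ` C \<union> range f" by blast
  have "closed (range f)"
  proof (subst closed_sequential_limits, intro allI impI)
    fix X l assume X: "(\<forall>n. X n \<in> range f) \<and> X \<longlonglongrightarrow> l"
    show "l \<in> range f"
    proof (cases "l \<in> f ` C")
      case False
      have "closed (f ` C)"
        using C(1) cont(1) by (meson compact_continuous_image compact_imp_closed continuous_on_subset subset_UNIV)
      then have "open (- (f ` C))" by auto
      then have ev: "eventually (\<lambda>n. X n \<in> - (f ` C)) sequentially"
        using X False topological_tendstoD[of X l sequentially "- (f ` C)"] by blast
      then have "eventually (\<lambda>n. X n \<in> - C) sequentially"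
      proof eventually_elim
        case (elim n)
        then obtain y where "X n = f y" "y \<notin> C" using X by blast
        then show ?case using C(2) by auto
      qed
      then have "eventually (\<lambda>n. f (X n) = X n) sequentially"
        by eventually_elim (use C(2) in auto)
      moreover have "(\<lambda>n. f (X n)) \<longlonglongrightarrow> f l"
        using cont(1) X by (auto simp: continuous_on_eq_continuous_at isCont_tendsto_compose)
      ultimately have "X \<longlonglongrightarrow> f l" by (auto elim: Lim_transform_eventually)
      then have "f l = l" using X LIMSEQ_unique by blast
      then show ?thesis by (metis rangeI)
    qed auto
  qed
  then have "range f = {} \<or> range f = UNIV" using op clopen by blast
  then show ?thesis by blast
qed

lemma supp_homeo_homeomorphism:
  fixes f :: "'a::euclidean_space \<Rightarrow> 'a"
  assumes "supp_homeo U f"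
  shows "homeomorphism UNIV UNIV f (inv f)"
proof -
  have "continuous_on UNIV f" "inj f" using assms unfolding supp_homeo_def by blast+
  then obtain g where g: "homeomorphism UNIV (range f) f g"
    using invariance_of_domain_homeomorphism[of UNIV f] by auto
  have "g y = inv f y" for y
  proof -
    obtain x where "y = f x" using supp_homeo_surj[OF assms] by (auto simp: surj_def)
    then show ?thesis using homeomorphism_apply1[OF g, of x] \<open>inj f\<close> by simp
  qed
  then have "g = inv f" by (rule ext)
  then show ?thesis using g supp_homeo_surj[OF assms] by simp
qed

text \<open>A point \<open>x\<close> of \<open>U\<close> with \<open>f x\<close> outside
  \<open>U\<close> would give \<open>f (f x) = f x\<close>, hence \<open>f x = x\<close> by
  injectivity.\<close>

lemma supp_homeo_mem_iff:
  fixes f :: "'a::euclidean_space \<Rightarrow> 'a"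
  assumes "supp_homeo U f"
  shows "f x \<in> U \<longleftrightarrow> x \<in> U"
proof -
  have "inj f" using assms unfolding supp_homeo_def by blast
  then show ?thesis
    using supp_homeo_outside[OF assms] by (metis injD)
qed

text \<open>Each map preserves its own set and fixes the others pointwise, so the composition of all
  of them restricts to \<open>f i\<close> on \<open>U i\<close>.\<close>

lemma supp_homeo_glue:
  fixes U :: "'i \<Rightarrow> 'a::euclidean_space set"
  assumes "finite I" "disjoint_family_on U I" "\<And>i. i \<in> I \<Longrightarrow> supp_homeo (U i) (f i)"
  shows "\<exists>g. supp_homeo (\<Union>i\<in>I. U i) g \<and> (\<forall>i\<in>I. \<forall>x\<in>U i. g x = f i x)"
  using assms
proof (induction I rule: finite_induct)
  case empty
  then show ?case using supp_homeo_id by auto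
next
  case (insert j I)
  have dis: "disjoint_family_on U I" using insert.prems(1) by (auto simp: disjoint_family_on_def)
  obtain g where g: "supp_homeo (\<Union>i\<in>I. U i) g" "\<forall>i\<in>I. \<forall>x\<in>U i. g x = f i x"
    using insert.IH[OF dis] insert.prems(2) by blast
  have sj: "supp_homeo (U j) (f j)" using insert.prems(2) by blast
  have dj: "U i \<inter> U j = {}" if "i \<in> I" for i
    using insert.prems(1) insert.hyps(2) that by (auto simp: disjoint_family_on_def)
  have "supp_homeo (\<Union>i\<in>insert j I. U i) (\<lambda>x. g (f j x))"
    by (rule supp_homeo_compose) (use g(1) sj in \<open>auto intro: supp_homeo_mono\<close>)
  moreover have "g (f j x) = f i x" if "i \<in> insert j I" "x \<in> U i" for i x
  proof (cases "i = j")
    case True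
    have "f j x \<in> U j" using supp_homeo_mem_iff[OF sj] that True by blast
    then have "f j x \<notin> (\<Union>i\<in>I. U i)" using dj by blast
    then show ?thesis using supp_homeo_outside[OF g(1)] True by simp
  next
    case False
    then have "i \<in> I" using that by blast
    then have "x \<notin> U j" using dj that by blast
    then show ?thesis using supp_homeo_outside[OF sj] g(2) that \<open>i \<in> I\<close> by simp
  qed
  ultimately show ?case by blast
qed

text \<open>The extension by the identity is continuous because the support \<open>k\<close>
  C\<open>is compact, hence closed in the whole space and not just in\<close>V\<open>: the open sets\<close>V\<open>and\<close>-
  (k \<open>C)\<close> cover everything and the map is continuous on both.\<close>

lemma supp_homeo_conjugate:
  fixes h :: "'a::euclidean_space \<Rightarrow> 'a"
  assumes "open V" "homeomorphism V W h k" "supp_homeo W f"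
  shows "supp_homeo V (\<lambda>x. if x \<in> V then k (f (h x)) else x)" (is "supp_homeo V ?g")
proof -
  obtain C where C: "compact C" "C \<subseteq> W" "\<And>x. x \<notin> C \<Longrightarrow> f x = x"
    and cont: "continuous_on UNIV f" "inj f"
    using assms(3) unfolding supp_homeo_def by blast
  note fW = supp_homeo_mem_iff[OF assms(3)]
  have h: "\<And>x. x \<in> V \<Longrightarrow> h x \<in> W" "\<And>y. y \<in> W \<Longrightarrow> k y \<in> V"
    "\<And>x. x \<in> V \<Longrightarrow> k (h x) = x" "\<And>y. y \<in> W \<Longrightarrow> h (k y) = y"
    using assms(2) by (auto simp: homeomorphism_def)
  have ch: "continuous_on V h" and ck: "continuous_on W k"
    using assms(2) by (auto simp: homeomorphism_def)
  have kC: "compact (k ` C)" "k ` C \<subseteq> V"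
    using C ck h by (auto intro: compact_continuous_image continuous_on_subset)
  have out: "?g x = x" if "x \<notin> k ` C" for x
  proof (cases "x \<in> V")
    case True
    then have "h x \<notin> C" using that h(3)[OF True] by (metis image_eqI)
    then show ?thesis using C(3) h True by simp
  qed simp
  have c1: "continuous_on V ?g"
  proof -
    have "continuous_on V (\<lambda>x. k (f (h x)))"
      by (rule continuous_on_compose2[OF ck continuous_on_compose2[OF cont(1) ch]])
        (use h fW in auto)
    then show ?thesis by (simp cong: continuous_on_cong)
  qed
  have c2: "continuous_on (- (k ` C)) ?g"
    by (rule continuous_on_eq[of _ "\<lambda>x. x"]) (use out in auto)
  have "open (- (k ` C))" using kC(1) compact_imp_closed by blast
  then have "continuous_on (V \<union> - (k ` C)) ?g"
    using continuous_on_open_Un[OF assms(1) _ c1 c2] by blast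
  moreover have "V \<union> - (k ` C) = UNIV" using kC(2) by blast
  ultimately have "continuous_on UNIV ?g" by simp
  moreover have "inj ?g"
  proof (rule injI)
    fix x y assume e: "?g x = ?g y"
    have V: "?g z \<in> V \<longleftrightarrow> z \<in> V" for z using h fW by auto
    have "x \<in> V \<longleftrightarrow> y \<in> V" using V[of x] V[of y] e by simp
    moreover have "x = y" if "x \<in> V" "y \<in> V"
    proof -
      have "k (f (h x)) = k (f (h y))" using e that by simp
      then have "f (h x) = f (h y)" using h fW that by metis
      then have "h x = h y" using cont(2) by (simp add: inj_eq)
      then show ?thesis using h that by metis
    qed
    ultimately show "x = y" using e by auto
  qed
  ultimately show ?thesis unfolding supp_homeo_def using kC out by blast
qed

section \<open>Squeezing compact sets towards a point\<close>

lemma compress_into_ball: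
  fixes w :: "'a::euclidean_space"
  assumes "compact L" "e > 0"
  shows "\<exists>f. supp_homeo UNIV f \<and> f ` L \<subseteq> ball w e"
proof -
  obtain R where R: "R > 0" "L \<subseteq> ball w R"
    using compact_imp_bounded[OF assms(1)] bounded_subset_ballD[of L w] by auto
  \<comment> \<open>The image of the ball of radius \<open>R\<close> will have radius at most
    \<open>2 * l * R\<close>; the bound \<open>e / (3 * R)\<close> keeps this below
    \<open>e\<close>, and \<open>1/2\<close> keeps \<open>l\<close> below 1.\<close>
  define l where "l = min (1/2) (e / (3 * R))"
  have l: "0 < l" "l < 1" "l \<le> e / (3 * R)" using assms R by (auto simp: l_def)
  \<comment> \<open>Radial scaling factor: it equals \<open>l\<close> at the centre, never
    decreases, and is 1 from radius \<open>R / l\<close> on, which gives the compact support.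
    Monotonicity makes \<open>s r * r\<close> strictly increasing, hence the map injective.\<close>
  define s where "s = (\<lambda>r::real. 1 - (1 - l) * max 0 (1 - l * r / R))"
  define f where "f = (\<lambda>x. w + s (norm (x - w)) *\<^sub>R (x - w))"
  have spos: "s r > 0" if "r \<ge> 0" for r
  proof -
    have "max 0 (1 - l * r / R) \<le> 1" using l R that by auto
    then have "(1 - l) * max 0 (1 - l * r / R) \<le> (1 - l) * 1" by (rule mult_left_mono) (use l in auto)
    also have "\<dots> < 1" using l by simp
    finally show ?thesis by (simp add: s_def)
  qed
  have smono: "s r \<le> s t" if "0 \<le> r" "r \<le> t" for r t
  proof -
    have "l * r / R \<le> l * t / R" using l R that by (simp add: divide_right_mono)
    then have "max 0 (1 - l * t / R) \<le> max 0 (1 - l * r / R)" by auto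
    then show ?thesis using l unfolding s_def by (simp add: mult_left_mono)
  qed
  have strict: "s r * r < s t * t" if "0 \<le> r" "r < t" for r t
  proof -
    have "s r * r \<le> s t * r" using smono[of r t] that by (intro mult_right_mono) auto
    also have "\<dots> < s t * t" using spos[of t] that by simp
    finally show ?thesis .
  qed
  have inj: "inj f"
  proof (rule injI)
    fix x y assume "f x = f y"
    then have e: "s (norm (x - w)) *\<^sub>R (x - w) = s (norm (y - w)) *\<^sub>R (y - w)" by (simp add: f_def)
    then have "norm (s (norm (x - w)) *\<^sub>R (x - w)) = norm (s (norm (y - w)) *\<^sub>R (y - w))" by simp
    then have "s (norm (x - w)) * norm (x - w) = s (norm (y - w)) * norm (y - w)"
      using spos by (simp add: less_imp_le)
    then have "norm (x - w) = norm (y - w)"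
      using strict[of "norm (x - w)" "norm (y - w)"] strict[of "norm (y - w)" "norm (x - w)"]
      by (metis less_irrefl linorder_neqE_linordered_idom norm_ge_zero)
    then have "s (norm (x - w)) *\<^sub>R (x - w) = s (norm (x - w)) *\<^sub>R (y - w)" using e by simp
    moreover have "s (norm (x - w)) \<noteq> 0" using spos[of "norm (x - w)"] by simp
    ultimately show "x = y" by simp
  qed
  have "continuous_on UNIV f" unfolding f_def s_def by (intro continuous_intros) (use R in auto)
  moreover have "f x = x" if "x \<notin> cball w (R / l)" for x
  proof -
    have "norm (x - w) > R / l" using that by (simp add: dist_norm norm_minus_commute)
    then have "l * norm (x - w) / R > 1" using l R by (simp add: field_simps)
    then have "max 0 (1 - l * norm (x - w) / R) = 0" by auto
    then show ?thesis by (simp add: f_def s_def)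
  qed
  ultimately have sf: "supp_homeo UNIV f" unfolding supp_homeo_def using inj compact_cball by blast
  have "f x \<in> ball w e" if "x \<in> L" for x
  proof -
    let ?r = "norm (x - w)"
    have r: "0 \<le> ?r" "?r < R" using R that by (auto simp: dist_norm norm_minus_commute)
    have "l * ?r / R \<le> l" using r l R by (simp add: field_simps)
    then have "1 - l \<le> max 0 (1 - l * ?r / R)" by auto
    then have "(1 - l) * (1 - l) \<le> (1 - l) * max 0 (1 - l * ?r / R)" using l by (intro mult_left_mono) auto
    then have "s ?r \<le> 1 - (1 - l) * (1 - l)" by (simp add: s_def)
    also have "\<dots> \<le> 2 * l" using l by (simp add: algebra_simps)
    finally have "s ?r * ?r \<le> 2 * l * R" using r l by (intro mult_mono) auto
    also have "\<dots> < e" using l(3) R assms(2) by (simp add: field_simps)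
    finally show ?thesis using spos[of ?r] by (simp add: f_def dist_norm less_imp_le)
  qed
  then show ?thesis using sf by blast
qed

text \<open>A nonempty bounded convex open set is homeomorphic to the whole space, so the radial
  contraction towards a point of \<open>W\<close> can be conjugated into \<open>C\<close> and
  extended by the identity.\<close>

lemma compress_in_convex:
  fixes C :: "'a::euclidean_space set"
  assumes "open C" "convex C" "bounded C" "compact L" "L \<subseteq> C" "open W" "W \<inter> C \<noteq> {}"
  shows "\<exists>f. supp_homeo C f \<and> f ` L \<subseteq> W"
proof -
  have "interior (closure C) = C" using assms by (simp add: convex_interior_closure interior_open)
  moreover have "closure C homeomorphic cball (0::'a) 1"
    by (rule homeomorphic_convex_compact_cball) (use assms calculation in auto)
  then have "interior (closure C) homeomorphic interior (cball (0::'a) 1)"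
    by (rule homeomorphic_interiors) (use assms \<open>interior (closure C) = C\<close> in auto)
  ultimately have "C homeomorphic (UNIV :: 'a set)"
    using homeomorphic_trans[OF _ homeomorphic_ball01_UNIV] by simp
  then obtain h k where hk: "homeomorphism C (UNIV::'a set) h k" by (auto simp: homeomorphic_def)
  obtain z where z: "z \<in> W" "z \<in> C" using assms by blast
  have "continuous_on UNIV k" using hk by (auto simp: homeomorphism_def)
  then have "open (k -` W)" using assms(6) by (simp add: open_vimage)
  moreover have "h z \<in> k -` W" using hk z by (simp add: homeomorphism_def)
  ultimately obtain e where e: "e > 0" "ball (h z) e \<subseteq> k -` W" by (meson open_contains_ball)
  have "compact (h ` L)"
    using assms hk by (meson compact_continuous_image continuous_on_subset homeomorphism_def)
  then obtain f where f: "supp_homeo UNIV f" "f ` h ` L \<subseteq> ball (h z) e"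
    using compress_into_ball e(1) by blast
  have "supp_homeo C (\<lambda>x. if x \<in> C then k (f (h x)) else x)"
    by (rule supp_homeo_conjugate[OF assms(1) hk f(1)])
  moreover have "(\<lambda>x. if x \<in> C then k (f (h x)) else x) ` L \<subseteq> W"
    using f(2) e(2) assms(5) by auto
  ultimately show ?thesis by blast
qed

section \<open>Zero-dimensional compacta and movable sets\<close>

text \<open>The metric form of zero-dimensionality for compacta: in a finite disjoint partition into
  compact pieces every piece is also open in \<open>K\<close>, so these are clopen partitions of
  arbitrarily small mesh. Compactness of the pieces also gives them positive mutual
  distances.\<close>

definition zdim :: "'a::euclidean_space set \<Rightarrow> bool" where
  "zdim K \<longleftrightarrow> compact K \<and> (\<forall>e>0. \<exists>\<P>. finite \<P> \<and> pairwise disjnt \<P> \<and> \<Union>\<P> = K \<and>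
     (\<forall>P\<in>\<P>. compact P \<and> (\<forall>x\<in>P. \<forall>y\<in>P. dist x y < e)))"

lemma zdim_compact: "zdim K \<Longrightarrow> compact K"
  by (simp add: zdim_def)

lemma zdimE:
  assumes "zdim K" "e > 0"
  obtains \<P> where "finite \<P>" "pairwise disjnt \<P>" "\<Union>\<P> = K" "\<And>P. P \<in> \<P> \<Longrightarrow> compact P"
    "\<And>P. P \<in> \<P> \<Longrightarrow> P \<noteq> {}" "\<And>P x y. P \<in> \<P> \<Longrightarrow> x \<in> P \<Longrightarrow> y \<in> P \<Longrightarrow> dist x y < e"
proof -
  obtain \<P> where P: "finite \<P>" "pairwise disjnt \<P>" "\<Union>\<P> = K"
    "\<forall>P\<in>\<P>. compact P \<and> (\<forall>x\<in>P. \<forall>y\<in>P. dist x y < e)"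
    using assms unfolding zdim_def by meson
  show ?thesis
  proof (rule that[of "\<P> - {{}}"])
    show "pairwise disjnt (\<P> - {{}})" using P(2) by (rule pairwise_subset) blast
  qed (use P in auto)
qed

text \<open>Order at most \<open>0 + 1\<close> says that distinct members of the refinement are
  disjoint, so each is the complement in \<open>K\<close> of the union of the others and is compact.
  Refining a cover by balls of radius \<open>e/2\<close> bounds the mesh by
  \<open>e\<close>.\<close>

lemma covering_dim_zero_imp_zdim:
  fixes K :: "'a::euclidean_space set"
  assumes "compact K" "covering_dim_le (top_of_set K) 0"
  shows "zdim K"
  unfolding zdim_def
proof (intro conjI allI impI)
  fix e :: real assume "e > 0"
  obtain F where F: "finite F" "F \<subseteq> K" "K \<subseteq> (\<Union>x\<in>F. ball x (e/2))"
    using compactE_image[OF assms(1), of K "\<lambda>x. ball x (e/2)"] \<open>e > 0\<close> by force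
  define \<U> where "\<U> = (\<lambda>x. K \<inter> ball x (e/2)) ` F"
  have "finite \<U> \<and> (\<forall>U\<in>\<U>. openin (top_of_set K) U) \<and> \<Union>\<U> = topspace (top_of_set K)"
    using F by (auto simp: openin_open_Int \<U>_def)
  with assms(2)[unfolded covering_dim_le_def, THEN conjunct2, rule_format, of \<U>]
  obtain \<V> where V: "finite \<V>" "\<forall>V\<in>\<V>. openin (top_of_set K) V"
    "\<Union>\<V> = topspace (top_of_set K)" "\<forall>V\<in>\<V>. \<exists>U\<in>\<U>. V \<subseteq> U"
    "\<forall>x\<in>topspace (top_of_set K). int (card {V\<in>\<V>. x \<in> V}) \<le> 0 + 1" by blast
  have V3: "\<Union>\<V> = K" and V5: "\<And>x. x \<in> K \<Longrightarrow> card {V\<in>\<V>. x \<in> V} \<le> 1"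
    using V(3,5) by auto
  have dis: "pairwise disjnt \<V>"
  proof (intro pairwiseI)
    fix A B assume AB: "A \<in> \<V>" "B \<in> \<V>" "A \<noteq> B"
    show "disjnt A B"
    proof (rule ccontr)
      assume "\<not> disjnt A B"
      then obtain x where x: "x \<in> A" "x \<in> B" by (auto simp: disjnt_def)
      have "card {A, B} \<le> card {V\<in>\<V>. x \<in> V}"
        by (rule card_mono) (use V(1) AB x in auto)
      moreover have "x \<in> K" using V3 AB x by blast
      ultimately show False using V5[of x] AB by simp
    qed
  qed
  have "compact V \<and> (\<forall>x\<in>V. \<forall>y\<in>V. dist x y < e)" if "V \<in> \<V>" for V
  proof
    have "openin (top_of_set K) (\<Union>(\<V> - {V}))" using V(2) by (intro openin_Union) auto
    moreover have "V = K - \<Union>(\<V> - {V})"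
      using V3 dis that by (fastforce simp: pairwise_def disjnt_def)
    ultimately have "closedin (top_of_set K) V"
      by (metis closedin_diff closedin_topspace topspace_euclidean_subtopology)
    then show "compact V" using assms(1) closedin_compact by blast
    have "\<exists>U\<in>\<U>. V \<subseteq> U" using V(4) that by blast
    then have "\<exists>z. V \<subseteq> ball z (e/2)" unfolding \<U>_def by blast
    then obtain z where z: "V \<subseteq> ball z (e/2)" by blast
    show "\<forall>x\<in>V. \<forall>y\<in>V. dist x y < e"
      using z dist_triangle_half_r[of z _ e] by (meson mem_ball subsetD)
  qed
  then show "\<exists>\<P>. finite \<P> \<and> pairwise disjnt \<P> \<and> \<Union>\<P> = K \<and>
     (\<forall>P\<in>\<P>. compact P \<and> (\<forall>x\<in>P. \<forall>y\<in>P. dist x y < e))"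
    using V(1) V3 dis by blast
qed (use assms in auto)

lemma zdim_subset:
  assumes "zdim K" "compact L" "L \<subseteq> K"
  shows "zdim L"
  unfolding zdim_def
proof (intro conjI allI impI)
  fix e :: real assume "e > 0"
  obtain \<P> where P: "finite \<P>" "pairwise disjnt \<P>" "\<Union>\<P> = K" "\<And>P. P \<in> \<P> \<Longrightarrow> compact P"
    "\<And>P x y. P \<in> \<P> \<Longrightarrow> x \<in> P \<Longrightarrow> y \<in> P \<Longrightarrow> dist x y < e"
    by (rule zdimE[OF assms(1) \<open>e > 0\<close>]) blast
  have "pairwise disjnt ((\<lambda>P. P \<inter> L) ` \<P>)"
    using P(2) by (fastforce simp: pairwise_def disjnt_def)
  moreover have "\<Union>((\<lambda>P. P \<inter> L) ` \<P>) = L" using P(3) assms(3) by blast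
  moreover have "\<forall>P\<in>(\<lambda>P. P \<inter> L) ` \<P>. compact P \<and> (\<forall>x\<in>P. \<forall>y\<in>P. dist x y < e)"
    using P(4,5) assms(2) compact_Int by fastforce
  ultimately show "\<exists>\<P>. finite \<P> \<and> pairwise disjnt \<P> \<and> \<Union>\<P> = L \<and>
     (\<forall>P\<in>\<P>. compact P \<and> (\<forall>x\<in>P. \<forall>y\<in>P. dist x y < e))"
    using P(1) by (meson finite_imageI)
qed (use assms in auto)

lemma zdim_image:
  fixes K :: "'a::euclidean_space set" and f :: "'a \<Rightarrow> 'b::euclidean_space"
  assumes "zdim K" "continuous_on K f" "inj_on f K"
  shows "zdim (f ` K)"
  unfolding zdim_def
proof (intro conjI allI impI)
  show "compact (f ` K)" using assms zdim_compact compact_continuous_image by blast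
  fix e :: real assume "e > 0"
  have "uniformly_continuous_on K f"
    using assms zdim_compact compact_uniformly_continuous by blast
  then obtain d where d: "d > 0" "\<And>x y. x \<in> K \<Longrightarrow> y \<in> K \<Longrightarrow> dist y x < d \<Longrightarrow> dist (f y) (f x) < e"
    using \<open>e > 0\<close> unfolding uniformly_continuous_on_def by meson
  obtain \<P> where P: "finite \<P>" "pairwise disjnt \<P>" "\<Union>\<P> = K" "\<And>P. P \<in> \<P> \<Longrightarrow> compact P"
    "\<And>P x y. P \<in> \<P> \<Longrightarrow> x \<in> P \<Longrightarrow> y \<in> P \<Longrightarrow> dist x y < d"
    by (rule zdimE[OF assms(1) \<open>d > 0\<close>]) blast
  have sub: "P \<subseteq> K" if "P \<in> \<P>" for P using P(3) that by blast
  have "pairwise disjnt ((`) f ` \<P>)"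
  proof (intro pairwiseI)
    fix A B assume "A \<in> (`) f ` \<P>" "B \<in> (`) f ` \<P>" "A \<noteq> B"
    then obtain A' B' where AB: "A' \<in> \<P>" "B' \<in> \<P>" "A = f ` A'" "B = f ` B'" "A' \<noteq> B'" by blast
    then have "A' \<inter> B' = {}" using P(2) by (auto simp: pairwise_def disjnt_def)
    then show "disjnt A B"
      using inj_on_image_Int[OF assms(3) sub[OF AB(1)] sub[OF AB(2)]] AB by (simp add: disjnt_def)
  qed
  moreover have "\<Union>((`) f ` \<P>) = f ` K" using P(3) by blast
  moreover have "compact (f ` P)" if "P \<in> \<P>" for P
    using P(4) sub that assms(2) compact_continuous_image continuous_on_subset by metis
  moreover have "dist (f x) (f y) < e" if "P \<in> \<P>" "x \<in> P" "y \<in> P" for P x y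
    using d(2)[of y x] P(5)[OF that] sub that by blast
  ultimately show "\<exists>\<P>. finite \<P> \<and> pairwise disjnt \<P> \<and> \<Union>\<P> = f ` K \<and>
     (\<forall>P\<in>\<P>. compact P \<and> (\<forall>x\<in>P. \<forall>y\<in>P. dist x y < e))"
    using P(1) by (intro exI[of _ "(`) f ` \<P>"]) auto
qed

text \<open>In a partition of mesh below the distance from \<open>A\<close> to \<open>B\<close> no
  piece meets both; the pieces that meet \<open>A\<close> form the clopen set
  \<open>N\<close>.\<close>

lemma zdim_separate:
  fixes K :: "'a::euclidean_space set"
  assumes "zdim K" "compact A" "compact B" "A \<subseteq> K" "B \<subseteq> K" "A \<inter> B = {}"
  obtains N where "compact N" "compact (K - N)" "N \<subseteq> K" "A \<subseteq> N" "N \<inter> B = {}"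
proof -
  obtain d where d: "d > 0" "\<And>x y. x \<in> A \<Longrightarrow> y \<in> B \<Longrightarrow> d \<le> dist x y"
    using separate_compact_closed[OF assms(2) compact_imp_closed[OF assms(3)] assms(6)] by blast
  obtain \<P> where P: "finite \<P>" "pairwise disjnt \<P>" "\<Union>\<P> = K" "\<And>P. P \<in> \<P> \<Longrightarrow> compact P"
    "\<And>P x y. P \<in> \<P> \<Longrightarrow> x \<in> P \<Longrightarrow> y \<in> P \<Longrightarrow> dist x y < d"
    by (rule zdimE[OF assms(1) \<open>d > 0\<close>]) blast
  let ?Q = "{P \<in> \<P>. P \<inter> A \<noteq> {}}"
  show ?thesis
  proof
    show "compact (\<Union>?Q)" using P(1,4) by (intro compact_Union) auto
    have "K - \<Union>?Q = \<Union>(\<P> - ?Q)" using P(2,3) by (fastforce simp: pairwise_def disjnt_def)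
    moreover have "compact (\<Union>(\<P> - ?Q))" using P(1,4) by (intro compact_Union) auto
    ultimately show "compact (K - \<Union>?Q)" by simp
    show "\<Union>?Q \<subseteq> K" "A \<subseteq> \<Union>?Q" using P(3) assms(4) by blast+
    show "\<Union>?Q \<inter> B = {}" using P(5) d(2) by (fastforce simp: not_less[symmetric])
  qed
qed

lemma disjoint_compact_family_dist:
  fixes \<P> :: "'a::euclidean_space set set"
  assumes "finite \<P>" "pairwise disjnt \<P>" "\<And>P. P \<in> \<P> \<Longrightarrow> compact P"
  obtains r where "r > 0"
    "\<And>P Q x y. P \<in> \<P> \<Longrightarrow> Q \<in> \<P> \<Longrightarrow> P \<noteq> Q \<Longrightarrow> x \<in> P \<Longrightarrow> y \<in> Q \<Longrightarrow> r \<le> dist x y"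
proof -
  have "\<exists>d>0. P \<noteq> Q \<longrightarrow> (\<forall>x\<in>P. \<forall>y\<in>Q. d \<le> dist x y)" if "P \<in> \<P>" "Q \<in> \<P>" for P Q
  proof (cases "P = Q")
    case False
    then have "P \<inter> Q = {}" using assms(2) that by (auto simp: pairwise_def disjnt_def)
    then show ?thesis
      using separate_compact_closed[of P Q] assms(3) that compact_imp_closed by metis
  qed (auto intro: exI[of _ 1])
  then obtain d where d: "\<And>P Q. P \<in> \<P> \<Longrightarrow> Q \<in> \<P> \<Longrightarrow> d P Q > 0 \<and> (P \<noteq> Q \<longrightarrow> (\<forall>x\<in>P. \<forall>y\<in>Q. d P Q \<le> dist x y))"
    by metis
  let ?D = "insert (1::real) ((\<lambda>(P,Q). d P Q) ` (\<P> \<times> \<P>))"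
  have fin: "finite ?D" using assms(1) by simp
  show ?thesis
  proof
    show "Min ?D > 0" using fin d by (subst Min_gr_iff) auto
    fix P Q x y assume "P \<in> \<P>" "Q \<in> \<P>" "P \<noteq> Q" "x \<in> P" "y \<in> Q"
    moreover have "Min ?D \<le> d P Q" using fin \<open>P \<in> \<P>\<close> \<open>Q \<in> \<P>\<close> by (intro Min_le) auto
    ultimately show "Min ?D \<le> dist x y" using d by fastforce
  qed
qed

lemma disjoint_compact_family_nhds:
  fixes \<P> :: "'a::euclidean_space set set"
  assumes "finite \<P>" "pairwise disjnt \<P>" "\<And>P. P \<in> \<P> \<Longrightarrow> compact P" "\<Union>\<P> \<subseteq> U" "open U" "e > 0"
  obtains V where "\<And>P. P \<in> \<P> \<Longrightarrow> open (V P) \<and> P \<subseteq> V P \<and> V P \<subseteq> U" "disjoint_family_on V \<P>"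
    "\<And>P y. P \<in> \<P> \<Longrightarrow> y \<in> V P \<Longrightarrow> \<exists>x\<in>P. dist x y < e"
proof -
  obtain r where r: "r > 0"
    "\<And>P Q x y. P \<in> \<P> \<Longrightarrow> Q \<in> \<P> \<Longrightarrow> P \<noteq> Q \<Longrightarrow> x \<in> P \<Longrightarrow> y \<in> Q \<Longrightarrow> r \<le> dist x y"
    by (rule disjoint_compact_family_dist[OF assms(1-3)], assumption+) (rule that; assumption)
  let ?V = "\<lambda>P. U \<inter> (\<Union>x\<in>P. ball x (min e (r/2)))"
  show ?thesis
  proof
    show "open (?V P) \<and> P \<subseteq> ?V P \<and> ?V P \<subseteq> U" if "P \<in> \<P>" for P
      using assms(4-6) r(1) that by auto
    show "disjoint_family_on ?V \<P>"
    proof (unfold disjoint_family_on_def, intro ballI impI, rule ccontr)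
      fix P Q assume PQ: "P \<in> \<P>" "Q \<in> \<P>" "P \<noteq> Q" "?V P \<inter> ?V Q \<noteq> {}"
      then obtain z x y where z: "x \<in> P" "y \<in> Q" "dist x z < r/2" "dist y z < r/2" by auto
      then have "dist x y < r" by (metis dist_triangle_half_l)
      then show False using r(2)[OF PQ(1-3) z(1,2)] by simp
    qed
    show "\<exists>x\<in>P. dist x y < e" if "P \<in> \<P>" "y \<in> ?V P" for P y using that by auto
  qed
qed

section \<open>Movable sets and their permanence properties\<close>

definition movable :: "'a::euclidean_space set \<Rightarrow> bool" where
  "movable K \<longleftrightarrow> (\<forall>U S. open U \<and> K \<subseteq> U \<and> closed S \<and> interior S = {} \<longrightarrow>
     (\<exists>f. supp_homeo U f \<and> f ` K \<inter> S = {}))"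

lemma movableD:
  "movable K \<Longrightarrow> open U \<Longrightarrow> K \<subseteq> U \<Longrightarrow> closed S \<Longrightarrow> interior S = {} \<Longrightarrow> \<exists>f. supp_homeo U f \<and> f ` K \<inter> S = {}"
  unfolding movable_def by blast

text \<open>The image of \<open>S \<inter> V\<close> is closed only relative to \<open>W\<close>, so
  its closure is used as the set to be avoided. The closure adds no point of \<open>W\<close>, and
  it is nowhere dense: a nonempty open subset would meet the image, hence \<open>W\<close>, and pull
  back to a nonempty open subset of \<open>S\<close>.\<close>

lemma movable_homeomorphism:
  fixes K V W :: "'a::euclidean_space set"
  assumes "open V" "open W" "homeomorphism V W h k" "K \<subseteq> V" "movable (h ` K)"
  shows "movable K"
  unfolding movable_def
proof (intro allI impI, elim conjE)
  fix U S :: "'a set" assume U: "open U" "K \<subseteq> U" and S: "closed S" "interior S = {}"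
  have h: "\<And>x. x \<in> V \<Longrightarrow> h x \<in> W" "\<And>y. y \<in> W \<Longrightarrow> k y \<in> V"
    "\<And>x. x \<in> V \<Longrightarrow> k (h x) = x" "\<And>y. y \<in> W \<Longrightarrow> h (k y) = y"
    "continuous_on V h" "continuous_on W k"
    using assms(3) by (auto simp: homeomorphism_def)
  have ih: "inj_on h V" and ik: "inj_on k W" using h by (metis inj_onI)+
  have oU: "open (h ` (U \<inter> V))"
    by (rule invariance_of_domain) (use h U assms(1) ih in \<open>auto intro: continuous_on_subset inj_on_subset\<close>)
  let ?S = "closure (h ` (S \<inter> V))"
  have clo: "W \<inter> ?S = h ` (S \<inter> V)"
  proof -
    have "closedin (top_of_set V) (S \<inter> V)" using closedin_closed_Int[OF S(1), of V] by (simp add: Int_commute)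
    then have "closedin (top_of_set W) (h ` (S \<inter> V))"
      using assms(3) homeomorphism_imp_closed_map by blast
    then obtain T where T: "closed T" "h ` (S \<inter> V) = W \<inter> T" by (auto simp: closedin_closed)
    then have "?S \<subseteq> T" by (intro closure_minimal) auto
    then have "W \<inter> ?S \<subseteq> h ` (S \<inter> V)" using T(2) by blast
    moreover have "h ` (S \<inter> V) \<subseteq> W \<inter> ?S" using h(1) closure_subset[of "h ` (S \<inter> V)"] by auto
    ultimately show ?thesis by blast
  qed
  have "interior ?S = {}"
  proof (rule ccontr)
    assume ne: "interior ?S \<noteq> {}"
    let ?T = "interior ?S \<inter> W"
    have "interior ?S \<inter> h ` (S \<inter> V) \<noteq> {}"
      using ne interior_subset[of ?S] open_Int_closure_eq_empty[of "interior ?S" "h ` (S \<inter> V)"] by auto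
    then have "?T \<noteq> {}" using h(1) by blast
    have "?T \<subseteq> h ` (S \<inter> V)" using clo interior_subset[of ?S] by auto
    then have "k ` ?T \<subseteq> S" using h(3) by auto
    moreover have "open (k ` ?T)"
      by (rule invariance_of_domain) (use h assms(2) ik in \<open>auto intro: continuous_on_subset inj_on_subset\<close>)
    ultimately have "k ` ?T \<subseteq> interior S" by (rule interior_maximal)
    then show False using S(2) \<open>?T \<noteq> {}\<close> by blast
  qed
  then obtain f where f: "supp_homeo (h ` (U \<inter> V)) f" "f ` h ` K \<inter> ?S = {}"
    using movableD[OF assms(5) oU _ closed_closure] U(2) assms(4) by blast
  have hom: "homeomorphism (U \<inter> V) (h ` (U \<inter> V)) h k"
    by (rule homeomorphism_of_subsets[OF assms(3)]) (use h in auto)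
  let ?g = "\<lambda>x. if x \<in> U \<inter> V then k (f (h x)) else x"
  have g: "supp_homeo (U \<inter> V) ?g"
    using supp_homeo_conjugate[OF _ hom f(1)] U(1) assms(1) by blast
  have "?g x \<notin> S" if "x \<in> K" for x
  proof
    assume "?g x \<in> S"
    have x: "x \<in> U \<inter> V" using that U assms(4) by blast
    then have "f (h x) \<in> h ` (U \<inter> V)" using supp_homeo_mem_iff[OF f(1)] by blast
    then obtain y where y: "y \<in> U \<inter> V" "f (h x) = h y" by blast
    then have "y \<in> S" using \<open>?g x \<in> S\<close> x h(3) by simp
    then have "f (h x) \<in> ?S" using y closure_subset[of "h ` (S \<inter> V)"] by auto
    then show False using f(2) that by blast
  qed
  then show "\<exists>g. supp_homeo U g \<and> g ` K \<inter> S = {}"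
    using supp_homeo_mono[OF g, of U] by (intro exI[of _ ?g]) blast
qed

lemma movable_supp_homeo_image:
  fixes K :: "'a::euclidean_space set"
  assumes "movable K" "supp_homeo U f"
  shows "movable (f ` K)"
proof -
  note hom = supp_homeo_homeomorphism[OF assms(2)]
  have "inv f ` f ` K = K" using assms(2) unfolding supp_homeo_def by (simp add: image_inv_f_f)
  then show ?thesis
    using movable_homeomorphism[OF open_UNIV open_UNIV homeomorphism_symD[OF hom], of "f ` K"] assms(1) by simp
qed

lemma movable_disjoint_Union:
  fixes \<P> :: "'a::euclidean_space set set"
  assumes "finite \<P>" "pairwise disjnt \<P>" "\<And>P. P \<in> \<P> \<Longrightarrow> compact P" "\<And>P. P \<in> \<P> \<Longrightarrow> movable P"
  shows "movable (\<Union>\<P>)"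
  unfolding movable_def
proof (intro allI impI, elim conjE)
  fix U S :: "'a set" assume U: "open U" "\<Union>\<P> \<subseteq> U" and S: "closed S" "interior S = {}"
  obtain V where V: "\<And>P. P \<in> \<P> \<Longrightarrow> open (V P) \<and> P \<subseteq> V P \<and> V P \<subseteq> U" "disjoint_family_on V \<P>"
    by (rule disjoint_compact_family_nhds[OF assms(1-3) U(2,1) zero_less_one], assumption+) (rule that; assumption)
  have "\<exists>f. supp_homeo (V P) f \<and> f ` P \<inter> S = {}" if "P \<in> \<P>" for P
    using movableD[OF assms(4)[OF that]] V(1)[OF that] S by blast
  then obtain f where f: "\<And>P. P \<in> \<P> \<Longrightarrow> supp_homeo (V P) (f P) \<and> f P ` P \<inter> S = {}" by metis
  then obtain g where g: "supp_homeo (\<Union>P\<in>\<P>. V P) g" "\<forall>P\<in>\<P>. \<forall>x\<in>V P. g x = f P x"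
    using supp_homeo_glue[OF assms(1) V(2), of f] by blast
  have "supp_homeo U g" using g(1) by (rule supp_homeo_mono) (use V in blast)
  moreover have "g ` \<Union>\<P> \<inter> S = {}" using g(2) f V(1) by fastforce
  ultimately show "\<exists>f. supp_homeo U f \<and> f ` \<Union>\<P> \<inter> S = {}" by blast
qed

text \<open>A Lebesgue number of the cover by the sets \<open>V x\<close> serves as mesh of a clopen
  partition, so every piece lies in one of these sets.\<close>

lemma movable_local:
  fixes K :: "'a::euclidean_space set"
  assumes "zdim K"
    and "\<And>x. x \<in> K \<Longrightarrow> \<exists>V. open V \<and> x \<in> V \<and> (\<forall>L. compact L \<and> L \<subseteq> K \<inter> V \<longrightarrow> movable L)"
  shows "movable K"
proof -
  obtain V where V: "\<And>x. x \<in> K \<Longrightarrow> open (V x) \<and> x \<in> V x \<and> (\<forall>L. compact L \<and> L \<subseteq> K \<inter> V x \<longrightarrow> movable L)"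
    using assms(2) by metis
  obtain e where e: "e > 0" "\<And>x. x \<in> K \<Longrightarrow> \<exists>G\<in>V ` K. ball x e \<subseteq> G"
    using Heine_Borel_lemma[OF zdim_compact[OF assms(1)], of "V ` K"] V by blast
  obtain \<P> where P: "finite \<P>" "pairwise disjnt \<P>" "\<Union>\<P> = K" "\<And>P. P \<in> \<P> \<Longrightarrow> compact P"
    "\<And>P. P \<in> \<P> \<Longrightarrow> P \<noteq> {}"  "\<And>P x y. P \<in> \<P> \<Longrightarrow> x \<in> P \<Longrightarrow> y \<in> P \<Longrightarrow> dist x y < e"
    by (rule zdimE[OF assms(1) \<open>e > 0\<close>]) blast
  have "movable P" if "P \<in> \<P>" for P
  proof -
    have "\<exists>x. x \<in> P" using P(5)[OF that] by blast
    then obtain x where x: "x \<in> P" by blast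
    then have "P \<subseteq> ball x e" using P(6)[OF that x] by auto
    moreover have "x \<in> K" using x that P(3) by blast
    then obtain y where "y \<in> K" "ball x e \<subseteq> V y" using e(2)[of x] by blast
    ultimately show ?thesis using V[of y] P(3,4) that by blast
  qed
  then show ?thesis using movable_disjoint_Union[of \<P>] P by simp
qed

text \<open>After \<open>f\<close> has pushed \<open>A\<close> off \<open>S\<close>, the points of
  \<open>K\<close> that still land in \<open>S\<close> form a compact set disjoint from
  \<open>A\<close>, which fits into a clopen \<open>N\<close> missing \<open>A\<close>. A second
  homeomorphism pushes \<open>f\<close> N\<open>off\<close>S\<open>; its support avoids\<close>f
  \<open>(K - N)\<close>, so nothing already achieved is disturbed.\<close>

lemma movable_extend:
  fixes K :: "'a::euclidean_space set"
  assumes "zdim K" "compact A" "A \<subseteq> K" "movable A" "\<And>N. compact N \<Longrightarrow> N \<subseteq> K - A \<Longrightarrow> movable N"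
  shows "movable K"
  unfolding movable_def
proof (intro allI impI, elim conjE)
  fix U S :: "'a set" assume U: "open U" "K \<subseteq> U" and S: "closed S" "interior S = {}"
  obtain f where f: "supp_homeo U f" "f ` A \<inter> S = {}"
    using movableD[OF assms(4) U(1) _ S] assms(3) U by blast
  have contf: "continuous_on UNIV f" and injf: "inj f" using f(1) unfolding supp_homeo_def by blast+
  let ?T = "K \<inter> f -` S"
  have "closed (f -` S)" using contf S(1) by (simp add: closed_vimage)
  then have "compact ?T" using zdim_compact[OF assms(1)] by blast
  moreover have "?T \<inter> A = {}" using f(2) by blast
  ultimately obtain N where N: "compact N" "compact (K - N)" "N \<subseteq> K" "?T \<subseteq> N" "N \<inter> A = {}"
    using zdim_separate[OF assms(1) _ assms(2), of ?T] assms(3) by blast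
  have "movable N" using assms(5) N by blast
  then have mv: "movable (f ` N)" using movable_supp_homeo_image f(1) by blast
  let ?U = "U - f ` (K - N)"
  have "compact (f ` (K - N))" using N(2) contf by (meson compact_continuous_image continuous_on_subset subset_UNIV)
  then have oU: "open ?U" using U(1) by (simp add: compact_imp_closed open_Diff)
  have "f ` N \<subseteq> ?U"
  proof
    fix y assume "y \<in> f ` N"
    then obtain x where x: "x \<in> N" "y = f x" by blast
    then have "y \<in> U" using supp_homeo_mem_iff[OF f(1)] N(3) U(2) by blast
    moreover have "y \<notin> f ` (K - N)" using x injf by (auto dest: injD)
    ultimately show "y \<in> ?U" by blast
  qed
  then obtain g where g: "supp_homeo ?U g" "g ` f ` N \<inter> S = {}"
    using movableD[OF mv oU _ S] by blast
  have "supp_homeo U (\<lambda>x. g (f x))"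
    by (rule supp_homeo_compose) (use f(1) g(1) in \<open>auto intro: supp_homeo_mono\<close>)
  moreover have "g (f x) \<notin> S" if "x \<in> K" for x
  proof (cases "x \<in> N")
    case False
    then have "f x \<notin> ?U" using that by blast
    then have "g (f x) = f x" using supp_homeo_outside[OF g(1)] by blast
    then show ?thesis using N(4) that False by auto
  qed (use g(2) in blast)
  ultimately show "\<exists>f. supp_homeo U f \<and> f ` K \<inter> S = {}"
    by (intro exI[of _ "\<lambda>x. g (f x)"]) blast
qed

text \<open>The closed sets may overlap. One of them is treated at a time: what remains to be shown
  movable by \<open>movable_extend\<close> is compact and misses it, hence is covered by the
  others.\<close>

lemma movable_finite_Union:
  fixes K :: "'a::euclidean_space set"
  assumes "finite \<A>" "zdim K" "K \<subseteq> \<Union>\<A>" "\<And>A. A \<in> \<A> \<Longrightarrow> closed A"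
    "\<And>A L. A \<in> \<A> \<Longrightarrow> compact L \<Longrightarrow> L \<subseteq> K \<inter> A \<Longrightarrow> movable L"
  shows "movable K"
  using assms
proof (induction \<A> arbitrary: K rule: finite_induct)
  case empty
  then have "K = {}" by simp
  then show ?case unfolding movable_def using supp_homeo_id by blast
next
  case (insert A \<A>)
  show ?case
  proof (rule movable_extend[OF insert.prems(1)])
    show cA: "compact (K \<inter> A)"
      using zdim_compact[OF insert.prems(1)] insert.prems(3) by blast
    show "movable (K \<inter> A)" using insert.prems(4)[of A] cA by blast
    fix N assume N: "compact N" "N \<subseteq> K - K \<inter> A"
    show "movable N"
    proof (rule insert.IH)
      show "zdim N" using zdim_subset[OF insert.prems(1) N(1)] N(2) by blast
      show "N \<subseteq> \<Union>\<A>" using N(2) insert.prems(2) by blast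
      show "closed B" if "B \<in> \<A>" for B using insert.prems(3) that by blast
      show "movable L" if "B \<in> \<A>" "compact L" "L \<subseteq> N \<inter> B" for B L
        using insert.prems(4)[of B L] that N(2) by blast
    qed
  qed blast
qed

section \<open>Movability of zero-dimensional compacta in a hyperplane\<close>

lemma infdist_lipschitz: "\<bar>infdist x A - infdist y A\<bar> \<le> dist x y"
  using infdist_triangle[of x A y] infdist_triangle[of y A x] by (simp add: dist_commute abs_le_iff)

text \<open>Two points with the same image differ by \<open>\<bar>w x - w y\<bar>\<close> in length,
  which a Lipschitz constant below 1 excludes unless they coincide.\<close>

lemma supp_homeo_lipschitz_shift:
  fixes e :: "'a::euclidean_space"
  assumes "norm e = 1" "\<And>x y. \<bar>w x - w y\<bar> \<le> c * dist x y" "c < 1"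
    "compact C" "C \<subseteq> U" "\<And>x. x \<notin> C \<Longrightarrow> w x = 0"
  shows "supp_homeo U (\<lambda>x. x + w x *\<^sub>R e)"
proof -
  have "continuous_on UNIV w"
  proof (rule lipschitz_on_continuous_on)
    have "\<bar>w x - w y\<bar> \<le> max 0 c * dist x y" for x y
      using assms(2)[of x y] mult_right_mono[of c "max 0 c" "dist x y"] by simp
    then show "(max 0 c)-lipschitz_on UNIV w" by (auto intro!: lipschitz_onI simp: dist_real_def)
  qed
  then have "continuous_on UNIV (\<lambda>x. x + w x *\<^sub>R e)" by (intro continuous_intros)
  moreover have "inj (\<lambda>x. x + w x *\<^sub>R e)"
  proof (rule injI)
    fix x y assume "x + w x *\<^sub>R e = y + w y *\<^sub>R e"
    then have "x - y = (w y - w x) *\<^sub>R e" by (simp add: algebra_simps)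
    then have "dist x y = \<bar>w x - w y\<bar>" using assms(1) by (simp add: dist_norm abs_minus_commute)
    then have "dist x y \<le> c * dist x y" using assms(2)[of x y] by simp
    then have "(1 - c) * dist x y \<le> 0" by (simp add: algebra_simps)
    then show "x = y" using assms(3) by (simp add: mult_le_0_iff)
  qed
  ultimately show ?thesis using assms(4-6) unfolding supp_homeo_def by (auto intro!: exI[of _ C])
qed

text \<open>A shift along the normal \<open>e\<close> puts the small clopen pieces at different
  heights. Each then lies in a convex open slab inside \<open>U\<close>, the slabs are disjoint, and
  none is contained in the nowhere dense \<open>S\<close>; so every piece can be compressed, within
  its slab, into the complement of \<open>S\<close>.\<close>

lemma movable_in_hyperplane:
  fixes K :: "'a::euclidean_space set"
  assumes "zdim K" "norm e = 1" "\<And>x. x \<in> K \<Longrightarrow> x \<bullet> e = c"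
  shows "movable K"
  unfolding movable_def
proof (intro allI impI, elim conjE)
  fix U S :: "'a set" assume U: "open U" "K \<subseteq> U" and S: "closed S" "interior S = {}"
  obtain d where d: "d > 0" "\<And>x. x \<in> K \<Longrightarrow> ball x d \<subseteq> U"
    using Heine_Borel_lemma[OF zdim_compact[OF assms(1)], of "{U}"] U by auto
  obtain \<P> where P: "finite \<P>" "pairwise disjnt \<P>" "\<Union>\<P> = K" "\<And>P. P \<in> \<P> \<Longrightarrow> compact P"
    "\<And>P. P \<in> \<P> \<Longrightarrow> P \<noteq> {}"  "\<And>P x y. P \<in> \<P> \<Longrightarrow> x \<in> P \<Longrightarrow> y \<in> P \<Longrightarrow> dist x y < d / 4"
    by (rule zdimE[OF assms(1), of "d/4"]) (use d(1) in auto)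
  obtain r0 where r0: "r0 > 0"
    "\<And>P Q x y. P \<in> \<P> \<Longrightarrow> Q \<in> \<P> \<Longrightarrow> P \<noteq> Q \<Longrightarrow> x \<in> P \<Longrightarrow> y \<in> Q \<Longrightarrow> r0 \<le> dist x y"
    by (rule disjoint_compact_family_dist[OF P(1,2,4)], assumption+) (rule that; assumption)
  \<comment> \<open>Radius of influence of the shift around each piece: at most \<open>r0\<close>,
    so that the shift of one piece does not act on another, and at most \<open>d/4\<close>, so that
    the support stays in \<open>U\<close>.\<close>
  define r where "r = min r0 (d/4)"
  have r: "r > 0" "r \<le> r0" "r \<le> d / 4" using r0(1) d(1) by (auto simp: r_def)
  define N where "N = card \<P>"
  obtain idx where idx: "bij_betw idx \<P> {0..<N}" using ex_bij_betw_finite_nat[OF P(1)] N_def by blast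
  \<comment> \<open>Spacing of the heights. The heights are \<open>q\<close>, ...,
    \<open>N * q\<close>, each at most \<open>r / (real N + 1)\<close>; hence their sum is below
    \<open>r\<close>, and the shift, whose Lipschitz constant is at most this sum over
    \<open>r\<close>, is injective.\<close>
  define q where "q = r / (real N + 1)^2"
  have q: "q > 0" using r by (simp add: q_def)
  define h where "h = (\<lambda>P. q * (real (idx P) + 1))"
  have idx_less: "idx P < N" if "P \<in> \<P>" for P using idx that by (auto simp: bij_betw_def)
  have hpos: "h P > 0" for P using q by (simp add: h_def)
  have hle: "h P \<le> r / (real N + 1)" if "P \<in> \<P>" for P
  proof -
    have "real (idx P) + 1 \<le> real N + 1" using idx_less[OF that] by simp
    then have "h P \<le> q * (real N + 1)" using q unfolding h_def by (intro mult_left_mono) auto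
    also have "\<dots> = r / (real N + 1)" unfolding q_def by (simp add: power2_eq_square divide_simps)
    finally show ?thesis .
  qed
  have hgap: "q \<le> \<bar>h P - h Q\<bar>" if "P \<in> \<P>" "Q \<in> \<P>" "P \<noteq> Q" for P Q
  proof -
    have "idx P \<noteq> idx Q" using idx that by (auto simp: bij_betw_def inj_on_def)
    then have "1 \<le> \<bar>real (idx P) - real (idx Q)\<bar>" by linarith
    then have "q * 1 \<le> q * \<bar>real (idx P) - real (idx Q)\<bar>" using q by (intro mult_left_mono) auto
    also have "\<dots> = \<bar>q * (real (idx P) - real (idx Q))\<bar>" using q by (simp add: abs_mult)
    also have "q * (real (idx P) - real (idx Q)) = h P - h Q" by (simp add: h_def algebra_simps)
    finally show ?thesis by simp
  qed
  have hsum: "(\<Sum>P\<in>\<P>. h P) / r < 1"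
  proof -
    have "(\<Sum>P\<in>\<P>. h P) \<le> real (card \<P>) * (r / (real N + 1))" using sum_bounded_above[of \<P> h] hle by blast
    also have "\<dots> < r" using r(1) by (simp add: N_def field_simps)
    finally show ?thesis using r(1) by simp
  qed
  \<comment> \<open>A bump that is 1 on \<open>P\<close>, vanishes from distance \<open>r\<close> on
    and has Lipschitz constant \<open>1 / r\<close>.\<close>
  define b where "b = (\<lambda>(P :: 'a set) x. max 0 (1 - infdist x P / r))"
  define w where "w = (\<lambda>x. \<Sum>P\<in>\<P>. h P * b P x)"
  have b_lip: "\<bar>b P x - b P y\<bar> \<le> dist x y / r" for P :: "'a set" and x y
  proof -
    have "\<bar>b P x - b P y\<bar> \<le> \<bar>infdist x P / r - infdist y P / r\<bar>" unfolding b_def by linarith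
    also have "\<dots> = \<bar>infdist x P - infdist y P\<bar> / r" using r(1) by (simp add: diff_divide_distrib[symmetric])
    also have "\<dots> \<le> dist x y / r" using infdist_lipschitz r(1) by (intro divide_right_mono) auto
    finally show ?thesis .
  qed
  have w_lip: "\<bar>w x - w y\<bar> \<le> (\<Sum>P\<in>\<P>. h P) / r * dist x y" for x y
  proof -
    have "\<bar>w x - w y\<bar> = \<bar>\<Sum>P\<in>\<P>. h P * (b P x - b P y)\<bar>"
      by (simp add: w_def sum_subtractf right_diff_distrib)
    also have "\<dots> \<le> (\<Sum>P\<in>\<P>. \<bar>h P * (b P x - b P y)\<bar>)" by (rule sum_abs)
    also have "\<dots> \<le> (\<Sum>P\<in>\<P>. h P * (dist x y / r))"
    proof (rule sum_mono)
      fix P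
      have "\<bar>h P * (b P x - b P y)\<bar> = h P * \<bar>b P x - b P y\<bar>" using hpos[of P] by (simp add: abs_mult)
      also have "\<dots> \<le> h P * (dist x y / r)" using b_lip hpos[of P] by (intro mult_left_mono) auto
      finally show "\<bar>h P * (b P x - b P y)\<bar> \<le> h P * (dist x y / r)" .
    qed
    also have "\<dots> = (\<Sum>P\<in>\<P>. h P) / r * dist x y" by (simp add: sum_distrib_right sum_divide_distrib)
    finally show ?thesis .
  qed
  have w_P: "w x = h P" if "P \<in> \<P>" "x \<in> P" for P x
  proof -
    have "b Q x = (if Q = P then 1 else 0)" if "Q \<in> \<P>" for Q
    proof (cases "Q = P")
      case True
      then show ?thesis using \<open>x \<in> P\<close> by (simp add: b_def)
    next
      case False
      have "r0 \<le> infdist x Q"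
        unfolding infdist_notempty[OF P(5)[OF \<open>Q \<in> \<P>\<close>]]
        using r0(2)[OF \<open>P \<in> \<P>\<close> \<open>Q \<in> \<P>\<close>] False \<open>x \<in> P\<close> P(5)[OF \<open>Q \<in> \<P>\<close>] by (intro cINF_greatest) auto
      then have "1 \<le> infdist x Q / r" using r by simp
      then show ?thesis using False by (simp add: b_def)
    qed
    then have "w x = (\<Sum>Q\<in>\<P>. if Q = P then h Q else 0)" unfolding w_def by (intro sum.cong) auto
    then show ?thesis using P(1) that(1) by simp
  qed
  define C where "C = (\<Union>P\<in>\<P>. {x. infdist x P \<le> r})"
  have "compact C" unfolding C_def using P(1,4,5) r(1) by (intro compact_UN compact_infdist_le) auto
  moreover have "C \<subseteq> U"
  proof
    fix x assume "x \<in> C"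
    then obtain P where Px: "P \<in> \<P>" "infdist x P \<le> r" by (auto simp: C_def)
    obtain p where p: "p \<in> P" "infdist x P = dist x p"
      using infdist_attains_inf[OF compact_imp_closed[OF P(4)[OF Px(1)]] P(5)[OF Px(1)]] by blast
    have "dist p x < d" using Px(2) p(2) r(3) d(1) by (simp add: dist_commute)
    moreover have "p \<in> K" using p(1) Px(1) P(3) by blast
    ultimately show "x \<in> U" using d(2)[of p] by auto
  qed
  moreover have "w x = 0" if "x \<notin> C" for x
  proof -
    have "b P x = 0" if "P \<in> \<P>" for P
    proof -
      have "infdist x P > r" using \<open>x \<notin> C\<close> that by (auto simp: C_def)
      then show ?thesis using r(1) by (simp add: b_def)
    qed
    then show ?thesis by (simp add: w_def)
  qed
  ultimately have sh: "supp_homeo U (\<lambda>x. x + w x *\<^sub>R e)" (is "supp_homeo U ?g")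
    using supp_homeo_lipschitz_shift[OF assms(2) w_lip hsum] by blast
  \<comment> \<open>The half-thickness \<open>q/2\<close> is half the smallest difference of
    heights, which makes the slabs disjoint.\<close>
  define Z where "Z = (\<lambda>P. ball (SOME p. p \<in> P) d \<inter> {y. \<bar>y \<bullet> e - (c + h P)\<bar> < q/2})"
  have Zslab: "{y. \<bar>y \<bullet> e - (c + h P)\<bar> < q/2} = {y. e \<bullet> y < c + h P + q/2} \<inter> {y. e \<bullet> y > c + h P - q/2}" for P
    by (intro set_eqI) (smt (verit) Int_iff mem_Collect_eq inner_commute field_sum_of_halves)
  have Zprop: "open (Z P)" "convex (Z P)" "bounded (Z P)" for P
    unfolding Z_def Zslab
    by (auto intro!: open_Int convex_Int open_halfspace_lt open_halfspace_gt convex_halfspace_lt convex_halfspace_gt bounded_Int)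
  have some: "(SOME p. p \<in> P) \<in> P" if "P \<in> \<P>" for P using P(5)[OF that] by (simp add: some_in_eq)
  have gP: "?g ` P \<subseteq> Z P" if P_mem: "P \<in> \<P>" for P
  proof
    fix y assume "y \<in> ?g ` P"
    then obtain x where x: "x \<in> P" "y = x + h P *\<^sub>R e" using w_P[OF P_mem] by auto
    have "e \<bullet> e = 1" using assms(2) by (simp add: dot_square_norm)
    moreover have "x \<bullet> e = c" using x(1) that assms(3) P(3) by blast
    ultimately have "y \<bullet> e = c + h P" using x(2) by (simp add: inner_left_distrib)
    have "h P \<le> r"
    proof -
      have "r / (real N + 1) \<le> r" using r(1) by (simp add: field_simps)
      then show ?thesis using hle[OF that] by linarith
    qed
    then have "dist x y \<le> d / 4" using x(2) assms(2) r(3) hpos[of P] by (simp add: dist_norm)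
    moreover have "dist (SOME p. p \<in> P) x < d / 4" using P(6)[OF that some[OF that] x(1)] .
    ultimately have "dist (SOME p. p \<in> P) y < d"
      using dist_triangle[of "SOME p. p \<in> P" y x] d(1) by linarith
    then show "y \<in> Z P" using \<open>y \<bullet> e = c + h P\<close> q by (simp add: Z_def)
  qed
  have Zdis: "disjoint_family_on Z \<P>"
  proof (unfold disjoint_family_on_def, intro ballI impI, rule ccontr)
    fix P Q assume PQ: "P \<in> \<P>" "Q \<in> \<P>" "P \<noteq> Q" "Z P \<inter> Z Q \<noteq> {}"
    then obtain y where "\<bar>y \<bullet> e - (c + h P)\<bar> < q/2" "\<bar>y \<bullet> e - (c + h Q)\<bar> < q/2" by (auto simp: Z_def)
    then have "\<bar>h P - h Q\<bar> < q" by linarith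
    then show False using hgap[OF PQ(1-3)] by simp
  qed
  have ZU: "Z P \<subseteq> U" if "P \<in> \<P>" for P
    using d(2)[of "SOME p. p \<in> P"] some[OF that] that P(3) unfolding Z_def by blast
  have contg: "continuous_on UNIV ?g" using sh unfolding supp_homeo_def by blast
  have "\<exists>f. supp_homeo (Z P) f \<and> f ` ?g ` P \<subseteq> - S" if "P \<in> \<P>" for P
  proof (rule compress_in_convex[OF Zprop _ gP[OF that]])
    show "compact (?g ` P)"
      using P(4)[OF that] contg by (meson compact_continuous_image continuous_on_subset subset_UNIV)
    show "open (- S)" using S(1) by blast
    show "- S \<inter> Z P \<noteq> {}"
    proof
      assume "- S \<inter> Z P = {}"
      then have "Z P \<subseteq> interior S" using Zprop(1) by (intro interior_maximal) auto
      then show False using S(2) gP[OF that] P(5)[OF that] by auto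
    qed
  qed
  then obtain f where f: "\<And>P. P \<in> \<P> \<Longrightarrow> supp_homeo (Z P) (f P) \<and> f P ` ?g ` P \<subseteq> - S" by metis
  then obtain k where k: "supp_homeo (\<Union>P\<in>\<P>. Z P) k" "\<forall>P\<in>\<P>. \<forall>x\<in>Z P. k x = f P x"
    using supp_homeo_glue[OF P(1) Zdis, of f] by blast
  have "supp_homeo U k" using k(1) by (rule supp_homeo_mono) (use ZU in blast)
  then have "supp_homeo U (\<lambda>x. k (?g x))" using sh by (rule supp_homeo_compose)
  moreover have "k (?g x) \<notin> S" if x: "x \<in> K" for x
  proof -
    obtain P where Px: "P \<in> \<P>" "x \<in> P" using x P(3) by blast
    then have "?g x \<in> Z P" using gP by blast
    then have "k (?g x) = f P (?g x)" using k(2) Px by blast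
    then show ?thesis using f[OF Px(1)] Px(2) by auto
  qed
  ultimately show "\<exists>f. supp_homeo U f \<and> f ` K \<inter> S = {}"
    by (intro exI[of _ "\<lambda>x. k (?g x)"]) auto
qed

section \<open>Movable zero-dimensional compacta are tame\<close>

text \<open>The homeomorphism preserves disjoint neighbourhoods of the pieces of a fine partition
  and is the identity outside them. Two points of such a neighbourhood are within \<open>e/4\<close>
  of points of one piece of mesh \<open>e/4\<close>, so no point moves by as much as
  \<open>e\<close>.\<close>

lemma movable_small:
  fixes K :: "'a::euclidean_space set"
  assumes "zdim K" "\<And>L. compact L \<Longrightarrow> L \<subseteq> K \<Longrightarrow> movable L" "closed S" "interior S = {}" "e > 0"
  shows "\<exists>f. supp_homeo UNIV f \<and> f ` K \<inter> S = {} \<and> (\<forall>x. dist (f x) x < e)"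
proof -
  have e4: "e / 4 > 0" using assms(5) by simp
  obtain \<P> where P: "finite \<P>" "pairwise disjnt \<P>" "\<Union>\<P> = K" "\<And>P. P \<in> \<P> \<Longrightarrow> compact P"
    "\<And>P. P \<in> \<P> \<Longrightarrow> P \<noteq> {}"  "\<And>P x y. P \<in> \<P> \<Longrightarrow> x \<in> P \<Longrightarrow> y \<in> P \<Longrightarrow> dist x y < e / 4"
    by (rule zdimE[OF assms(1) e4]) blast
  obtain V where V: "\<And>P. P \<in> \<P> \<Longrightarrow> open (V P) \<and> P \<subseteq> V P \<and> V P \<subseteq> UNIV" "disjoint_family_on V \<P>"
    "\<And>P y. P \<in> \<P> \<Longrightarrow> y \<in> V P \<Longrightarrow> \<exists>x\<in>P. dist x y < e / 4"
    by (rule disjoint_compact_family_nhds[OF P(1,2,4) subset_UNIV open_UNIV e4], assumption+) (rule that; assumption)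
  have "\<exists>f. supp_homeo (V P) f \<and> f ` P \<inter> S = {}" if "P \<in> \<P>" for P
  proof -
    have "movable P" using assms(2)[OF P(4)[OF that]] P(3) that by blast
    then show ?thesis using movableD V(1)[OF that] assms(3,4) by metis
  qed
  then obtain f where f: "\<And>P. P \<in> \<P> \<Longrightarrow> supp_homeo (V P) (f P) \<and> f P ` P \<inter> S = {}" by metis
  then obtain g where g: "supp_homeo (\<Union>P\<in>\<P>. V P) g" "\<forall>P\<in>\<P>. \<forall>x\<in>V P. g x = f P x"
    using supp_homeo_glue[OF P(1) V(2), of f] by blast
  show ?thesis
  proof (intro exI[of _ g] conjI allI)
    show "supp_homeo UNIV g" using g(1) by (rule supp_homeo_mono) simp
    show "g ` K \<inter> S = {}"
    proof (intro equals0I, elim IntE imageE)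
      fix y x assume y: "y \<in> S" "y = g x" "x \<in> K"
      then obtain P where Px: "P \<in> \<P>" "x \<in> P" using P(3) by blast
      then have "g x = f P x" using g(2) V(1) by blast
      then show False using f[OF Px(1)] Px(2) y by auto
    qed
    show "dist (g x) x < e" for x
    proof (cases "x \<in> (\<Union>P\<in>\<P>. V P)")
      case True
      then obtain P where Px: "P \<in> \<P>" "x \<in> V P" by blast
      then have "g x = f P x" using g(2) by blast
      then have gx: "g x \<in> V P" using supp_homeo_mem_iff f[OF Px(1)] Px(2) by metis
      obtain a where a: "a \<in> P" "dist a x < e/4" using V(3)[OF Px] by blast
      obtain b where b: "b \<in> P" "dist b (g x) < e/4" using V(3)[OF Px(1) gx] by blast
      have "dist (g x) x \<le> dist b (g x) + dist b a + dist a x"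
        using dist_triangle[of "g x" x b] dist_triangle[of b x a] by (simp add: dist_commute)
      also have "\<dots> < e" using P(6)[OF Px(1) b(1) a(1)] a(2) b(2) assms(5) by linarith
      finally show ?thesis .
    next
      case False
      then show ?thesis using supp_homeo_outside[OF g(1)] assms(5) by simp
    qed
  qed
qed

section \<open>Separating the levels of a linear functional by cubical grids\<close>

definition grid :: "real \<Rightarrow> 'a::euclidean_space set" where
  "grid d = (\<Union>b\<in>Basis. \<Union>k. {x. b \<bullet> x = d * of_int k})"

lemma closed_grid:
  assumes "d > 0"
  shows "closed (grid d :: 'a::euclidean_space set)"
proof -
  have "closed (\<Union>k. {x::'a. b \<bullet> x = d * of_int k})" for b
  proof -
    have "(\<Union>k. {x::'a. b \<bullet> x = d * of_int k}) = (\<lambda>x. b \<bullet> x / d) -` \<int>"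
      using assms by (auto simp: field_simps Ints_def)
    moreover have "closed ((\<lambda>x. b \<bullet> x / d) -` \<int>)"
      by (intro closed_vimage closed_Ints continuous_intros) (use assms in auto)
    ultimately show ?thesis by simp
  qed
  then show ?thesis unfolding grid_def by (intro closed_UN) auto
qed

lemma interior_grid: "interior (grid d :: 'a::euclidean_space set) = {}"
proof -
  have "negligible (\<Union>k. {x::'a. b \<bullet> x = d * of_int k})" if "b \<in> Basis" for b
  proof (rule negligible_countable_Union)
    show "countable (range (\<lambda>k. {x::'a. b \<bullet> x = d * of_int k}))" by simp
    show "negligible S" if "S \<in> range (\<lambda>k. {x::'a. b \<bullet> x = d * of_int k})" for S
      using negligible_hyperplane[of b] \<open>b \<in> Basis\<close> nonzero_Basis that by auto
  qed
  then have "negligible (grid d :: 'a set)" unfolding grid_def by (intro negligible_Union) auto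
  then show ?thesis
    using open_not_negligible[of "interior (grid d)"] negligible_subset interior_subset by blast
qed

text \<open>\<open>B x\<close> is the open cell whose lower corner comes from rounding down the
  coordinates of \<open>x\<close>. A grid point gets a cell that does not contain it; all points of
  one cell name the same cell, which makes the cells disjoint. The diameter is bounded through the
  sum norm.\<close>

lemma outside_grid_boxes:
  assumes "d > 0"
  shows "\<exists>B :: 'a::euclidean_space \<Rightarrow> 'a set. (\<forall>x. open (B x) \<and> convex (B x) \<and> bounded (B x)) \<and>
    (\<forall>x. x \<notin> grid d \<longrightarrow> x \<in> B x) \<and> (\<forall>x. \<forall>y\<in>B x. B y = B x) \<and>
    (\<forall>x. \<forall>y\<in>B x. \<forall>z\<in>B x. dist y z \<le> d * real DIM('a))"
proof -
  define lo where "lo = (\<lambda>x::'a. \<Sum>b\<in>Basis. (d * of_int \<lfloor>(b \<bullet> x) / d\<rfloor>) *\<^sub>R b)"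
  define B where "B = (\<lambda>x. box (lo x) (lo x + d *\<^sub>R One))"
  have lo: "lo x \<bullet> b = d * of_int \<lfloor>(b \<bullet> x) / d\<rfloor>" if "b \<in> Basis" for x b
    using that by (simp add: lo_def)
  have mem: "y \<in> B x \<longleftrightarrow> (\<forall>b\<in>Basis. d * of_int \<lfloor>(b \<bullet> x) / d\<rfloor> < b \<bullet> y \<and> b \<bullet> y < d * of_int \<lfloor>(b \<bullet> x) / d\<rfloor> + d)" for x y
    unfolding B_def by (simp add: mem_box inner_add_left lo inner_commute[of y])
  have "open (B x) \<and> convex (B x) \<and> bounded (B x)" for x unfolding B_def by auto
  moreover have "x \<in> B x" if "x \<notin> grid d" for x
  proof (unfold mem, intro ballI)
    fix b :: 'a assume b: "b \<in> Basis"
    have "b \<bullet> x \<noteq> d * of_int \<lfloor>(b \<bullet> x) / d\<rfloor>" using that b by (auto simp: grid_def)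
    moreover have "d * of_int \<lfloor>u\<rfloor> \<le> d * u" "d * u < d * (of_int \<lfloor>u\<rfloor> + 1)" for u :: real
      using assms by (simp_all add: mult_left_mono mult_strict_left_mono)
    from this[of "(b \<bullet> x) / d"]
    have "d * of_int \<lfloor>(b \<bullet> x) / d\<rfloor> \<le> b \<bullet> x" "b \<bullet> x < d * of_int \<lfloor>(b \<bullet> x) / d\<rfloor> + d"
      using assms by (simp_all add: distrib_left)
    ultimately show "d * of_int \<lfloor>(b \<bullet> x) / d\<rfloor> < b \<bullet> x \<and> b \<bullet> x < d * of_int \<lfloor>(b \<bullet> x) / d\<rfloor> + d" by linarith
  qed
  moreover have "B y = B x" if "y \<in> B x" for x y
  proof -
    have "\<lfloor>(b \<bullet> y) / d\<rfloor> = \<lfloor>(b \<bullet> x) / d\<rfloor>" if "b \<in> Basis" for b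
    proof (rule floor_unique)
      have "d * of_int \<lfloor>(b \<bullet> x) / d\<rfloor> < b \<bullet> y" "b \<bullet> y < d * of_int \<lfloor>(b \<bullet> x) / d\<rfloor> + d"
        using \<open>y \<in> B x\<close> that by (auto simp: mem)
      then show "of_int \<lfloor>(b \<bullet> x) / d\<rfloor> \<le> (b \<bullet> y) / d" "(b \<bullet> y) / d < of_int \<lfloor>(b \<bullet> x) / d\<rfloor> + 1"
        using assms by (simp_all add: field_simps)
    qed
    then show ?thesis by (auto simp: mem)
  qed
  moreover have "dist y z \<le> d * real DIM('a)" if "y \<in> B x" "z \<in> B x" for x y z
  proof -
    have "dist y z \<le> (\<Sum>b\<in>Basis. \<bar>(y - z) \<bullet> b\<bar>)" unfolding dist_norm by (rule norm_le_l1)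
    also have "\<dots> \<le> (\<Sum>b\<in>(Basis::'a set). d)"
    proof (rule sum_mono)
      fix b :: 'a assume "b \<in> Basis"
      then show "\<bar>(y - z) \<bullet> b\<bar> \<le> d" using that unfolding mem by (smt (verit) inner_commute inner_diff_left)
    qed
    also have "\<dots> = d * real DIM('a)" by simp
    finally show ?thesis .
  qed
  ultimately show ?thesis by blast
qed

text \<open>Sliding a point of the next open set along \<open>e\<close> changes its level
  continuously, and only finitely many positions are forbidden.\<close>

lemma distinct_levels:
  fixes e :: "'a::euclidean_space"
  assumes "finite \<B>" "norm e = 1" "\<And>B. B \<in> \<B> \<Longrightarrow> open B \<and> B \<noteq> {}"
  shows "\<exists>z. (\<forall>B\<in>\<B>. z B \<in> B) \<and> inj_on (\<lambda>B. z B \<bullet> e) \<B>"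
  using assms(1,3)
proof (induction \<B> rule: finite_induct)
  case (insert B \<B>)
  then obtain z where z: "\<forall>A\<in>\<B>. z A \<in> A" "inj_on (\<lambda>A. z A \<bullet> e) \<B>" by blast
  obtain p r where p: "r > 0" "ball p r \<subseteq> B" using insert.prems by (metis insertI1 ex_in_conv open_contains_ball)
  have "infinite ({0<..<r} - (\<lambda>A. z A \<bullet> e - p \<bullet> e) ` \<B>)"
    using p(1) insert.hyps(1) by (simp add: infinite_Ioo Diff_infinite_finite)
  from infinite_imp_nonempty[OF this]
  obtain t where t: "0 < t" "t < r" "t \<notin> (\<lambda>A. z A \<bullet> e - p \<bullet> e) ` \<B>" by force
  have ee: "e \<bullet> e = 1" using assms(2) by (simp add: dot_square_norm)
  have "p + t *\<^sub>R e \<in> B" using p(2) t assms(2) by (auto simp: dist_norm)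
  moreover have "(p + t *\<^sub>R e) \<bullet> e \<noteq> z A \<bullet> e" if "A \<in> \<B>" for A
  proof
    assume "(p + t *\<^sub>R e) \<bullet> e = z A \<bullet> e"
    then have "t = z A \<bullet> e - p \<bullet> e" using ee by (simp add: inner_left_distrib)
    then show False using t(3) that by blast
  qed
  ultimately have new: "p + t *\<^sub>R e \<in> B" "\<And>A. A \<in> \<B> \<Longrightarrow> (p + t *\<^sub>R e) \<bullet> e \<noteq> z A \<bullet> e"
    by blast+
  define z' where "z' = z(B := p + t *\<^sub>R e)"
  have z': "z' B = p + t *\<^sub>R e" "\<And>A. A \<in> \<B> \<Longrightarrow> z' A = z A"
    using insert.hyps(2) by (auto simp: z'_def)
  have "z' A \<in> A" if "A \<in> insert B \<B>" for A using that z' new(1) z(1) by auto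
  moreover have "inj_on (\<lambda>A. z' A \<bullet> e) \<B>" using z(2) z'(2) by (simp cong: inj_on_cong)
  then have "inj_on (\<lambda>A. z' A \<bullet> e) (insert B \<B>)"
    unfolding inj_on_insert using z' new(2) by auto
  ultimately show ?case by blast
qed auto

text \<open>Once \<open>K\<close> is off a fine grid, the part in each cell can be compressed within
  the cell into a thin slab around a level belonging to that cell alone. Points on a common level
  then come from one cell, and the cells are too small to hold images of points at distance
  \<open>\<epsilon>\<close>.\<close>

lemma separating_step:
  fixes K :: "'a::euclidean_space set"
  assumes "zdim K" "\<And>L. compact L \<Longrightarrow> L \<subseteq> K \<Longrightarrow> movable L" "norm e = 1" "\<epsilon> > 0"
  obtains f where "supp_homeo UNIV f" "\<And>x. dist (f x) x < \<epsilon>"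
    "\<And>x y. x \<in> K \<Longrightarrow> y \<in> K \<Longrightarrow> \<epsilon> \<le> dist x y \<Longrightarrow> f x \<bullet> e \<noteq> f y \<bullet> e"
proof -
  \<comment> \<open>Cells get diameter at most \<open>\<epsilon> / 4\<close>. As \<open>f\<close>
    moves points by less than \<open>\<epsilon> / 4\<close>, two points sent into one cell are less
    than three quarters of \<open>\<epsilon>\<close> apart.\<close>
  define d where "d = \<epsilon> / (4 * real DIM('a))"
  have d: "d > 0" "d * real DIM('a) = \<epsilon> / 4" using assms(4) by (auto simp: d_def)
  have e4: "\<epsilon> / 4 > 0" using assms(4) by simp
  obtain f where f: "supp_homeo UNIV f" "f ` K \<inter> grid d = {}" "\<And>x. dist (f x) x < \<epsilon> / 4"
    using movable_small[OF assms(1,2) closed_grid[OF d(1)] interior_grid e4] by blast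
  obtain B :: "'a \<Rightarrow> 'a set" where B: "\<And>x. open (B x)" "\<And>x. convex (B x)" "\<And>x. bounded (B x)"
    "\<And>x. x \<notin> grid d \<Longrightarrow> x \<in> B x" "\<And>x y. y \<in> B x \<Longrightarrow> B y = B x"
    "\<And>x y z. y \<in> B x \<Longrightarrow> z \<in> B x \<Longrightarrow> dist y z \<le> d * real DIM('a)"
    using outside_grid_boxes[OF d(1)] by metis
  have contf: "continuous_on UNIV f" using f(1) unfolding supp_homeo_def by blast
  have cK: "compact (f ` K)"
    using zdim_compact[OF assms(1)] contf by (meson compact_continuous_image continuous_on_subset subset_UNIV)
  have mem: "y \<in> B y" if "y \<in> f ` K" for y using B(4) f(2) that by blast
  obtain F where F: "finite F" "F \<subseteq> f ` K" "f ` K \<subseteq> (\<Union>y\<in>F. B y)"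
    by (rule compactE_image[OF cK, of "f ` K" B]) (use B(1) mem in auto)
  define \<B> where "\<B> = B ` F"
  have B_in: "B y \<in> \<B>" if y: "y \<in> f ` K" for y
  proof -
    obtain a where a: "a \<in> F" "y \<in> B a" using F(3) y by blast
    then show ?thesis using B(5)[of y a] by (simp add: \<B>_def)
  qed
  have ne: "open C \<and> C \<noteq> {}" if C: "C \<in> \<B>" for C
  proof -
    obtain a where a: "a \<in> F" "C = B a" using C by (auto simp: \<B>_def)
    then have "a \<in> B a" using mem F(2) by blast
    then show ?thesis using B(1) a(2) by blast
  qed
  have fin: "finite \<B>" using F(1) by (simp add: \<B>_def)
  have Bid: "B y = C" if "C \<in> \<B>" "y \<in> C" for C y using that B(5) by (auto simp: \<B>_def)
  have dis: "disjoint_family_on (\<lambda>C. C) \<B>"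
    unfolding disjoint_family_on_def using Bid by blast
  obtain z where z: "\<forall>C\<in>\<B>. z C \<in> C" "inj_on (\<lambda>C. z C \<bullet> e) \<B>"
    using distinct_levels[OF fin assms(3) ne] by blast
  \<comment> \<open>The levels are wrapped as singletons so that the distance lemma for finite
    families of disjoint compact sets yields their smallest gap \<open>r\<close>.\<close>
  let ?Q = "(\<lambda>C. {z C \<bullet> e}) ` \<B>"
  have Q: "finite ?Q" "pairwise disjnt ?Q" "\<And>q. q \<in> ?Q \<Longrightarrow> compact q" using fin by (auto simp: pairwise_def)
  obtain r where r: "r > 0" "\<And>q q' x y. q \<in> ?Q \<Longrightarrow> q' \<in> ?Q \<Longrightarrow> q \<noteq> q' \<Longrightarrow> x \<in> q \<Longrightarrow> y \<in> q' \<Longrightarrow> r \<le> dist x y"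
    by (rule disjoint_compact_family_dist[OF Q], assumption+) (rule that; assumption)
  have gap: "r \<le> \<bar>z C \<bullet> e - z D \<bullet> e\<bar>" if CD: "C \<in> \<B>" "D \<in> \<B>" "C \<noteq> D" for C D
  proof -
    have "z C \<bullet> e \<noteq> z D \<bullet> e" using z(2) CD by (auto simp: inj_on_def)
    then show ?thesis using r(2)[of "{z C \<bullet> e}" "{z D \<bullet> e}"] CD by (auto simp: dist_real_def)
  qed
  define W where "W = (\<lambda>C. {y. \<bar>y \<bullet> e - z C \<bullet> e\<bar> < r/2})"
  have oW: "open (W C)" for C
  proof -
    have "W C = {y. e \<bullet> y < z C \<bullet> e + r/2} \<inter> {y. e \<bullet> y > z C \<bullet> e - r/2}"
      unfolding W_def by (intro set_eqI) (smt (verit) Int_iff mem_Collect_eq inner_commute field_sum_of_halves)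
    then show ?thesis by (simp add: open_Int open_halfspace_lt open_halfspace_gt)
  qed
  have "\<exists>g. supp_homeo C g \<and> g ` (f ` K \<inter> C) \<subseteq> W C" if C: "C \<in> \<B>" for C
  proof (rule compress_in_convex)
    obtain a where a: "C = B a" using C by (auto simp: \<B>_def)
    show "open C" "convex C" "bounded C" using B(1-3) a by auto
    \<comment> \<open>Compactness of the part in an open cell comes from missing the cell walls: it
      is the compact image minus the remaining open cells.\<close>
    have "f ` K \<inter> C = f ` K - \<Union>(\<B> - {C})"
    proof (intro equalityI subsetI)
      fix y assume y: "y \<in> f ` K \<inter> C"
      then have "y \<notin> \<Union>(\<B> - {C})" using Bid[OF C, of y] Bid[of _ y] by blast
      then show "y \<in> f ` K - \<Union>(\<B> - {C})" using y by blast
    next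
      fix y assume y: "y \<in> f ` K - \<Union>(\<B> - {C})"
      then have "B y \<in> \<B>" "y \<in> B y" using B_in mem by blast+
      then show "y \<in> f ` K \<inter> C" using y by blast
    qed
    moreover have "open (\<Union>(\<B> - {C}))" using ne by blast
    ultimately show "compact (f ` K \<inter> C)" using cK by (simp add: compact_diff)
    show "open (W C)" by (rule oW)
    have "z C \<in> W C" using r(1) by (simp add: W_def)
    then show "W C \<inter> C \<noteq> {}" using z(1) C by blast
  qed blast
  then obtain g where g: "\<And>C. C \<in> \<B> \<Longrightarrow> supp_homeo C (g C) \<and> g C ` (f ` K \<inter> C) \<subseteq> W C" by metis
  then obtain k where k: "supp_homeo (\<Union>C\<in>\<B>. C) k" "\<forall>C\<in>\<B>. \<forall>x\<in>C. k x = g C x"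
    using supp_homeo_glue[OF fin dis, of g] by blast
  show ?thesis
  proof
    have "supp_homeo UNIV k" using k(1) by (rule supp_homeo_mono) simp
    then show "supp_homeo UNIV (\<lambda>x. k (f x))" using f(1) by (rule supp_homeo_compose)
    show "dist (k (f x)) x < \<epsilon>" for x
    proof -
      have "dist (k y) y \<le> \<epsilon> / 4" for y
      proof (cases "\<exists>C\<in>\<B>. y \<in> C")
        case True
        then obtain C where C: "C \<in> \<B>" "y \<in> C" by blast
        then have "k y \<in> C" using k(2) g[OF C(1)] supp_homeo_mem_iff by metis
        then show ?thesis using B(6) C d(2) by (auto simp: \<B>_def)
      next
        case False
        then show ?thesis using supp_homeo_outside[OF k(1)] e4 by simp
      qed
      then have "dist (k (f x)) (f x) \<le> \<epsilon> / 4" .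
      then show ?thesis using dist_triangle[of "k (f x)" x "f x"] f(3)[of x] e4 by linarith
    qed
    show "k (f x) \<bullet> e \<noteq> k (f y) \<bullet> e" if xy: "x \<in> K" "y \<in> K" "\<epsilon> \<le> dist x y" for x y
    proof
      assume eq: "k (f x) \<bullet> e = k (f y) \<bullet> e"
      have W: "k (f x) \<in> W (B (f x))" "B (f x) \<in> \<B>" "f x \<in> B (f x)" if "x \<in> K" for x
      proof -
        show *: "B (f x) \<in> \<B>" "f x \<in> B (f x)" using B_in mem that by blast+
        then show "k (f x) \<in> W (B (f x))" using k(2) g[OF *(1)] that by auto
      qed
      have "B (f x) = B (f y)"
      proof (rule ccontr)
        assume "B (f x) \<noteq> B (f y)"
        then have "r \<le> \<bar>z (B (f x)) \<bullet> e - z (B (f y)) \<bullet> e\<bar>" using gap W(2) xy by blast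
        moreover have "\<bar>k (f x) \<bullet> e - z (B (f x)) \<bullet> e\<bar> < r/2" "\<bar>k (f y) \<bullet> e - z (B (f y)) \<bullet> e\<bar> < r/2"
          using W(1) xy by (auto simp: W_def)
        ultimately show False using eq by linarith
      qed
      then have "dist (f x) (f y) \<le> \<epsilon> / 4" using B(6)[OF W(3)[OF xy(1)]] W(3)[OF xy(2)] d(2) by simp
      moreover have "dist x y \<le> dist (f x) x + dist (f x) (f y) + dist (f y) y"
        using dist_triangle[of x y "f x"] dist_triangle[of "f x" y "f y"] by (simp add: dist_commute)
      ultimately show False using f(3)[of x] f(3)[of y] xy(3) e4 by linarith
    qed
  qed
qed

section \<open>Convergent sequences of homeomorphisms and tameness\<close>

lemma supp_homeo_inv:
  fixes f :: "'a::euclidean_space \<Rightarrow> 'a"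
  assumes "supp_homeo U f"
  shows "supp_homeo U (inv f)"
proof -
  have inj: "inj f" using assms unfolding supp_homeo_def by blast
  obtain C where C: "compact C" "C \<subseteq> U" "\<And>x. x \<notin> C \<Longrightarrow> f x = x"
    using assms unfolding supp_homeo_def by blast
  have "inv f x = x" if "x \<notin> C" for x using inv_f_f[OF inj, of x] C(3)[OF that] by simp
  moreover have "continuous_on UNIV (inv f)"
    using supp_homeo_homeomorphism[OF assms] by (simp add: homeomorphism_def)
  moreover have "inj (inv f)" using supp_homeo_surj[OF assms] by (simp add: surj_imp_inj_inv)
  ultimately show ?thesis using C unfolding supp_homeo_def by blast
qed

text \<open>Two points at distance below 1 either both lie in \<open>cball 0 (R + 1)\<close>, where
  compactness applies, or both lie outside the support, where the map is the identity.\<close>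

lemma supp_homeo_uniformly_continuous:
  fixes f :: "'a::euclidean_space \<Rightarrow> 'a"
  assumes "supp_homeo U f"
  shows "uniformly_continuous_on UNIV f"
  unfolding uniformly_continuous_on_def
proof (intro allI impI)
  fix e :: real assume e: "e > 0"
  obtain C where C: "compact C" "\<And>x. x \<notin> C \<Longrightarrow> f x = x" and cont: "continuous_on UNIV f"
    using assms unfolding supp_homeo_def by blast
  obtain R where R: "C \<subseteq> ball 0 R" using compact_imp_bounded[OF C(1)] bounded_subset_ballD by blast
  have "uniformly_continuous_on (cball 0 (R + 1)) f"
    using compact_uniformly_continuous[OF continuous_on_subset[OF cont subset_UNIV] compact_cball] .
  then obtain d where d: "d > 0"
    "\<And>x y. x \<in> cball 0 (R + 1) \<Longrightarrow> y \<in> cball 0 (R + 1) \<Longrightarrow> dist y x < d \<Longrightarrow> dist (f y) (f x) < e"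
    using e unfolding uniformly_continuous_on_def by meson
  have "dist (f y) (f x) < e" if xy: "dist y x < min (min d e) 1" for x y
  proof (cases "x \<in> ball 0 R \<or> y \<in> ball 0 R")
    case True
    have "norm x \<le> norm y + dist y x" "norm y \<le> norm x + dist y x"
      using norm_triangle_ineq2[of x y] norm_triangle_ineq2[of y x] by (auto simp: dist_norm norm_minus_commute)
    then have "x \<in> cball 0 (R + 1)" "y \<in> cball 0 (R + 1)" using True xy by auto
    then show ?thesis using d(2) xy by simp
  next
    case False
    then have "x \<notin> C" "y \<notin> C" using R by blast+
    then show ?thesis using C(2) xy by simp
  qed
  then show "\<exists>d>0. \<forall>x\<in>UNIV. \<forall>x'\<in>UNIV. dist x' x < d \<longrightarrow> dist (f x') (f x) < e"
    using d(1) e by (intro exI[of _ "min (min d e) 1"]) auto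
qed

lemma uniform_Cauchy_limit:
  fixes f :: "nat \<Rightarrow> 'a::euclidean_space \<Rightarrow> 'a"
  assumes "\<And>m. continuous_on UNIV (f m)" "\<And>m x. dist (f (Suc m) x) (f m x) \<le> (1/2)^m"
  obtains l where "continuous_on UNIV l" "\<And>x. (\<lambda>m. f m x) \<longlonglongrightarrow> l x"
    "\<And>m x. dist (l x) (f m x) \<le> 2 * (1/2)^m"
proof -
  \<comment> \<open>The tail of the geometric series is kept in the form of a difference so that the
    induction on \<open>k\<close> closes exactly.\<close>
  have step: "dist (f (m + k) x) (f m x) \<le> 2 * (1/2)^m - 2 * (1/2)^(m + k)" for m k x
  proof (induction k)
    case (Suc k)
    have "dist (f (m + Suc k) x) (f m x) \<le> dist (f (Suc (m + k)) x) (f (m + k) x) + dist (f (m + k) x) (f m x)"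
      by (simp add: dist_triangle)
    also have "\<dots> \<le> (1/2)^(m + k) + (2 * (1/2)^m - 2 * (1/2)^(m + k))"
      using assms(2) Suc.IH by (intro add_mono)
    finally show ?case by simp
  qed simp
  have step': "dist (f n x) (f m x) \<le> 2 * (1/2)^m" if "n \<ge> m" for m n x
  proof -
    have "dist (f n x) (f m x) \<le> 2 / 2 ^ m - 2 / 2 ^ n"
      using step[of m "n - m" x] that by (simp add: power_divide)
    also have "\<dots> \<le> 2 / 2 ^ m" by simp
    finally show ?thesis by (simp add: power_divide)
  qed
  have conv: "convergent (\<lambda>m. f m x)" for x
  proof (rule Cauchy_convergent)
    show "Cauchy (\<lambda>m. f m x)"
    proof (rule metric_CauchyI)
      fix e :: real assume "e > 0"
      then obtain M where M: "(1/2::real)^M < e / 4"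
        using real_arch_pow_inv[of "e/4" "1/2"] by auto
      have "dist (f m x) (f n x) < e" if "m \<ge> M" "n \<ge> M" for m n
        using dist_triangle2[of "f m x" "f n x" "f M x"] step'[OF that(1), of x] step'[OF that(2), of x] M
        by linarith
      then show "\<exists>M. \<forall>m\<ge>M. \<forall>n\<ge>M. dist (f m x) (f n x) < e" by blast
    qed
  qed
  define l where "l = (\<lambda>x. lim (\<lambda>m. f m x))"
  have lim: "(\<lambda>m. f m x) \<longlonglongrightarrow> l x" for x using conv by (simp add: l_def convergent_LIMSEQ_iff)
  have bound: "dist (l x) (f m x) \<le> 2 * (1/2)^m" for m x
  proof (rule LIMSEQ_le_const2)
    show "(\<lambda>n. dist (f n x) (f m x)) \<longlonglongrightarrow> dist (l x) (f m x)" using lim by (intro tendsto_intros)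
    show "\<exists>N. \<forall>n\<ge>N. dist (f n x) (f m x) \<le> 2 * (1/2)^m" using step' by blast
  qed
  have "uniform_limit UNIV f l sequentially"
  proof (rule uniform_limitI)
    fix e :: real assume "e > 0"
    then obtain M where M: "(1/2::real)^M < e / 2"
      using real_arch_pow_inv[of "e/2" "1/2"] by auto
    have "dist (f m x) (l x) < e" if "m \<ge> M" for m x
    proof -
      have "(1/2::real)^m \<le> (1/2)^M" using that by (intro power_decreasing) auto
      then show ?thesis using bound[of x m] M by (subst dist_commute) linarith
    qed
    then show "\<forall>\<^sub>F m in sequentially. \<forall>x\<in>UNIV. dist (f m x) (l x) < e"
      unfolding eventually_sequentially by blast
  qed
  then have "continuous_on UNIV l"
    by (rule uniform_limit_theorem[rotated]) (use assms(1) in auto)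
  then show ?thesis using that lim bound by blast
qed

text \<open>A uniform limit of homeomorphisms need not be injective, so the inverses are required to
  converge uniformly as well; the two limits are then inverse to each other.\<close>

lemma homeomorphism_limit:
  fixes f g :: "nat \<Rightarrow> 'a::euclidean_space \<Rightarrow> 'a"
  assumes "\<And>m. homeomorphism UNIV UNIV (f m) (g m)"
    and "\<And>m x. dist (f (Suc m) x) (f m x) \<le> (1/2)^m" "\<And>m x. dist (g (Suc m) x) (g m x) \<le> (1/2)^m"
  obtains F G where "homeomorphism UNIV UNIV F G" "\<And>x. (\<lambda>m. f m x) \<longlonglongrightarrow> F x"
proof -
  have cont: "\<And>m. continuous_on UNIV (f m)" "\<And>m. continuous_on UNIV (g m)"
    using assms(1) by (auto simp: homeomorphism_def)
  obtain F where F: "continuous_on UNIV F" "\<And>x. (\<lambda>m. f m x) \<longlonglongrightarrow> F x" "\<And>m x. dist (F x) (f m x) \<le> 2 * (1/2)^m"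
    by (rule uniform_Cauchy_limit[of f, OF cont(1) assms(2)]) (rule that; assumption)
  obtain G where G: "continuous_on UNIV G" "\<And>x. (\<lambda>m. g m x) \<longlonglongrightarrow> G x" "\<And>m x. dist (G x) (g m x) \<le> 2 * (1/2)^m"
    by (rule uniform_Cauchy_limit[of g, OF cont(2) assms(3)]) (rule that; assumption)
  have lim0: "(\<lambda>m. 2 * (1/2::real)^m) \<longlonglongrightarrow> 0"
    using tendsto_mult_right_zero[OF LIMSEQ_realpow_zero[of "1/2::real"]] by simp
  have inverse: "P (Q x) = x"
    if P: "continuous_on UNIV P" "\<And>m x. dist (P x) (p m x) \<le> 2 * (1/2)^m"
      and Q: "\<And>x. (\<lambda>m. q m x) \<longlonglongrightarrow> Q x" and pq: "\<And>m x. p m (q m x) = x"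
    for P Q :: "'a \<Rightarrow> 'a" and p q :: "nat \<Rightarrow> 'a \<Rightarrow> 'a" and x
  proof -
    have "(\<lambda>m. P (q m x)) \<longlonglongrightarrow> P (Q x)"
      using P(1) by (intro isCont_tendsto_compose[OF _ Q]) (simp add: continuous_on_eq_continuous_at)
    moreover have "(\<lambda>m. P (q m x)) \<longlonglongrightarrow> x"
    proof (rule metric_tendsto_imp_tendsto[OF lim0])
      show "\<forall>\<^sub>F m in sequentially. dist (P (q m x)) x \<le> dist (2 * (1/2::real)^m) 0"
        using P(2)[of "q m x" m for m] pq by (auto simp: dist_real_def)
    qed
    ultimately show ?thesis using LIMSEQ_unique by blast
  qed
  have fg: "f m (g m x) = x" "g m (f m x) = x" for m x using assms(1)[of m] by (auto simp: homeomorphism_def)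
  have "F (G x) = x" "G (F x) = x" for x
    using inverse[OF F(1,3) G(2) fg(1)] inverse[OF G(1,3) F(2) fg(2)] by blast+
  then have "homeomorphism UNIV UNIV F G" using F(1) G(1) by (intro homeomorphismI) auto
  then show ?thesis using that F(2) by blast
qed

lemma tame_if_injective_level:
  fixes K :: "'a::euclidean_space set" and e :: 'a
  assumes "homeomorphism UNIV UNIV h k" "compact K" "norm e = 1" "inj_on (\<lambda>x. h x \<bullet> e) K"
  shows "tame K"
proof -
  let ?t = "\<lambda>x. h x \<bullet> e"
  have conth: "continuous_on UNIV h" using assms(1) by (simp add: homeomorphism_def)
  then have contt: "continuous_on K ?t" by (intro continuous_intros) (auto intro: continuous_on_subset)
  obtain s where s: "homeomorphism K (?t ` K) ?t s"
    using homeomorphism_compact[OF assms(2) contt refl assms(4)] by blast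
  have "closed (?t ` K)" using compact_continuous_image[OF contt assms(2)] compact_imp_closed by blast
  moreover have "continuous_on (?t ` K) (\<lambda>r. h (s r))"
    by (rule continuous_on_compose2[OF conth]) (use s in \<open>auto simp: homeomorphism_def\<close>)
  ultimately obtain c where c: "continuous_on UNIV c" "\<And>r. r \<in> ?t ` K \<Longrightarrow> c r = h (s r)"
    using Tietze_unbounded[of "?t ` K" "\<lambda>r. h (s r)" UNIV] by auto
  have cK: "c (h x \<bullet> e) = h x" if "x \<in> K" for x
    using c(2)[of "?t x"] s that by (simp add: homeomorphism_def)
  \<comment> \<open>Component orthogonal to \<open>e\<close> of the extended map. Since
    \<open>q\<close> takes values orthogonal to \<open>e\<close>, the shear preserves levels and is
    inverted by adding \<open>q\<close> back.\<close>
  define q where "q = (\<lambda>r. c r - (c r \<bullet> e) *\<^sub>R e)"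
  have ee: "e \<bullet> e = 1" using assms(3) by (simp add: dot_square_norm)
  have qe: "q r \<bullet> e = 0" for r using ee by (simp add: q_def inner_diff_left)
  have contq: "continuous_on UNIV q" unfolding q_def using c(1) by (intro continuous_intros)
  have contq': "continuous_on UNIV (\<lambda>x. q (x \<bullet> e))"
    by (rule continuous_on_compose2[OF contq]) (auto intro!: continuous_intros)
  have "homeomorphism UNIV UNIV (\<lambda>x. x - q (x \<bullet> e)) (\<lambda>x. x + q (x \<bullet> e))"
    by (rule homeomorphismI) (use qe contq' in \<open>auto intro!: continuous_intros simp: inner_diff_left inner_add_left\<close>)
  from homeomorphism_compose[OF assms(1) this]
  have "homeomorphism UNIV UNIV ((\<lambda>x. x - q (x \<bullet> e)) \<circ> h) (k \<circ> (\<lambda>x. x + q (x \<bullet> e)))" .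
  moreover have "straight_line (span {e})"
    using assms(3) by (auto simp: straight_line_def subspace_imp_affine aff_dim_subspace)
  moreover have "((\<lambda>x. x - q (x \<bullet> e)) \<circ> h) ` K \<subseteq> span {e}"
  proof
    fix y assume "y \<in> ((\<lambda>x. x - q (x \<bullet> e)) \<circ> h) ` K"
    then obtain x where "x \<in> K" "y = h x - q (h x \<bullet> e)" by auto
    then have "y = (h x \<bullet> e) *\<^sub>R e" using cK by (simp add: q_def)
    then show "y \<in> span {e}" by (simp add: span_mul span_base)
  qed
  ultimately show ?thesis unfolding tame_def by blast
qed

text \<open>The homeomorphisms are built so that stage \<open>m\<close> separates the levels of
  points of \<open>K\<close> at distance at least \<open>1 / real m\<close>, and all later stages
  together move points too little to undo this.\<close>

lemma movable_imp_tame: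
  fixes K :: "'a::euclidean_space set"
  assumes K: "zdim K" and mov: "\<And>L. compact L \<Longrightarrow> L \<subseteq> K \<Longrightarrow> movable L"
  shows "tame K"
proof -
  obtain e :: 'a where e: "norm e = 1" using vector_choose_size[of 1] by auto
  \<comment> \<open>\<open>\<beta>\<close> bounds the total displacement by all later stages. A
    level gap of \<open>3 * \<beta>\<close> loses at most \<open>\<beta>\<close> at either point and
    stays positive in the limit. The guard \<open>m > 0\<close> matters at stage 0, where
    \<open>1 / real m\<close> is 0 and the clause would fail for \<open>x = y\<close>.\<close>
  define P where "P = (\<lambda>m (h :: 'a \<Rightarrow> 'a, \<beta>). supp_homeo UNIV h \<and> 0 < \<beta> \<and> \<beta> \<le> (1/2)^m \<and>
      (\<forall>x\<in>K. \<forall>y\<in>K. 1 / real m \<le> dist x y \<and> m > 0 \<longrightarrow> 3 * \<beta> \<le> \<bar>h x \<bullet> e - h y \<bullet> e\<bar>))"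
  define Q where "Q = (\<lambda>m :: nat. \<lambda>(h :: 'a \<Rightarrow> 'a, \<beta> :: real) (h' :: 'a \<Rightarrow> 'a, \<beta>'). (\<forall>x. dist (h' x) (h x) \<le> \<beta> / 2) \<and> \<beta>' \<le> \<beta> / 2 \<and>
      (\<forall>x. dist (inv h' x) (inv h x) \<le> (1/2)^m))"
  have "\<exists>\<sigma> :: nat \<Rightarrow> ('a \<Rightarrow> 'a) \<times> real. \<forall>m. P m (\<sigma> m) \<and> Q m (\<sigma> m) (\<sigma> (Suc m))"
  proof (rule dependent_nat_choice)
    show "\<exists>s. P 0 s" using supp_homeo_id by (intro exI[of _ "(\<lambda>x. x, 1)"]) (auto simp: P_def)
    fix s :: "('a \<Rightarrow> 'a) \<times> real" and m :: nat
    assume Ps: "P m s"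
    obtain h \<beta> where s: "s = (h, \<beta>)" by fastforce
    have h: "supp_homeo UNIV h" and \<beta>: "0 < \<beta>" "\<beta> \<le> (1/2)^m" using Ps by (auto simp: P_def s)
    have conth: "continuous_on UNIV h" and injh: "inj h" using h unfolding supp_homeo_def by blast+
    have "uniformly_continuous_on UNIV (inv h)"
      using supp_homeo_uniformly_continuous[OF supp_homeo_inv[OF h]] .
    \<comment> \<open>The first bound keeps the new inverse within \<open>(1/2)^m\<close> of the old
      one. The second ensures that points of \<open>K\<close> at distance
      \<open>1 / real (Suc m)\<close> have images under \<open>h\<close> at distance at least
      \<open>d\<close>, so that the separating step with \<open>\<epsilon> \<le> d\<close> acts on
      them.\<close>
    moreover define \<eta> where "\<eta> = min ((1/2)^m) (1 / real (Suc m))"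
    have "\<eta> > 0" by (simp add: \<eta>_def)
    ultimately obtain d where d: "d > 0" "\<And>x y. dist y x < d \<Longrightarrow> dist (inv h y) (inv h x) < \<eta>"
      unfolding uniformly_continuous_on_def by (metis UNIV_I)
    define \<epsilon> where "\<epsilon> = min (\<beta> / 2) d"
    have \<epsilon>: "\<epsilon> > 0" "\<epsilon> \<le> \<beta> / 2" "\<epsilon> \<le> d" using \<beta>(1) d(1) by (auto simp: \<epsilon>_def)
    have zK: "zdim (h ` K)"
      using zdim_image[OF K] conth injh by (meson continuous_on_subset inj_on_subset subset_UNIV)
    have mK: "movable L" if L: "compact L" "L \<subseteq> h ` K" for L
    proof -
      have hom: "homeomorphism UNIV UNIV h (inv h)" by (rule supp_homeo_homeomorphism[OF h])
      have "inv h ` L \<subseteq> K" using L(2) injh by auto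
      moreover have "compact (inv h ` L)"
        using L(1) hom by (meson compact_continuous_image continuous_on_subset homeomorphism_cont2 subset_UNIV)
      ultimately have "movable (h ` inv h ` L)" using mov movable_supp_homeo_image[OF _ h] by blast
      moreover have "h ` inv h ` L = L" using supp_homeo_surj[OF h] by (simp add: image_f_inv_f)
      ultimately show ?thesis by simp
    qed
    obtain f where f: "supp_homeo UNIV f" "\<And>x. dist (f x) x < \<epsilon>"
      "\<And>x y. x \<in> h ` K \<Longrightarrow> y \<in> h ` K \<Longrightarrow> \<epsilon> \<le> dist x y \<Longrightarrow> f x \<bullet> e \<noteq> f y \<bullet> e"
      by (rule separating_step[OF zK mK e \<epsilon>(1)]) blast+
    define h' where "h' = (\<lambda>x. f (h x))"
    have h': "supp_homeo UNIV h'" unfolding h'_def using f(1) h by (rule supp_homeo_compose)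
    have conth': "continuous_on UNIV h'" using h' unfolding supp_homeo_def by blast
    \<comment> \<open>The pairs to be separated form a compact set on which the difference of levels
      is positive; its minimum gives the new gap.\<close>
    define D where "D = (K \<times> K) \<inter> {z. 1 / real (Suc m) \<le> dist (fst z) (snd z)}"
    have "closed {z :: 'a \<times> 'a. 1 / real (Suc m) \<le> dist (fst z) (snd z)}"
      by (intro closed_Collect_le continuous_intros)
    then have cD: "compact D" unfolding D_def
      using zdim_compact[OF K] by (intro compact_Int_closed compact_Times) auto
    define \<phi> where "\<phi> = (\<lambda>z. \<bar>h' (fst z) \<bullet> e - h' (snd z) \<bullet> e\<bar>)"
    have cont\<phi>: "continuous_on D \<phi>" unfolding \<phi>_def
      by (intro continuous_intros continuous_on_compose2[OF conth']) auto
    have \<phi>pos: "\<phi> z > 0" if z: "z \<in> D" for z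
    proof -
      have "inv h (h x) = x" for x using injh by simp
      then have "\<not> dist (h (fst z)) (h (snd z)) < d"
        using d(2)[of "h (fst z)" "h (snd z)"] z by (auto simp: D_def \<eta>_def)
      then have "f (h (fst z)) \<bullet> e \<noteq> f (h (snd z)) \<bullet> e"
        using z \<epsilon>(3) by (intro f(3)) (auto simp: D_def)
      then show ?thesis by (simp add: \<phi>_def h'_def)
    qed
    have "\<exists>c>0. \<forall>z\<in>D. c \<le> \<phi> z"
    proof (cases "D = {}")
      case False
      then obtain z where "z \<in> D" "\<forall>y\<in>D. \<phi> z \<le> \<phi> y"
        using continuous_attains_inf[OF cD _ cont\<phi>] by blast
      then show ?thesis using \<phi>pos by blast
    qed (auto intro: exI[of _ 1])
    then obtain c where c: "c > 0" "\<And>z. z \<in> D \<Longrightarrow> c \<le> \<phi> z" by blast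
    define \<beta>' where "\<beta>' = min (\<beta> / 2) (c / 3)"
    have "3 * \<beta>' \<le> \<bar>h' x \<bullet> e - h' y \<bullet> e\<bar>" if "x \<in> K" "y \<in> K" "1 / real (Suc m) \<le> dist x y" for x y
    proof -
      have "c \<le> \<phi> (x, y)" using that by (intro c(2)) (auto simp: D_def)
      moreover have "3 * \<beta>' \<le> c" by (simp add: \<beta>'_def min_def)
      ultimately show ?thesis by (simp add: \<phi>_def)
    qed
    moreover have "0 < \<beta>'" "\<beta>' \<le> (1/2)^Suc m" using \<beta> c(1) by (auto simp: \<beta>'_def)
    ultimately have "P (Suc m) (h', \<beta>')" using h' by (simp add: P_def)
    moreover have "dist (h' x) (h x) \<le> \<beta> / 2" for x
      using f(2)[of "h x"] \<epsilon>(2) by (simp add: h'_def)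
    moreover have "dist (inv h' y) (inv h y) \<le> (1/2)^m" for y
    proof -
      have "h' (inv h' y) = y" using supp_homeo_surj[OF h'] by (simp add: surj_f_inv_f)
      moreover define x where "x = inv h' y"
      ultimately have y: "y = f (h x)" by (simp add: h'_def)
      have "inv h (h x) = x" using injh by simp
      then have "dist (inv h y) x < \<eta>" using d(2)[of y "h x"] f(2)[of "h x"] \<epsilon>(3) y by simp
      then show ?thesis unfolding x_def[symmetric] by (simp add: \<eta>_def dist_commute)
    qed
    ultimately have "P (Suc m) (h', \<beta>') \<and> Q m s (h', \<beta>')" by (simp add: Q_def s \<beta>'_def)
    then show "\<exists>s'. P (Suc m) s' \<and> Q m s s'" by blast
  qed
  then obtain \<sigma> where \<sigma>: "\<And>m. P m (\<sigma> m)" "\<And>m. Q m (\<sigma> m) (\<sigma> (Suc m))" by blast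
  define h where "h = (\<lambda>m. fst (\<sigma> m))"
  define \<beta> where "\<beta> = (\<lambda>m. snd (\<sigma> m))"
  have Ph: "supp_homeo UNIV (h m)" "0 < \<beta> m" "\<beta> m \<le> (1/2)^m"
    "\<And>x y. x \<in> K \<Longrightarrow> y \<in> K \<Longrightarrow> 1 / real m \<le> dist x y \<Longrightarrow> m > 0 \<Longrightarrow> 3 * \<beta> m \<le> \<bar>h m x \<bullet> e - h m y \<bullet> e\<bar>" for m
    using \<sigma>(1)[of m] by (auto simp: P_def h_def \<beta>_def split: prod.splits)
  have Qh: "dist (h (Suc m) x) (h m x) \<le> \<beta> m / 2" "\<beta> (Suc m) \<le> \<beta> m / 2"
    "dist (inv (h (Suc m)) x) (inv (h m) x) \<le> (1/2)^m" for m x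
    using \<sigma>(2)[of m] by (auto simp: Q_def h_def \<beta>_def split: prod.splits)
  have "dist (h (Suc m) x) (h m x) \<le> (1/2)^m" for m x
    using Qh(1)[where m = m and x = x] Ph(2,3)[of m] by linarith
  then obtain F G where FG: "homeomorphism UNIV UNIV F G" "\<And>x. (\<lambda>m. h m x) \<longlonglongrightarrow> F x"
    using homeomorphism_limit[of h "\<lambda>m. inv (h m)", OF supp_homeo_homeomorphism[OF Ph(1)] _ Qh(3)] by blast
  \<comment> \<open>Each stage moves points by at most half of the current \<open>\<beta>\<close>,
    and \<open>\<beta>\<close> at least halves; the difference form of the bound absorbs the next
    displacement.\<close>
  have stay: "dist (h (m + k) x) (h m x) \<le> \<beta> m - \<beta> (m + k)" for m k x
  proof (induction k)
    case (Suc k)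
    have "dist (h (m + Suc k) x) (h m x) \<le> dist (h (Suc (m + k)) x) (h (m + k) x) + dist (h (m + k) x) (h m x)"
      by (simp add: dist_triangle)
    also have "\<dots> \<le> \<beta> (m + k) / 2 + (\<beta> m - \<beta> (m + k))" using Qh(1) Suc.IH by (intro add_mono)
    also have "\<dots> \<le> \<beta> m - \<beta> (m + Suc k)" using Qh(2)[of "m + k"] Ph(2)[of "m + k"] by simp
    finally show ?case .
  qed simp
  have close: "dist (F x) (h m x) \<le> \<beta> m" for m x
  proof (rule LIMSEQ_le_const2)
    show "(\<lambda>n. dist (h n x) (h m x)) \<longlonglongrightarrow> dist (F x) (h m x)" using FG(2) by (intro tendsto_intros)
    have "dist (h n x) (h m x) \<le> \<beta> m" if "n \<ge> m" for n
      using stay[of m "n - m" x] that Ph(2)[of n] by simp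
    then show "\<exists>N. \<forall>n\<ge>N. dist (h n x) (h m x) \<le> \<beta> m" by blast
  qed
  have "inj_on (\<lambda>x. F x \<bullet> e) K"
  proof (rule inj_onI, rule ccontr)
    fix x y assume xy: "x \<in> K" "y \<in> K" "F x \<bullet> e = F y \<bullet> e" "x \<noteq> y"
    then obtain m where m: "m > 0" "1 / real m < dist x y"
      using ex_inverse_of_nat_less[of "dist x y"] by (auto simp: inverse_eq_divide)
    have lev: "\<bar>F z \<bullet> e - h m z \<bullet> e\<bar> \<le> \<beta> m" for z
    proof -
      have "\<bar>(F z - h m z) \<bullet> e\<bar> \<le> norm (F z - h m z) * norm e" by (rule Cauchy_Schwarz_ineq2)
      then show ?thesis using close[of z m] e by (simp add: dist_norm inner_diff_left)
    qed
    have "3 * \<beta> m \<le> \<bar>h m x \<bullet> e - h m y \<bullet> e\<bar>" using Ph(4)[OF xy(1,2)] m by simp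
    then show False using lev[of x] lev[of y] xy(3) Ph(2)[of m] by linarith
  qed
  then show ?thesis using tame_if_injective_level[OF FG(1) zdim_compact[OF K] e] by blast
qed

section \<open>Boundary behaviour of the Riemann map of a Jordan domain\<close>

lemma simple_loop_from:
  fixes c :: "real \<Rightarrow> 'a::real_normed_vector"
  assumes "simple_path c" "pathfinish c = pathstart c" "q \<in> path_image c"
  obtains d where "simple_path d" "pathfinish d = pathstart d" "pathstart d = q" "path_image d = path_image c"
proof -
  obtain u where u: "u \<in> {0..1}" "c u = q" using assms(3) by (auto simp: path_image_def)
  show ?thesis
  proof (rule that[of "shiftpath u c"])
    show "simple_path (shiftpath u c)" using simple_path_shiftpath assms(1,2) u(1) by auto
    show "pathfinish (shiftpath u c) = pathstart (shiftpath u c)" using closed_shiftpath assms(2) u(1) by blast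
    show "pathstart (shiftpath u c) = q" using pathstart_shiftpath u by auto
    show "path_image (shiftpath u c) = path_image c" using path_image_shiftpath assms(2) u(1) by blast
  qed
qed

text \<open>Janiszewski's theorem. Let \<open>?J2\<close> be the part of the loop away from
  \<open>q\<close>. The loop meets \<open>?J2 \<union> sphere q e\<close> in the connected set
  \<open>?J2\<close>, because the rest of the loop lies in the ball. Two inside points close to
  \<open>q\<close> are joined off the loop, through its inside, and off
  \<open>?J2 \<union> sphere q e\<close>, through a small ball; hence they are joined off the
  union.\<close>

lemma inside_simple_loop_locally_connected:
  fixes c :: "real \<Rightarrow> complex"
  assumes "simple_path c" "pathfinish c = pathstart c" "q \<in> path_image c" "e > 0"
  shows "\<exists>d>0. \<forall>z\<in>inside (path_image c) \<inter> ball q d. \<forall>w\<in>inside (path_image c) \<inter> ball q d.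
           connected_component (inside (path_image c) \<inter> ball q e) z w"
proof -
  let ?J = "path_image c" and ?O = "inside (path_image c)"
  obtain g where g: "simple_path g" "pathfinish g = pathstart g" "pathstart g = q" "path_image g = ?J"
    by (rule simple_loop_from[OF assms(1-3)])
  have contg: "continuous_on {0..1} g" using g(1) by (simp add: simple_path_def path_def)
  have g01: "g 0 = q" "g 1 = q" using g(2,3) by (auto simp: pathstart_def pathfinish_def)
  obtain a where a: "0 < a" "a < 1/2" "g ` {0..a} \<subseteq> ball q e" "g ` {1-a..1} \<subseteq> ball q e"
  proof -
    obtain d1 where d1: "d1 > 0" "\<And>t. t \<in> {0..1} \<Longrightarrow> dist t 0 < d1 \<Longrightarrow> dist (g t) (g 0) < e"
      using contg assms(4) unfolding continuous_on_iff by (metis atLeastAtMost_iff order_refl zero_le_one)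
    obtain d2 where d2: "d2 > 0" "\<And>t. t \<in> {0..1} \<Longrightarrow> dist t 1 < d2 \<Longrightarrow> dist (g t) (g 1) < e"
      using contg assms(4) unfolding continuous_on_iff by (metis atLeastAtMost_iff order_refl zero_le_one)
    let ?a = "min (min d1 d2) (1/2) / 2"
    show ?thesis
    proof (rule that[of ?a])
      show "0 < ?a" "?a < 1/2" using d1(1) d2(1) by auto
      show "g ` {0..?a} \<subseteq> ball q e"
      proof (intro subsetI, elim imageE)
        fix x t assume t: "x = g t" "t \<in> {0..?a}"
        have "t \<in> {0..1}" "dist t 0 < d1" using t(2) d1(1) d2(1) by (auto simp: dist_real_def)
        then show "x \<in> ball q e" using d1(2) t(1) g01 by (simp add: dist_commute)
      qed
      show "g ` {1-?a..1} \<subseteq> ball q e"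
      proof (intro subsetI, elim imageE)
        fix x t assume t: "x = g t" "t \<in> {1-?a..1}"
        have "t \<in> {0..1}" "dist t 1 < d2" using t(2) d1(1) d2(1) by (auto simp: dist_real_def)
        then show "x \<in> ball q e" using d2(2) t(1) g01 by (simp add: dist_commute)
      qed
    qed
  qed
  let ?J2 = "g ` {a..1-a}"
  have cJ2: "continuous_on {a..1-a} g" by (rule continuous_on_subset[OF contg]) (use a in auto)
  have J2: "compact ?J2" "connected ?J2"
    using cJ2 by (auto intro: compact_continuous_image connected_continuous_image)
  have "q \<notin> ?J2"
  proof
    assume "q \<in> ?J2"
    then obtain t where t: "t \<in> {a..1-a}" "g t = g 0" using g01(1) by auto
    have "loop_free g" using g(1) by (simp add: simple_path_def)
    then have "t = 0 \<or> t = 1" using t a unfolding loop_free_def by fastforce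
    then show False using t(1) a by auto
  qed
  then have "q \<in> - ?J2" "open (- ?J2)" using compact_imp_closed[OF J2(1)] by auto
  then obtain d0 where d0: "d0 > 0" "ball q d0 \<subseteq> - ?J2" by (meson open_contains_ball)
  have Jsub: "?J - ?J2 \<subseteq> ball q e"
  proof
    fix x assume x: "x \<in> ?J - ?J2"
    then have "x \<in> g ` {0..1}" using g(4) by (simp add: path_image_def)
    then obtain t where t: "t \<in> {0..1}" "x = g t" by blast
    then have "\<not> (a \<le> t \<and> t \<le> 1 - a)" using x by auto
    then have "t \<in> {0..a} \<or> t \<in> {1-a..1}" using t(1) by auto
    then show "x \<in> ball q e" using a(3,4) t(2) by blast
  qed
  have "{a..1-a} \<subseteq> {0..1}" using a by auto
  from image_mono[OF this, of g] have "?J2 \<subseteq> ?J" using g(4) by (simp add: path_image_def)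
  define d where "d = min d0 e"
  have "connected_component (?O \<inter> ball q e) z w" if z: "z \<in> ?O \<inter> ball q d" and w: "w \<in> ?O \<inter> ball q d" for z w
  proof -
    note JO = Jordan_inside_outside[OF assms(1,2)]
    let ?T = "?J2 \<union> sphere q e"
    have "connected_component (- (?J \<union> ?T)) z w"
    proof (rule Janiszewski)
      show "compact ?J" using assms(1) by (simp add: compact_simple_path_image)
      show "closed ?T" by (intro closed_Un closed_sphere compact_imp_closed J2(1))
      have "ball q e \<inter> sphere q e = {}" by auto
      then have "?J \<inter> ?T = ?J2" using Jsub \<open>?J2 \<subseteq> ?J\<close> by blast
      then show "connected (?J \<inter> ?T)" using J2(2) by simp
      have "connected ?O" "?O \<subseteq> - ?J" using JO by blast+
      then show "connected_component (- ?J) z w" using z w unfolding connected_component_def by blast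
      have "connected (ball q d)" "ball q d \<subseteq> - ?T" using d0(2) by (auto simp: d_def)
      then show "connected_component (- ?T) z w" using z w unfolding connected_component_def by blast
    qed
    then obtain C where C: "connected C" "C \<subseteq> - (?J \<union> ?T)" "z \<in> C" "w \<in> C"
      unfolding connected_component_def by blast
    have "C \<subseteq> ?O"
    proof (rule ccontr)
      assume "\<not> C \<subseteq> ?O"
      then have "C \<inter> ?O \<noteq> {}" "C - ?O \<noteq> {}" using C(3) z by blast+
      from connected_Int_frontier[OF C(1) this] show False using JO C(2) by blast
    qed
    moreover have "C \<subseteq> ball q e"
    proof (rule ccontr)
      assume "\<not> C \<subseteq> ball q e"
      then have "C \<inter> ball q e \<noteq> {}" "C - ball q e \<noteq> {}" using C(3) z by (auto simp: d_def)
      from connected_Int_frontier[OF C(1) this] show False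
        using C(2) assms(4) frontier_ball[of e q] by auto
    qed
    ultimately show ?thesis using C unfolding connected_component_def by blast
  qed
  moreover have "d > 0" using d0(1) assms(4) by (simp add: d_def)
  ultimately show ?thesis by blast
qed

text \<open>Multiplying \<open>G\<close> by powers of \<open>s / (z - e)\<close>, with pole
  \<open>e\<close> just outside the domain, leaves the bound \<open>M\<close> intact on the frontier
  of \<open>\<Omega> \<inter> ball e s\<close>: there either \<open>G\<close> vanishes or the factor
  has modulus 1. Inside, the factor has modulus above 1, and letting the exponent grow forces
  \<open>G w = 0\<close>.\<close>

lemma vanishing_on_boundary_arc:
  fixes c :: "real \<Rightarrow> complex"
  assumes "simple_path c" "pathfinish c = pathstart c" "q \<in> path_image c" "r > 0"
    and hol: "G holomorphic_on inside (path_image c)"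
    and cont: "continuous_on (closure (inside (path_image c))) G"
    and zero: "\<And>z. z \<in> path_image c \<inter> ball q r \<Longrightarrow> G z = 0"
  shows "\<exists>w\<in>inside (path_image c). G w = 0"
proof -
  let ?J = "path_image c" and ?O = "inside (path_image c)"
  note JO = Jordan_inside_outside[OF assms(1,2)]
  have clO: "closure ?O = ?O \<union> ?J" using JO closure_Un_frontier by metis
  have "compact (closure ?O)" using JO by simp
  then have "bounded (G ` closure ?O)" using cont compact_continuous_image compact_imp_bounded by blast
  then obtain M where M: "M > 0" "\<And>z. z \<in> closure ?O \<Longrightarrow> norm (G z) \<le> M"
    unfolding bounded_pos by auto
  have "q \<in> closure (outside ?J)" using JO assms(3) frontier_def by (metis DiffD1)
  \<comment> \<open>Distance below \<open>r / 4\<close> from \<open>q\<close> lets the ball of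
    radius \<open>r / 2\<close> around \<open>e\<close> contain \<open>q\<close> and yet stay in
    \<open>ball q r\<close>, where the boundary values vanish.\<close>
  then obtain e where e: "e \<in> outside ?J" "dist e q < r / 4"
    using assms(4) closure_approachable[of q] by (metis zero_less_divide_iff zero_less_numeral)
  have enO: "e \<notin> closure ?O" using e(1) JO clO by blast
  define s where "s = r / 2"
  have s: "s > 0" "dist e q < s" "cball e s \<subseteq> ball q r"
  proof -
    show "s > 0" "dist e q < s" using assms(4) e(2) by (auto simp: s_def)
    show "cball e s \<subseteq> ball q r"
    proof
      fix x assume "x \<in> cball e s"
      then show "x \<in> ball q r"
        using dist_triangle[of q x e] e(2) assms(4) by (simp add: s_def dist_commute)
    qed
  qed
  have "q \<in> closure ?O" using clO assms(3) by blast
  then have "ball e s \<inter> ?O \<noteq> {}" using s(2) open_Int_closure_eq_empty[of "ball e s" ?O] by auto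
  then obtain w where w: "w \<in> ?O" "dist e w < s" by auto
  define W where "W = ?O \<inter> ball e s"
  have oW: "open W" using JO by (auto simp: W_def)
  have clW: "closure W \<subseteq> closure ?O" "closure W \<subseteq> cball e s"
    using closure_mono[of W ?O] closure_mono[of W "ball e s"] s(1) by (auto simp: W_def)
  have "norm (G w) * (s / dist w e)^N \<le> M" for N
  proof -
    define H where "H = (\<lambda>z. G z * (s / (z - e))^N)"
    have "norm (H w) \<le> M"
    proof (rule maximum_modulus_frontier[where f = H and S = W])
      have "G holomorphic_on W" by (rule holomorphic_on_subset[OF hol]) (auto simp: W_def)
      moreover have "e \<notin> W" using enO closure_subset[of ?O] by (auto simp: W_def)
      ultimately have "H holomorphic_on W" unfolding H_def by (auto intro!: holomorphic_intros)
      then show "H holomorphic_on interior W" by (simp add: interior_open[OF oW])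
      show "continuous_on (closure W) H"
      proof -
        have "continuous_on (closure W) G" by (rule continuous_on_subset[OF cont clW(1)])
        moreover have "e \<notin> closure W" using enO clW(1) by blast
        ultimately show ?thesis unfolding H_def by (auto intro!: continuous_intros)
      qed
      show "bounded W" using JO by (auto simp: W_def)
      show "w \<in> W" using w by (simp add: W_def)
      fix z assume z: "z \<in> frontier W"
      then have z1: "z \<in> closure ?O" "z \<in> cball e s" "z \<notin> W"
        using clW oW by (auto simp: frontier_def interior_open)
      show "norm (H z) \<le> M"
      proof (cases "z \<in> ?J")
        case True
        then have "G z = 0" using zero z1(2) s(3) by blast
        then show ?thesis using M(1) by (simp add: H_def)
      next
        case False
        then have "dist e z = s" using z1 clO by (auto simp: W_def)
        then have "norm (s / (z - e)) = 1" using s(1) by (simp add: norm_divide dist_norm norm_minus_commute)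
        then show ?thesis using M(2)[OF z1(1)] by (simp add: H_def norm_mult norm_power)
      qed
    qed
    then show ?thesis by (simp add: H_def norm_mult norm_power norm_divide dist_norm s(1) less_imp_le)
  qed
  moreover have "w \<noteq> e" using enO w(1) closure_subset[of ?O] by blast
  then have ratio: "s / dist w e > 1" using w(2) by (simp add: dist_commute)
  ultimately have bnd: "norm (G w) * (s / dist w e)^N \<le> M" for N by blast
  have "G w = 0"
  proof (rule ccontr)
    assume "G w \<noteq> 0"
    then obtain N where "M / norm (G w) < (s / dist w e)^N" using real_arch_pow[OF ratio] by blast
    then have "M < norm (G w) * (s / dist w e)^N" using \<open>G w \<noteq> 0\<close> by (simp add: field_simps)
    then show False using bnd[of N] by simp
  qed
  then show ?thesis using w(1) by blast
qed

section \<open>Koebe's lemma on functions that are small along a path through the disc\<close>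

text \<open>A two-constants estimate on the component of \<open>\<i>/2\<close>. By the third
  geometric assumption the closure of this component stays inside the disc, so its frontier lies on
  \<open>\<Gamma>\<close> or in \<open>Im z \<le> 1/4\<close>, and no boundary behaviour of
  \<open>F\<close> on the unit circle is involved.\<close>

lemma koebe_half_disc:
  fixes F :: "complex \<Rightarrow> complex"
  assumes hol: "F holomorphic_on ball 0 1" and M: "\<And>z. z \<in> ball 0 1 \<Longrightarrow> norm (F z) \<le> M"
    and \<Gamma>: "closed \<Gamma>" "\<And>z. z \<in> \<Gamma> \<Longrightarrow> norm (F z) \<le> \<epsilon>" "0 < \<epsilon>" "\<epsilon> \<le> M"
    and W: "\<i>/2 \<notin> \<Gamma>" "connected_component_set ({z. norm z < 1 \<and> 1/4 < Im z} - \<Gamma>) (\<i>/2) \<subseteq> cball 0 \<rho>" "\<rho> < 1"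
  shows "norm (F (\<i>/2)) \<le> M * exp (- ln (M / \<epsilon>) / 4)"
proof -
  define O' where "O' = {z. norm z < 1 \<and> 1/4 < Im z} - \<Gamma>"
  have "{z. norm z < 1 \<and> 1/4 < Im z} = ball 0 1 \<inter> {z. 1/4 < Im z}" by auto
  then have "open {z. norm z < 1 \<and> 1/4 < Im z}"
    using open_Int[OF open_ball open_halfspace_Im_gt] by metis
  then have oO: "open O'" using \<Gamma>(1) by (simp add: O'_def open_Diff)
  define W where "W = connected_component_set O' (\<i>/2)"
  have Wsub: "W \<subseteq> cball 0 \<rho>" "W \<subseteq> O'"
    using assms(8) connected_component_subset by (auto simp: W_def O'_def)
  have oW: "open W" using oO by (simp add: W_def open_connected_component)
  have clW: "closure W \<subseteq> cball 0 \<rho>" using Wsub(1) closure_minimal closed_cball by blast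
  then have clW1: "closure W \<subseteq> ball 0 1" using W(3) by auto
  define L where "L = ln (M / \<epsilon>)"
  have L: "L \<ge> 0" "exp L = M / \<epsilon>" using \<Gamma>(3,4) by (auto simp: L_def)
  \<comment> \<open>The factor has modulus \<open>exp (L * (Im z - 1/4))\<close>: at most 1 where
    \<open>Im z \<le> 1/4\<close>, at most \<open>M / \<epsilon>\<close> in the disc, and exactly
    \<open>exp (L / 4)\<close> at \<open>\<i>/2\<close>. The first two facts bound \<open>G\<close>
    by \<open>M\<close> on the frontier, the third gives the gain.\<close>
  define G where "G = (\<lambda>z. F z * exp (of_real L * (- \<i> * z - 1/4)))"
  have nG: "norm (G z) = norm (F z) * exp (L * (Im z - 1/4))" for z
    by (simp add: G_def norm_mult)
  have "norm (G (\<i>/2)) \<le> M"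
  proof (rule maximum_modulus_frontier[where f = G and S = W])
    have holG: "G holomorphic_on ball 0 1" unfolding G_def by (intro holomorphic_intros hol)
    show "G holomorphic_on interior W"
      by (rule holomorphic_on_subset[OF holG]) (use clW1 closure_subset[of W] interior_subset[of W] in auto)
    show "continuous_on (closure W) G"
      by (rule continuous_on_subset[OF holomorphic_on_imp_continuous_on[OF holG] clW1])
    show "bounded W" using Wsub(1) bounded_cball bounded_subset by blast
    have "\<i>/2 \<in> O'" using W(1) by (simp add: O'_def)
    then show "\<i>/2 \<in> W" by (simp add: W_def)
    fix z assume z: "z \<in> frontier W"
    then have zcl: "z \<in> closure W" by (simp add: frontier_def)
    have "z \<notin> O'"
    proof
      assume "z \<in> O'"
      moreover have "z \<in> frontier O'" using z frontier_of_components_subset[of W O']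
        by (metis W_def \<open>\<i>/2 \<in> O'\<close> componentsI subsetD)
      ultimately show False using oO by (simp add: frontier_def interior_open)
    qed
    moreover have z1: "norm z < 1" using zcl clW1 by auto
    ultimately have alt: "Im z \<le> 1/4 \<or> z \<in> \<Gamma>" by (auto simp: O'_def)
    have "norm (F z) \<le> M" using M z1 by simp
    show "norm (G z) \<le> M"
    proof (cases "Im z \<le> 1/4")
      case True
      then have "exp (L * (Im z - 1/4)) \<le> 1" using L(1) by (simp add: mult_nonneg_nonpos)
      then have "norm (F z) * exp (L * (Im z - 1/4)) \<le> norm (F z) * 1" by (intro mult_left_mono) auto
      then show ?thesis using \<open>norm (F z) \<le> M\<close> nG by simp
    next
      case False
      have "Im z < 1" using z1 abs_Im_le_cmod[of z] by linarith
      then have "L * (Im z - 1/4) \<le> L * 1" using L(1) by (intro mult_left_mono) auto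
      then have "exp (L * (Im z - 1/4)) \<le> M / \<epsilon>" using L(2) by (metis exp_le_cancel_iff mult.right_neutral)
      moreover have "norm (F z) \<le> \<epsilon>" using False alt \<Gamma>(2) by blast
      ultimately have "norm (F z) * exp (L * (Im z - 1/4)) \<le> \<epsilon> * (M / \<epsilon>)" using \<Gamma>(3) by (intro mult_mono) auto
      then show ?thesis using nG \<Gamma>(3) by simp
    qed
  qed
  then have "norm (F (\<i>/2)) * exp (L / 4) \<le> M" by (simp add: nG)
  then show ?thesis by (simp add: L_def[symmetric] exp_minus field_simps)
qed

lemma fashoda_complex_square:
  fixes f g :: "real \<Rightarrow> complex"
  assumes "path f" "path g"
    and f: "\<And>z. z \<in> path_image f \<Longrightarrow> \<bar>Re z\<bar> \<le> 1 \<and> \<bar>Im z\<bar> \<le> 1"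
    and g: "\<And>z. z \<in> path_image g \<Longrightarrow> \<bar>Re z\<bar> \<le> 1 \<and> \<bar>Im z\<bar> \<le> 1"
    and "Re (pathstart f) = -1" "Re (pathfinish f) = 1" "Im (pathstart g) = -1" "Im (pathfinish g) = 1"
  shows "path_image f \<inter> path_image g \<noteq> {}"
proof -
  define h :: "complex \<Rightarrow> real^2" where "h = (\<lambda>z. \<chi> i. if i = 1 then Re z else Im z)"
  have h12: "h z $ 1 = Re z" "h z $ 2 = Im z" for z by (auto simp: h_def)
  have "continuous_on S h" for S
    unfolding h_def
  proof (rule continuous_on_vec_lambda)
    show "continuous_on S (\<lambda>z. if i = 1 then Re z else Im z)" for i :: 2
      by (cases "i = 1") (auto intro!: continuous_intros)
  qed
  then have p: "path (h \<circ> f)" "path (h \<circ> g)" using assms(1,2) path_continuous_image by blast+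
  have mem: "h z \<in> cbox (-1) 1" if "\<bar>Re z\<bar> \<le> 1 \<and> \<bar>Im z\<bar> \<le> 1" for z
    using that by (auto simp: mem_box_cart forall_2 h12 abs_le_iff)
  obtain z where z: "z \<in> path_image (h \<circ> f)" "z \<in> path_image (h \<circ> g)"
  proof (rule fashoda[OF p, of "-1" 1])
    show "path_image (h \<circ> f) \<subseteq> cbox (-1) 1" "path_image (h \<circ> g) \<subseteq> cbox (-1) 1"
      using mem f g by (auto simp: path_image_compose)
    show "pathstart (h \<circ> f) $ 1 = (-1 :: real^2) $ 1" "pathfinish (h \<circ> f) $ 1 = (1 :: real^2) $ 1"
      "pathstart (h \<circ> g) $ 2 = (-1 :: real^2) $ 2" "pathfinish (h \<circ> g) $ 2 = (1 :: real^2) $ 2"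
      using assms(5-8) by (auto simp: pathstart_compose pathfinish_compose h12)
  qed
  then obtain x y where xy: "x \<in> path_image f" "y \<in> path_image g" "h x = h y" by (auto simp: path_image_compose)
  then have "x = y" using h12[of x] h12[of y] by (simp add: complex_eq_iff)
  then show ?thesis using xy by blast
qed

lemma open_half_disc: "open {z::complex. norm z < 1 \<and> 1/4 < Im z}" "open {z::complex. norm z < 1 \<and> Im z < -1/4}"
proof -
  have e: "{z::complex. norm z < 1 \<and> 1/4 < Im z} = ball 0 1 \<inter> {z. 1/4 < Im z}" by auto
  show "open {z::complex. norm z < 1 \<and> 1/4 < Im z}" unfolding e by (intro open_Int open_ball open_halfspace_Im_gt)
  have e: "{z::complex. norm z < 1 \<and> Im z < -1/4} = ball 0 1 \<inter> {z. Im z < -1/4}" by auto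
  show "open {z::complex. norm z < 1 \<and> Im z < -1/4}" unfolding e by (intro open_Int open_ball open_halfspace_Im_lt)
qed

lemma path_in_component:
  fixes S :: "complex set"
  assumes "open S" "y \<in> connected_component_set S x"
  obtains p where "path p" "path_image p \<subseteq> S" "pathstart p = x" "pathfinish p = y"
proof -
  have "path_component S x y" using assms open_path_connected_component[of S x] by simp
  then show ?thesis using that unfolding path_component_def by blast
qed

text \<open>If both components reached beyond radius \<open>\<rho>\<close>, paths in them together
  with the segment between \<open>-\<i>/2\<close> and \<open>\<i>/2\<close> would give a vertical
  crossing of the square. The path extended horizontally is a horizontal crossing, and the Fashoda
  theorem makes the two meet, which every pair of their parts excludes.\<close>

lemma path_through_disc_separates:
  fixes \<gamma> :: "real \<Rightarrow> complex"
  assumes "path \<gamma>" "path_image \<gamma> \<subseteq> cball 0 \<rho>" "\<rho> < 1" "\<And>z. z \<in> path_image \<gamma> \<Longrightarrow> 1/2 < norm z"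
    and a: "Re (pathstart \<gamma>) < 0" "\<bar>Im (pathstart \<gamma>)\<bar> < 1/4"
    and b: "Re (pathfinish \<gamma>) > 0" "\<bar>Im (pathfinish \<gamma>)\<bar> < 1/4"
  shows "connected_component_set ({z. norm z < 1 \<and> 1/4 < Im z} - path_image \<gamma>) (\<i>/2) \<subseteq> cball 0 \<rho> \<or>
    connected_component_set ({z. norm z < 1 \<and> Im z < -1/4} - path_image \<gamma>) (-\<i>/2) \<subseteq> cball 0 \<rho>"
proof (rule ccontr)
  let ?\<Gamma> = "path_image \<gamma>"
  let ?U = "{z. norm z < 1 \<and> 1/4 < Im z} - ?\<Gamma>" and ?L = "{z. norm z < 1 \<and> Im z < -1/4} - ?\<Gamma>"
  assume "\<not> ?thesis"
  then obtain u l where u: "u \<in> connected_component_set ?U (\<i>/2)" "norm u > \<rho>"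
    and l: "l \<in> connected_component_set ?L (-\<i>/2)" "norm l > \<rho>" by (auto simp: subset_iff not_le)
  have cl: "closed ?\<Gamma>" using assms(1) by (simp add: closed_path_image)
  have op: "open ?U" "open ?L" using open_half_disc cl by (auto intro: open_Diff)
  obtain pu where pu: "path pu" "path_image pu \<subseteq> ?U" "pathstart pu = \<i>/2" "pathfinish pu = u"
    by (rule path_in_component[OF op(1) u(1)])
  obtain pl where pl: "path pl" "path_image pl \<subseteq> ?L" "pathstart pl = -\<i>/2" "pathfinish pl = l"
    by (rule path_in_component[OF op(2) l(1)])
  have uU: "u \<in> ?U" and lL: "l \<in> ?L"
    using pathfinish_in_path_image[of pu] pathfinish_in_path_image[of pl] pu(2,4) pl(2,4) by auto
  define a where "a = pathstart \<gamma>"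
  define b where "b = pathfinish \<gamma>"
  note a' = a[folded a_def] and b' = b[folded b_def]
  \<comment> \<open>The horizontal extensions stay at heights below \<open>1/4\<close> in absolute
    value and off the imaginary axis; this is what the conditions on the endpoints are for.\<close>
  define g where "g = linepath (Complex (-1) (Im a)) a +++ \<gamma> +++ linepath b (Complex 1 (Im b))"
  \<comment> \<open>The outer vertical segments start beyond radius \<open>\<rho>\<close> and run
    outwards, so they miss the path; the middle segment misses it because the path keeps modulus
    above \<open>1/2\<close>.\<close>
  define m where "m = linepath (Complex (Re l) (-1)) l +++ reversepath pl +++ linepath (-\<i>/2) (\<i>/2) +++ pu +++ linepath u (Complex (Re u) 1)"
  have pg: "path g" unfolding g_def using assms(1) by (auto simp: a_def b_def)
  have pm: "path m" unfolding m_def using pu pl by auto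
  have img: "path_image g = closed_segment (Complex (-1) (Im a)) a \<union> (?\<Gamma> \<union> closed_segment b (Complex 1 (Im b)))"
    unfolding g_def by (simp add: path_image_join a_def b_def)
  have imm: "path_image m = closed_segment (Complex (Re l) (-1)) l \<union> (path_image pl \<union>
      (closed_segment (-\<i>/2) (\<i>/2) \<union> (path_image pu \<union> closed_segment u (Complex (Re u) 1))))"
    unfolding m_def using pu pl by (simp add: path_image_join)
  have ab\<Gamma>: "a \<in> ?\<Gamma>" "b \<in> ?\<Gamma>" by (auto simp: a_def b_def)
  have \<Gamma>1: "norm z < 1" if "z \<in> ?\<Gamma>" for z using assms(2,3) that by auto
  have seg_a: "Im z = Im a" "-1 \<le> Re z" "Re z \<le> Re a" if zz: "z \<in> closed_segment (Complex (-1) (Im a)) a" for z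
  proof -
    obtain t where t: "0 \<le> t" "t \<le> 1" "z = (1 - t) *\<^sub>R Complex (-1) (Im a) + t *\<^sub>R a"
      using zz by (auto simp: in_segment)
    have "-1 \<le> Re a" using \<Gamma>1[OF ab\<Gamma>(1)] abs_Re_le_cmod[of a] by linarith
    then have "0 \<le> t * (Re a + 1)" "0 \<le> (1 - t) * (Re a + 1)" using t by simp_all
    moreover have "Re z = (1 - t) * (-1) + t * Re a" "Im z = (1 - t) * Im a + t * Im a" using t(3) by simp_all
    ultimately show "Im z = Im a" "-1 \<le> Re z" "Re z \<le> Re a" by (simp_all add: algebra_simps)
  qed
  have seg_b: "Im z = Im b" "Re b \<le> Re z" "Re z \<le> 1" if zz: "z \<in> closed_segment b (Complex 1 (Im b))" for z
  proof -
    obtain t where t: "0 \<le> t" "t \<le> 1" "z = (1 - t) *\<^sub>R b + t *\<^sub>R Complex 1 (Im b)"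
      using zz by (auto simp: in_segment)
    have "Re b \<le> 1" using \<Gamma>1[OF ab\<Gamma>(2)] abs_Re_le_cmod[of b] by linarith
    then have "0 \<le> t * (1 - Re b)" "0 \<le> (1 - t) * (1 - Re b)" using t by simp_all
    moreover have "Re z = (1 - t) * Re b + t * 1" "Im z = (1 - t) * Im b + t * Im b" using t(3) by simp_all
    ultimately show "Im z = Im b" "Re b \<le> Re z" "Re z \<le> 1" by (simp_all add: algebra_simps)
  qed
  have seg_u: "Re z = Re u" "Im u \<le> Im z" "Im z \<le> 1" if zz: "z \<in> closed_segment u (Complex (Re u) 1)" for z
  proof -
    obtain t where t: "0 \<le> t" "t \<le> 1" "z = (1 - t) *\<^sub>R u + t *\<^sub>R Complex (Re u) 1"
      using zz by (auto simp: in_segment)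
    have "Im u \<le> 1" using uU abs_Im_le_cmod[of u] by auto
    then have "0 \<le> t * (1 - Im u)" "0 \<le> (1 - t) * (1 - Im u)" using t by simp_all
    moreover have "Re z = (1 - t) * Re u + t * Re u" "Im z = (1 - t) * Im u + t * 1" using t(3) by simp_all
    ultimately show "Re z = Re u" "Im u \<le> Im z" "Im z \<le> 1" by (simp_all add: algebra_simps)
  qed
  have seg_l: "Re z = Re l" "Im z \<le> Im l" "-1 \<le> Im z" if zz: "z \<in> closed_segment (Complex (Re l) (-1)) l" for z
  proof -
    obtain t where t: "0 \<le> t" "t \<le> 1" "z = (1 - t) *\<^sub>R Complex (Re l) (-1) + t *\<^sub>R l"
      using zz by (auto simp: in_segment)
    have "-1 \<le> Im l" using lL abs_Im_le_cmod[of l] by auto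
    then have "0 \<le> t * (Im l + 1)" "0 \<le> (1 - t) * (Im l + 1)" using t by simp_all
    moreover have "Re z = (1 - t) * Re l + t * Re l" "Im z = (1 - t) * (-1) + t * Im l" using t(3) by simp_all
    ultimately show "Re z = Re l" "Im z \<le> Im l" "-1 \<le> Im z" by (simp_all add: algebra_simps)
  qed
  have seg_m: "Re z = 0" "\<bar>Im z\<bar> \<le> 1/2" if zz: "z \<in> closed_segment (-\<i>/2) (\<i>/2)" for z
  proof -
    obtain t where t: "0 \<le> t" "t \<le> 1" "z = (1 - t) *\<^sub>R (-\<i>/2) + t *\<^sub>R (\<i>/2)"
      using zz by (auto simp: in_segment)
    then have "Re z = 0" "Im z = (1 - t) * (-1/2) + t * (1/2)" by simp_all
    then show "Re z = 0" "\<bar>Im z\<bar> \<le> 1/2" using t(1,2) by (simp_all add: abs_le_iff field_simps)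
  qed
  have sq: "\<bar>Re z\<bar> \<le> 1 \<and> \<bar>Im z\<bar> \<le> 1" if "norm z < 1" for z
    using that abs_Re_le_cmod[of z] abs_Im_le_cmod[of z] by linarith
  have "path_image g \<inter> path_image m \<noteq> {}"
  proof (rule fashoda_complex_square[OF pg pm])
    show "\<bar>Re z\<bar> \<le> 1 \<and> \<bar>Im z\<bar> \<le> 1" if "z \<in> path_image g" for z
      using that sq[OF \<Gamma>1] seg_a[of z] seg_b[of z] sq[OF \<Gamma>1[OF ab\<Gamma>(1)]] sq[OF \<Gamma>1[OF ab\<Gamma>(2)]] a' b'
      unfolding img by (auto simp: abs_le_iff)
    have nu: "norm u < 1" "norm l < 1" using uU lL by auto
    have sub: "norm z < 1" if "z \<in> path_image pl \<or> z \<in> path_image pu" for z using that pu(2) pl(2) by auto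
    show "\<bar>Re z\<bar> \<le> 1 \<and> \<bar>Im z\<bar> \<le> 1" if "z \<in> path_image m" for z
    proof -
      consider "z \<in> closed_segment (Complex (Re l) (-1)) l" | "norm z < 1"
        | "z \<in> closed_segment (-\<i>/2) (\<i>/2)" | "z \<in> closed_segment u (Complex (Re u) 1)"
        using \<open>z \<in> path_image m\<close> sub unfolding imm by blast
      then show ?thesis
      proof cases
        case 1 then show ?thesis using seg_l[OF 1] sq[OF nu(2)] by (auto simp: abs_le_iff)
      next
        case 2 then show ?thesis by (rule sq)
      next
        case 3 then show ?thesis using seg_m[OF 3] by auto
      next
        case 4 then show ?thesis using seg_u[OF 4] sq[OF nu(1)] by (auto simp: abs_le_iff)
      qed
    qed
  qed (simp_all add: g_def m_def)
  then obtain z where zg: "z \<in> path_image g" and zm: "z \<in> path_image m" by blast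
  have im_g: "\<bar>Im z\<bar> < 1/4 \<and> Re z \<noteq> 0" if "z \<notin> ?\<Gamma>"
    using zg that seg_a[of z] seg_b[of z] a' b' unfolding img by auto
  have "z \<in> ?\<Gamma>"
  proof (rule ccontr)
    assume n: "z \<notin> ?\<Gamma>"
    note im_g[OF n]
    moreover have "Im z < -1/4 \<or> Im z > 1/4 \<or> Re z = 0"
      using zm pu(2) pl(2) seg_u[of z] seg_l[of z] seg_m[of z] uU lL unfolding imm by auto
    ultimately show False by linarith
  qed
  then have z1: "norm z \<le> \<rho>" "1/2 < norm z" using assms(2,4) by auto
  have "z \<notin> path_image pl" "z \<notin> path_image pu" using \<open>z \<in> ?\<Gamma>\<close> pu(2) pl(2) by auto
  moreover have "z \<notin> closed_segment (-\<i>/2) (\<i>/2)"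
  proof
    assume "z \<in> closed_segment (-\<i>/2) (\<i>/2)"
    from seg_m[OF this] have "norm z \<le> 1/2" by (simp add: cmod_eq_Im)
    then show False using z1 by simp
  qed
  moreover have "z \<notin> closed_segment u (Complex (Re u) 1)"
  proof
    assume "z \<in> closed_segment u (Complex (Re u) 1)"
    note s = seg_u[OF this]
    have "(Im u)\<^sup>2 \<le> (Im z)\<^sup>2" using s uU by (intro power_mono) auto
    then have "norm u \<le> norm z" unfolding cmod_def using s by simp
    then show False using z1 u(2) by simp
  qed
  moreover have "z \<notin> closed_segment (Complex (Re l) (-1)) l"
  proof
    assume "z \<in> closed_segment (Complex (Re l) (-1)) l"
    note s = seg_l[OF this]
    have "(Im l)\<^sup>2 \<le> (Im z)\<^sup>2" using s lL by (auto simp: abs_le_square_iff[symmetric])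
    then have "norm l \<le> norm z" unfolding cmod_def using s by simp
    then show False using z1 l(2) by simp
  qed
  ultimately show False using zm unfolding imm by blast
qed

text \<open>A quantitative form of Koebe's lemma. The harmonic functions that compare the bound on the path
  with the global bound are affine, one for each half of the disc, and the path cuts off a component
  in at least one half.\<close>

lemma koebe_path_bound:
  fixes F :: "complex \<Rightarrow> complex"
  assumes hol: "F holomorphic_on ball 0 1" and M: "\<And>z. z \<in> ball 0 1 \<Longrightarrow> norm (F z) \<le> M"
    and \<gamma>: "path \<gamma>" "path_image \<gamma> \<subseteq> ball 0 1" "\<And>z. z \<in> path_image \<gamma> \<Longrightarrow> 1/2 < norm z"
    and a: "Re (pathstart \<gamma>) < 0" "\<bar>Im (pathstart \<gamma>)\<bar> < 1/4"
    and b: "Re (pathfinish \<gamma>) > 0" "\<bar>Im (pathfinish \<gamma>)\<bar> < 1/4"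
    and \<epsilon>: "\<And>z. z \<in> path_image \<gamma> \<Longrightarrow> norm (F z) \<le> \<epsilon>" "0 < \<epsilon>" "\<epsilon> \<le> M"
  shows "norm (F (\<i>/2)) \<le> M * exp (- ln (M / \<epsilon>) / 4) \<or> norm (F (-\<i>/2)) \<le> M * exp (- ln (M / \<epsilon>) / 4)"
proof -
  let ?\<Gamma> = "path_image \<gamma>"
  have cl: "closed ?\<Gamma>" using \<gamma>(1) by (simp add: closed_path_image)
  \<comment> \<open>The largest modulus on the path supplies a radius below 1 that encloses
    it.\<close>
  obtain x where x: "x \<in> ?\<Gamma>" "\<forall>y\<in>?\<Gamma>. norm y \<le> norm x"
    using continuous_attains_sup[of ?\<Gamma> norm] compact_path_image[OF \<gamma>(1)] path_image_nonempty[of \<gamma>]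
    by (auto intro: continuous_on_norm_id)
  define \<rho> where "\<rho> = norm x"
  have \<rho>: "\<rho> < 1" "?\<Gamma> \<subseteq> cball 0 \<rho>" using x \<gamma>(2) by (auto simp: \<rho>_def)
  have ni: "\<i>/2 \<notin> ?\<Gamma>" "-\<i>/2 \<notin> ?\<Gamma>" using \<gamma>(3)[of "\<i>/2"] \<gamma>(3)[of "-\<i>/2"] by (auto simp: norm_divide)
  consider "connected_component_set ({z. norm z < 1 \<and> 1/4 < Im z} - ?\<Gamma>) (\<i>/2) \<subseteq> cball 0 \<rho>"
    | "connected_component_set ({z. norm z < 1 \<and> Im z < -1/4} - ?\<Gamma>) (-\<i>/2) \<subseteq> cball 0 \<rho>"
    using path_through_disc_separates[OF \<gamma>(1) \<rho>(2,1) \<gamma>(3) a b] by blast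
  then show ?thesis
  proof cases
    case 1
    show ?thesis using koebe_half_disc[OF hol M cl \<epsilon> ni(1) 1 \<rho>(1)] by blast
  next
    case 2
    \<comment> \<open>Reflection in the origin exchanges the two halves of the disc, so the estimate
      for the upper half applies to \<open>F (- z)\<close>.\<close>
    let ?\<Gamma>' = "uminus ` ?\<Gamma>"
    have "norm (F (- (\<i>/2))) \<le> M * exp (- ln (M / \<epsilon>) / 4)"
    proof (rule koebe_half_disc[where F = "\<lambda>z. F (- z)" and \<Gamma> = ?\<Gamma>'])
      have "(F \<circ> uminus) holomorphic_on ball 0 1"
        by (rule holomorphic_on_compose_gen[OF _ hol]) (auto intro!: holomorphic_intros)
      then show "(\<lambda>z. F (- z)) holomorphic_on ball 0 1" by (simp add: comp_def)
      show "closed ?\<Gamma>'" using cl by (rule closed_negations)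
      show "\<i>/2 \<notin> ?\<Gamma>'" using ni(2) by (auto simp: minus_equation_iff)
      let ?C = "connected_component_set ({z. norm z < 1 \<and> 1/4 < Im z} - ?\<Gamma>') (\<i>/2)"
      have Csub: "?C \<subseteq> {z. norm z < 1 \<and> 1/4 < Im z} - ?\<Gamma>'" by (rule connected_component_subset)
      have "uminus ` ?C \<subseteq> connected_component_set ({z. norm z < 1 \<and> Im z < -1/4} - ?\<Gamma>) (-\<i>/2)"
      proof (rule connected_component_maximal)
        have "\<i>/2 \<in> {z. norm z < 1 \<and> 1/4 < Im z} - ?\<Gamma>'" using \<open>\<i>/2 \<notin> ?\<Gamma>'\<close> by (simp add: norm_divide)
        then have "\<i>/2 \<in> ?C" by simp
        then have "- (\<i>/2) \<in> uminus ` ?C" by (rule imageI)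
        then show "-\<i>/2 \<in> uminus ` ?C" by simp
        show "connected (uminus ` ?C)"
          by (intro connected_continuous_image connected_connected_component continuous_intros)
        show "uminus ` ?C \<subseteq> {z. norm z < 1 \<and> Im z < -1/4} - ?\<Gamma>"
        proof
          fix y assume "y \<in> uminus ` ?C"
          then obtain x where x: "y = - x" "x \<in> ?C" by blast
          then have "x \<in> {z. norm z < 1 \<and> 1/4 < Im z} - ?\<Gamma>'" using Csub by blast
          then have "norm y < 1" "1/4 < - Im y" "- y \<notin> ?\<Gamma>'" using x(1) by auto
          moreover from this have "y \<notin> ?\<Gamma>" using imageI[of y ?\<Gamma> uminus] by blast
          ultimately show "y \<in> {z. norm z < 1 \<and> Im z < -1/4} - ?\<Gamma>" by auto
        qed
      qed
      then have sub: "uminus ` ?C \<subseteq> cball 0 \<rho>" using 2 by (rule subset_trans)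
      show "?C \<subseteq> cball 0 \<rho>"
      proof
        fix x assume "x \<in> ?C"
        then have "- x \<in> cball 0 \<rho>" using sub by blast
        then show "x \<in> cball 0 \<rho>" by simp
      qed
    qed (use M \<epsilon> \<rho> in auto)
    then show ?thesis by simp
  qed
qed

text \<open>A rotation makes the two points mirror images in the imaginary axis. A Moebius
  transformation with purely imaginary parameter commutes with that reflection and can be chosen to
  send one of them to 1, hence the other to -1.\<close>

lemma disc_automorphism_antipodal:
  fixes \<zeta> \<omega> :: complex
  assumes "norm \<zeta> = 1" "norm \<omega> = 1" "\<zeta> \<noteq> \<omega>"
  obtains m m' where "m holomorphic_on ball 0 1" "m' holomorphic_on ball 0 1"
    "\<And>z. z \<in> ball 0 1 \<Longrightarrow> m z \<in> ball 0 1" "\<And>z. z \<in> ball 0 1 \<Longrightarrow> m' z \<in> ball 0 1"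
    "\<And>z. z \<in> ball 0 1 \<Longrightarrow> m' (m z) = z" "isCont m \<zeta>" "isCont m \<omega>" "m \<zeta> = -1" "m \<omega> = 1"
proof -
  have nz: "\<zeta> \<noteq> 0" "\<omega> \<noteq> 0" using assms by auto
  \<comment> \<open>A square root of \<open>- 1 / (\<zeta> * \<omega>)\<close> makes the product of
    the rotated points -1, so each is minus the conjugate of the other.\<close>
  define u0 where "u0 = csqrt (- 1 / (\<zeta> * \<omega>))"
  have u0: "u0\<^sup>2 = - 1 / (\<zeta> * \<omega>)" by (simp add: u0_def)
  \<comment> \<open>The sign of the root is chosen so that the rotated \<open>\<omega>\<close> lies
    in the right half-plane.\<close>
  define u where "u = (if Re (u0 * \<omega>) < 0 then - u0 else u0)"
  have u2: "u\<^sup>2 = - 1 / (\<zeta> * \<omega>)" using u0 by (simp add: u_def)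
  have "norm u ^ 2 = 1" using u2 assms by (simp add: norm_power[symmetric] norm_divide norm_mult)
  then have nu: "norm u = 1" using norm_ge_zero[of u] by (simp add: power2_eq_1_iff)
  then have "u \<noteq> 0" by auto
  define v where "v = u * \<omega>"
  define x where "x = Re v"
  define y where "y = Im v"
  have uw: "v = Complex x y" unfolding x_def y_def by (rule complex_surj[symmetric])
  have nv: "norm v = 1" using nu assms by (simp add: v_def norm_mult)
  have xy: "x\<^sup>2 + y\<^sup>2 = 1"
    using nv cmod_power2[of v] by (simp add: x_def y_def)
  have uzv: "(u * \<zeta>) * v = -1" using u2 nz by (simp add: v_def power2_eq_square field_simps)
  have vv: "v * cnj v = 1" using complex_mult_cnj[of v] xy unfolding x_def y_def by (simp del: of_real_add of_real_power)
  have "u * \<zeta> = (u * \<zeta>) * (v * cnj v)" unfolding vv by simp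
  also have "\<dots> = ((u * \<zeta>) * v) * cnj v" by (simp only: mult.assoc)
  also have "\<dots> = - cnj v" unfolding uzv by simp
  finally have "u * \<zeta> = - cnj v" .
  then have uz: "u * \<zeta> = Complex (- x) y" unfolding uw by (simp add: complex_eq_iff)
  have "x \<ge> 0" by (auto simp: x_def v_def u_def)
  moreover have "x \<noteq> 0"
  proof
    assume "x = 0"
    then have "u * \<zeta> = u * \<omega>" using uw uz by (simp add: v_def)
    then show False using \<open>u \<noteq> 0\<close> assms(3) by simp
  qed
  ultimately have x: "x > 0" by simp
  \<comment> \<open>Tangent of half the argument of \<open>v\<close>: exactly the value for which
    numerator and denominator of the Moebius quotient agree at \<open>v\<close>.\<close>
  define b where "b = y / (1 + x)"
  have b1: "x = 1 - b * y" "y - b = b * x"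
  proof -
    have "b * (1 + x) = y" using x by (simp add: b_def)
    then show "y - b = b * x" by (simp add: algebra_simps)
    have "b * y * (1 + x) = (b * (1 + x)) * y" by (simp only: ac_simps)
    also have "\<dots> = y\<^sup>2" unfolding \<open>b * (1 + x) = y\<close> by (simp add: power2_eq_square)
    finally have "b * y * (1 + x) = y\<^sup>2" .
    also have "\<dots> = (1 - x) * (1 + x)" using xy by (simp add: power2_eq_square algebra_simps)
    finally have "b * y = 1 - x" using x by simp
    then show "x = 1 - b * y" by simp
  qed
  have "b\<^sup>2 < 1"
  proof -
    have "y\<^sup>2 < (1 + x)\<^sup>2" using xy x by (simp add: power2_eq_square algebra_simps) (smt (verit) mult_pos_pos)
    then show ?thesis using x by (simp add: b_def power_divide)
  qed
  then have babs: "\<bar>b\<bar> < 1" by (simp add: abs_square_less_1)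
  define a where "a = \<i> * of_real b"
  have na: "norm a < 1" "norm (- a) < 1" using babs by (simp_all add: a_def norm_mult)
  have cna: "cnj a = - \<i> * of_real b" by (simp add: a_def)
  define m where "m = (\<lambda>z. Moebius_function 0 a (u * z))"
  define m' where "m' = (\<lambda>z. Moebius_function 0 (- a) z / u)"
  have den: "1 - cnj a * (u * z) \<noteq> 0" if "norm z \<le> 1" for z
  proof
    assume "1 - cnj a * (u * z) = 0"
    then have "norm (cnj a * (u * z)) = 1" by (metis eq_iff_diff_eq_0 norm_one)
    then have "\<bar>b\<bar> * norm z = 1" using nu by (simp add: cna norm_mult)
    moreover have "\<bar>b\<bar> * norm z \<le> \<bar>b\<bar> * 1" using that by (intro mult_left_mono) auto
    ultimately show False using babs by simp
  qed
  show ?thesis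
  proof (rule that[of m m'])
    show "m holomorphic_on ball 0 1"
      unfolding m_def Moebius_function_simple using den by (auto intro!: holomorphic_intros)
    show "m' holomorphic_on ball 0 1"
      unfolding m'_def using Moebius_function_holomorphic[OF na(2)] \<open>u \<noteq> 0\<close> by (auto intro!: holomorphic_intros)
    have uball: "norm (u * z) < 1" if "z \<in> ball 0 1" for z using that nu by (simp add: norm_mult)
    show "m z \<in> ball 0 1" if "z \<in> ball 0 1" for z
      using Moebius_function_norm_lt_1[OF na(1) uball[OF that]] by (simp add: m_def)
    show "m' z \<in> ball 0 1" if "z \<in> ball 0 1" for z
      using Moebius_function_norm_lt_1[OF na(2), of z] that nu by (simp add: m'_def norm_divide)
    show "m' (m z) = z" if "z \<in> ball 0 1" for z
      using Moebius_function_compose[OF _ na(2) uball[OF that], of a] \<open>u \<noteq> 0\<close> by (simp add: m_def m'_def)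
    show "isCont m \<zeta>" "isCont m \<omega>"
      unfolding m_def Moebius_function_simple using den[of \<zeta>] den[of \<omega>] assms by (auto intro!: continuous_intros)
    have "u * \<omega> - a = 1 - cnj a * (u * \<omega>)" "u * \<zeta> - a = - (1 - cnj a * (u * \<zeta>))"
      unfolding v_def[symmetric] uw uz cna using b1 by (auto simp: complex_eq_iff a_def algebra_simps)
    then show "m \<zeta> = -1" "m \<omega> = 1"
      unfolding m_def Moebius_function_simple using den[of \<zeta>] den[of \<omega>] assms by (simp_all add: divide_eq_minus_1_iff)
  qed
qed

section \<open>The Riemann map of a Jordan domain near the boundary\<close>

locale jordan_riemann =
  fixes c :: "real \<Rightarrow> complex" and \<phi> \<psi> :: "complex \<Rightarrow> complex" and J \<Omega> :: "complex set"
  assumes c: "simple_path c" "pathfinish c = pathstart c"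
    and J: "J = path_image c" and \<Omega>: "\<Omega> = inside (path_image c)"
    and hol: "\<phi> holomorphic_on \<Omega>" "\<psi> holomorphic_on ball 0 1"
    and \<phi>: "\<And>z. z \<in> \<Omega> \<Longrightarrow> \<phi> z \<in> ball 0 1" "\<And>z. z \<in> \<Omega> \<Longrightarrow> \<psi> (\<phi> z) = z"
    and \<psi>: "\<And>z. z \<in> ball 0 1 \<Longrightarrow> \<psi> z \<in> \<Omega>" "\<And>z. z \<in> ball 0 1 \<Longrightarrow> \<phi> (\<psi> z) = z"
begin

lemma \<Omega>_facts: "open \<Omega>" "connected \<Omega>" "bounded \<Omega>" "\<Omega> \<inter> J = {}" "closure \<Omega> = \<Omega> \<union> J" "frontier \<Omega> = J" "compact (\<Omega> \<union> J)"
proof -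
  note JO = Jordan_inside_outside[OF c]
  show op: "open \<Omega>" "connected \<Omega>" "bounded \<Omega>" "frontier \<Omega> = J" using JO by (auto simp: J \<Omega>)
  show "\<Omega> \<inter> J = {}" using JO by (auto simp: J \<Omega>)
  show cl: "closure \<Omega> = \<Omega> \<union> J" using closure_Un_frontier[of \<Omega>] op(4) by simp
  show "compact (\<Omega> \<union> J)" unfolding cl[symmetric] using op(3) by simp
qed

text \<open>At a limit inside the disc, continuity of \<open>\<psi>\<close> would return the
  sequence to a point of \<open>\<Omega>\<close>, not to the boundary point
  \<open>q\<close>.\<close>

lemma boundary_limit_norm:
  assumes "\<And>n. X n \<in> \<Omega>" "X \<longlonglongrightarrow> q" "q \<in> J" "(\<lambda>n. \<phi> (X n)) \<longlonglongrightarrow> \<zeta>"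
  shows "norm \<zeta> = 1"
proof (rule ccontr)
  assume "norm \<zeta> \<noteq> 1"
  moreover have "norm \<zeta> \<le> 1"
    by (rule LIMSEQ_le_const2[OF tendsto_norm[OF assms(4)]]) (use \<phi>(1) assms(1) in \<open>auto intro!: exI[of _ 0] less_imp_le\<close>)
  ultimately have \<zeta>: "\<zeta> \<in> ball 0 1" by simp
  have "isCont \<psi> \<zeta>" using hol(2) \<zeta> by (meson continuous_on_eq_continuous_at holomorphic_on_imp_continuous_on open_ball)
  then have "(\<lambda>n. \<psi> (\<phi> (X n))) \<longlonglongrightarrow> \<psi> \<zeta>" using assms(4) by (rule isCont_tendsto_compose)
  then have "X \<longlonglongrightarrow> \<psi> \<zeta>" using \<phi>(2) assms(1) by simp
  then have "q = \<psi> \<zeta>" using assms(2) LIMSEQ_unique by blast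
  then show False using \<psi>(1)[OF \<zeta>] assms(3) \<Omega>_facts(4) by blast
qed

text \<open>Koebe's argument. With the two limits moved to -1 and 1, points near \<open>q\<close>
  can be joined inside \<open>\<Omega>\<close> near \<open>q\<close>, and the image of such a path
  crosses the disc from near -1 to near 1. On it \<open>F\<close>, the inverse map minus
  \<open>q\<close>, is arbitrarily small, so one of its values at the two fixed test points would be
  arbitrarily small, although \<open>F\<close> has no zero.\<close>

lemma no_two_boundary_limits:
  assumes q: "q \<in> J"
    and X: "\<And>n. X n \<in> \<Omega>" "X \<longlonglongrightarrow> q" "(\<lambda>n. \<phi> (X n)) \<longlonglongrightarrow> \<zeta>"
    and Y: "\<And>n. Y n \<in> \<Omega>" "Y \<longlonglongrightarrow> q" "(\<lambda>n. \<phi> (Y n)) \<longlonglongrightarrow> \<omega>"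
  shows "\<zeta> = \<omega>"
proof (rule ccontr)
  assume ne: "\<zeta> \<noteq> \<omega>"
  have n1: "norm \<zeta> = 1" "norm \<omega> = 1" using boundary_limit_norm X Y q by blast+
  obtain m m' where m: "m holomorphic_on ball 0 1" "m' holomorphic_on ball 0 1"
    "\<And>z. z \<in> ball 0 1 \<Longrightarrow> m z \<in> ball 0 1" "\<And>z. z \<in> ball 0 1 \<Longrightarrow> m' z \<in> ball 0 1"
    "\<And>z. z \<in> ball 0 1 \<Longrightarrow> m' (m z) = z" "isCont m \<zeta>" "isCont m \<omega>" "m \<zeta> = -1" "m \<omega> = 1"
    by (rule disc_automorphism_antipodal[OF n1 ne]) (rule that; assumption)
  define F where "F = (\<lambda>z. \<psi> (m' z) - q)"
  have hol\<psi>m: "(\<psi> \<circ> m') holomorphic_on ball 0 1"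
    by (rule holomorphic_on_compose_gen[OF m(2) hol(2)]) (use m(4) in auto)
  then have holF: "F holomorphic_on ball 0 1" unfolding F_def by (auto intro!: holomorphic_intros simp: comp_def)
  have Fval: "\<psi> (m' z) \<in> \<Omega>" if "z \<in> ball 0 1" for z using m(4) \<psi>(1) that by blast
  obtain M0 where M0: "\<And>z. z \<in> \<Omega> \<Longrightarrow> norm z \<le> M0" using \<Omega>_facts(3) by (auto simp: bounded_iff)
  define M where "M = \<bar>M0\<bar> + norm q + 1"
  have M: "M > 0" "norm (F z) \<le> M" if "z \<in> ball 0 1" for z
  proof -
    show "M > 0" unfolding M_def using norm_ge_zero[of q] by linarith
    show "norm (F z) \<le> M"
      using norm_triangle_ineq4[of "\<psi> (m' z)" q] M0[OF Fval[OF that]] by (simp add: F_def M_def)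
  qed
  have Fnz: "F z \<noteq> 0" if "z \<in> ball 0 1" for z
    using Fval[OF that] q \<Omega>_facts(4) by (auto simp: F_def)
  have i2: "\<i>/2 \<in> ball (0::complex) 1" "-\<i>/2 \<in> ball (0::complex) 1" by (simp_all add: norm_divide)
  have Mpos: "M > 0" using M(1)[OF i2(1)] .
  define c0 where "c0 = min (norm (F (\<i>/2))) (norm (F (-\<i>/2)))"
  have c0: "c0 > 0" using Fnz i2 by (simp add: c0_def)
  \<comment> \<open>Half the critical ratio, so that the final bound \<open>M * t\<close> stays
    strictly below both test values; the cap 1 makes \<open>\<epsilon> \<le> M\<close>.\<close>
  define t where "t = min 1 (c0 / (2 * M))"
  have t: "0 < t" "t \<le> 1" "M * t < c0"
  proof -
    show "0 < t" "t \<le> 1" using c0 Mpos by (auto simp: t_def)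
    have "M * t \<le> M * (c0 / (2 * M))" using Mpos by (intro mult_left_mono) (auto simp: t_def)
    also have "\<dots> < c0" using Mpos c0 by simp
    finally show "M * t < c0" .
  qed
  \<comment> \<open>The fourth power cancels the factor \<open>1/4\<close> in the exponent of the
    Koebe bound, which becomes exactly \<open>M * t\<close>.\<close>
  define \<epsilon> where "\<epsilon> = M * t ^ 4"
  have \<epsilon>: "0 < \<epsilon>" "\<epsilon> \<le> M" using Mpos t by (auto simp: \<epsilon>_def power_le_one)
  have "M / \<epsilon> = inverse (t ^ 4)" using Mpos by (simp add: \<epsilon>_def inverse_eq_divide)
  then have "ln (M / \<epsilon>) = - (4 * ln t)" using t(1) by (simp add: ln_inverse ln_realpow)
  then have bound: "M * exp (- ln (M / \<epsilon>) / 4) = M * t" using t(1) by simp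
  \<comment> \<open>This compact part of \<open>\<Omega>\<close> has positive distance from
    \<open>q\<close>; a path staying closer to \<open>q\<close> has its image outside the disc of
    radius \<open>1/2\<close>, as the Koebe bound requires.\<close>
  let ?Q = "(\<psi> \<circ> m') ` cball 0 (1/2)"
  have "compact ?Q"
    by (intro compact_continuous_image compact_cball continuous_on_subset[OF holomorphic_on_imp_continuous_on[OF hol\<psi>m]]) auto
  then have "open (- ?Q)" by (simp add: compact_imp_closed open_Compl)
  moreover have "q \<in> - ?Q"
  proof -
    have "?Q \<subseteq> \<Omega>" using Fval by auto
    then show ?thesis using q \<Omega>_facts(4) by blast
  qed
  ultimately obtain r0 where r0: "r0 > 0" "ball q r0 \<subseteq> - ?Q" by (meson open_contains_ball)
  define \<eta> where "\<eta> = min \<epsilon> r0"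
  have "\<eta> > 0" using \<epsilon> r0 by (simp add: \<eta>_def)
  then obtain d where d: "d > 0" "\<And>z w. z \<in> \<Omega> \<inter> ball q d \<Longrightarrow> w \<in> \<Omega> \<inter> ball q d \<Longrightarrow> connected_component (\<Omega> \<inter> ball q \<eta>) z w"
    using inside_simple_loop_locally_connected[OF c, of q \<eta>] q unfolding J \<Omega> by blast
  have "(\<lambda>n. m (\<phi> (X n))) \<longlonglongrightarrow> -1" "(\<lambda>n. m (\<phi> (Y n))) \<longlonglongrightarrow> 1"
    using isCont_tendsto_compose[OF m(6) X(3)] isCont_tendsto_compose[OF m(7) Y(3)] m(8,9) by simp_all
  from tendstoD[OF this(1), of "1/4"] tendstoD[OF this(2), of "1/4"]
  have ev1: "\<forall>\<^sub>F n in sequentially. dist (m (\<phi> (X n))) (-1) < 1/4"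
    "\<forall>\<^sub>F n in sequentially. dist (m (\<phi> (Y n))) 1 < 1/4" by simp_all
  have ev2: "\<forall>\<^sub>F n in sequentially. dist (X n) q < d" "\<forall>\<^sub>F n in sequentially. dist (Y n) q < d"
    using X(2) Y(2) d(1) by (auto intro: tendstoD)
  obtain n where n: "dist (m (\<phi> (X n))) (-1) < 1/4" "dist (m (\<phi> (Y n))) 1 < 1/4" "dist (X n) q < d" "dist (Y n) q < d"
    using eventually_happens'[OF sequentially_bot eventually_conj[OF eventually_conj[OF ev1] eventually_conj[OF ev2]]] by blast
  have "connected_component (\<Omega> \<inter> ball q \<eta>) (X n) (Y n)"
    using d(2) X(1) Y(1) n(3,4) by (simp add: dist_commute)
  then have "path_component (\<Omega> \<inter> ball q \<eta>) (X n) (Y n)"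
    using open_path_connected_component[OF open_Int[OF \<Omega>_facts(1) open_ball[of q \<eta>]], of "X n"] by simp
  then obtain \<beta> where \<beta>: "path \<beta>" "path_image \<beta> \<subseteq> \<Omega> \<inter> ball q \<eta>" "pathstart \<beta> = X n" "pathfinish \<beta> = Y n"
    unfolding path_component_def by blast
  define \<gamma> where "\<gamma> = (m \<circ> \<phi>) \<circ> \<beta>"
  have "(m \<circ> \<phi>) holomorphic_on \<Omega>" by (rule holomorphic_on_compose_gen[OF hol(1) m(1)]) (use \<phi>(1) in auto)
  then have "continuous_on \<Omega> (m \<circ> \<phi>)" by (rule holomorphic_on_imp_continuous_on)
  then have "continuous_on (path_image \<beta>) (m \<circ> \<phi>)" by (rule continuous_on_subset) (use \<beta>(2) in blast)
  then have "path \<gamma>" unfolding \<gamma>_def by (rule path_continuous_image[OF \<beta>(1)])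
  have im\<gamma>: "path_image \<gamma> = (\<lambda>z. m (\<phi> z)) ` path_image \<beta>" by (simp add: \<gamma>_def path_image_compose image_image)
  have F\<gamma>: "F (m (\<phi> z)) = z - q" if "z \<in> \<Omega>" for z using \<phi> m(5) that by (simp add: F_def)
  have "norm (F (\<i>/2)) \<le> M * exp (- ln (M / \<epsilon>) / 4) \<or> norm (F (-\<i>/2)) \<le> M * exp (- ln (M / \<epsilon>) / 4)"
  proof (rule koebe_path_bound[OF holF M(2) \<open>path \<gamma>\<close>])
    show "path_image \<gamma> \<subseteq> ball 0 1"
      unfolding im\<gamma>
    proof (rule image_subsetI)
      fix w assume "w \<in> path_image \<beta>"
      then have "w \<in> \<Omega>" using \<beta>(2) by auto
      then show "m (\<phi> w) \<in> ball 0 1" by (intro m(3) \<phi>(1))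
    qed
    show "1/2 < norm z" if "z \<in> path_image \<gamma>" for z
    proof (rule ccontr)
      assume "\<not> 1/2 < norm z"
      obtain w where w: "w \<in> path_image \<beta>" "z = m (\<phi> w)" using \<open>z \<in> path_image \<gamma>\<close> unfolding im\<gamma> by (rule imageE)
      then have "w \<in> \<Omega>" "w \<in> ball q \<eta>" using \<beta>(2) by auto
      then have "(\<psi> \<circ> m') z = w" using w(2) \<phi> m(5) by simp
      moreover have "z \<in> cball 0 (1/2)" using \<open>\<not> 1/2 < norm z\<close> by simp
      ultimately have "w \<in> ?Q" by (metis image_eqI)
      then show False using \<open>w \<in> ball q \<eta>\<close> r0(2) by (auto simp: \<eta>_def)
    qed
    have st: "pathstart \<gamma> = m (\<phi> (X n))" "pathfinish \<gamma> = m (\<phi> (Y n))"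
      using \<beta>(3,4) by (simp_all add: \<gamma>_def pathstart_compose pathfinish_compose)
    have "\<bar>Re (pathstart \<gamma> - (-1))\<bar> < 1/4" "\<bar>Im (pathstart \<gamma> - (-1))\<bar> < 1/4"
      "\<bar>Re (pathfinish \<gamma> - 1)\<bar> < 1/4" "\<bar>Im (pathfinish \<gamma> - 1)\<bar> < 1/4"
      using n(1,2) abs_Re_le_cmod abs_Im_le_cmod unfolding st dist_norm by (meson le_less_trans)+
    then have re: "\<bar>Re (pathstart \<gamma>) + 1\<bar> < 1/4" "\<bar>Im (pathstart \<gamma>)\<bar> < 1/4"
      "\<bar>Re (pathfinish \<gamma>) - 1\<bar> < 1/4" "\<bar>Im (pathfinish \<gamma>)\<bar> < 1/4" by simp_all
    show "\<bar>Im (pathstart \<gamma>)\<bar> < 1/4" "\<bar>Im (pathfinish \<gamma>)\<bar> < 1/4" by (rule re)+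
    show "Re (pathstart \<gamma>) < 0" using re(1) by linarith
    show "Re (pathfinish \<gamma>) > 0" using re(3) by linarith
    show "norm (F z) \<le> \<epsilon>" if "z \<in> path_image \<gamma>" for z
    proof -
      obtain w where w: "w \<in> path_image \<beta>" "z = m (\<phi> w)" using \<open>z \<in> path_image \<gamma>\<close> unfolding im\<gamma> by (rule imageE)
      then have "w \<in> \<Omega>" "dist q w < \<eta>" using \<beta>(2) by auto
      then show ?thesis using F\<gamma>[of w] w(2) by (simp add: \<eta>_def dist_norm norm_minus_commute)
    qed
  qed (use \<epsilon> in auto)
  then show False unfolding bound using t(3) by (auto simp: c0_def)
qed

text \<open>Otherwise two sequences tending to \<open>q\<close> would have images staying
  \<open>e\<close> apart, and convergent subsequences of these images would have different
  limits.\<close>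

lemma boundary_oscillation:
  assumes q: "q \<in> J" and "e > 0"
  shows "\<exists>d>0. \<forall>z\<in>\<Omega> \<inter> ball q d. \<forall>w\<in>\<Omega> \<inter> ball q d. dist (\<phi> z) (\<phi> w) < e"
proof (rule ccontr)
  assume neg: "\<not> ?thesis"
  have "\<exists>z w. z \<in> \<Omega> \<and> w \<in> \<Omega> \<and> dist q z < 1 / real (Suc n) \<and> dist q w < 1 / real (Suc n) \<and> e \<le> dist (\<phi> z) (\<phi> w)" for n
  proof -
    have "1 / real (Suc n) > 0" by simp
    then have "\<not> (\<forall>z\<in>\<Omega> \<inter> ball q (1 / real (Suc n)). \<forall>w\<in>\<Omega> \<inter> ball q (1 / real (Suc n)). dist (\<phi> z) (\<phi> w) < e)"
      using neg by blast
    then show ?thesis unfolding Ball_def by (auto simp: not_less)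
  qed
  then obtain X Y where XY: "\<And>n. X n \<in> \<Omega>" "\<And>n. Y n \<in> \<Omega>" "\<And>n. dist q (X n) < 1 / real (Suc n)"
    "\<And>n. dist q (Y n) < 1 / real (Suc n)" "\<And>n. e \<le> dist (\<phi> (X n)) (\<phi> (Y n))" by metis
  have lim: "Z \<longlonglongrightarrow> q" if "\<And>n. dist q (Z n) < 1 / real (Suc n)" for Z
  proof (rule metric_tendsto_imp_tendsto[OF LIMSEQ_inverse_real_of_nat])
    show "\<forall>\<^sub>F n in sequentially. dist (Z n) q \<le> dist (inverse (real (Suc n))) 0"
      using that by (auto simp: dist_commute inverse_eq_divide less_imp_le)
  qed
  have XYlim: "X \<longlonglongrightarrow> q" "Y \<longlonglongrightarrow> q" using lim XY by blast+
  have sc: "seq_compact (cball (0::complex) 1 \<times> cball (0::complex) 1)"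
    by (intro compact_imp_seq_compact compact_Times compact_cball)
  have "(\<phi> (X n), \<phi> (Y n)) \<in> cball 0 1 \<times> cball 0 1" for n
    using \<phi>(1)[OF XY(1)[of n]] \<phi>(1)[OF XY(2)[of n]] by auto
  then have mem: "\<forall>n. (\<phi> (X n), \<phi> (Y n)) \<in> cball 0 1 \<times> cball 0 1" by blast
  obtain l r where l: "strict_mono r" "((\<lambda>n. (\<phi> (X n), \<phi> (Y n))) \<circ> r) \<longlonglongrightarrow> l"
    by (rule seq_compactE[OF sc mem])
  have lims: "(\<lambda>n. \<phi> (X (r n))) \<longlonglongrightarrow> fst l" "(\<lambda>n. \<phi> (Y (r n))) \<longlonglongrightarrow> snd l"
    using tendsto_fst[OF l(2)] tendsto_snd[OF l(2)] by (simp_all add: comp_def)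
  have sub: "(\<lambda>n. X (r n)) \<longlonglongrightarrow> q" "(\<lambda>n. Y (r n)) \<longlonglongrightarrow> q"
    using LIMSEQ_subseq_LIMSEQ[OF XYlim(1) l(1)] LIMSEQ_subseq_LIMSEQ[OF XYlim(2) l(1)] by (simp_all add: comp_def)
  have "fst l = snd l"
    by (rule no_two_boundary_limits[OF q XY(1) sub(1) lims(1) XY(2) sub(2) lims(2)])
  then have "(\<lambda>n. dist (\<phi> (X (r n))) (\<phi> (Y (r n)))) \<longlonglongrightarrow> 0"
    using tendsto_dist[OF lims] by simp
  then have "e \<le> 0" by (rule LIMSEQ_le_const) (use XY(5) in blast)
  then show False using \<open>e > 0\<close> by simp
qed

text \<open>Small oscillation near every point of the compact closure becomes uniform continuity by
  a Lebesgue number, and a uniformly continuous map extends to the closure.\<close>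

lemma continuous_extension:
  obtains g where "continuous_on (\<Omega> \<union> J) g" "\<And>z. z \<in> \<Omega> \<Longrightarrow> g z = \<phi> z"
    "\<And>z. z \<in> J \<Longrightarrow> norm (g z) = 1"
proof -
  have "uniformly_continuous_on \<Omega> \<phi>"
    unfolding uniformly_continuous_on_def
  proof (intro allI impI)
    fix e :: real assume "e > 0"
    have "\<exists>d>0. \<forall>z\<in>\<Omega> \<inter> ball q d. \<forall>w\<in>\<Omega> \<inter> ball q d. dist (\<phi> z) (\<phi> w) < e" if "q \<in> \<Omega> \<union> J" for q
    proof (cases "q \<in> J")
      case False
      then have "q \<in> \<Omega>" using that by blast
      moreover have "continuous_on \<Omega> \<phi>" using hol(1) holomorphic_on_imp_continuous_on by blast
      ultimately obtain d where d: "d > 0" "\<And>z. z \<in> \<Omega> \<Longrightarrow> dist z q < d \<Longrightarrow> dist (\<phi> z) (\<phi> q) < e/2"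
        using \<open>e > 0\<close> unfolding continuous_on_iff by (metis half_gt_zero)
      have "dist (\<phi> z) (\<phi> w) < e" if zw: "z \<in> \<Omega> \<inter> ball q d" "w \<in> \<Omega> \<inter> ball q d" for z w
      proof -
        have "dist (\<phi> z) (\<phi> q) < e/2" "dist (\<phi> w) (\<phi> q) < e/2"
          using d(2)[of z] d(2)[of w] zw by (simp_all add: dist_commute)
        then show ?thesis using dist_triangle2[of "\<phi> z" "\<phi> w" "\<phi> q"] by linarith
      qed
      then show ?thesis using d(1) by blast
    qed (use boundary_oscillation \<open>e > 0\<close> in blast)
    then obtain d where d: "\<And>q. q \<in> \<Omega> \<union> J \<Longrightarrow> d q > 0 \<and> (\<forall>z\<in>\<Omega> \<inter> ball q (d q). \<forall>w\<in>\<Omega> \<inter> ball q (d q). dist (\<phi> z) (\<phi> w) < e)"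
      by metis
    obtain \<delta> where \<delta>: "\<delta> > 0" "\<And>x. x \<in> \<Omega> \<union> J \<Longrightarrow> \<exists>B\<in>(\<lambda>q. ball q (d q)) ` (\<Omega> \<union> J). ball x \<delta> \<subseteq> B"
    proof (rule Heine_Borel_lemma[OF \<Omega>_facts(7), of "(\<lambda>q. ball q (d q)) ` (\<Omega> \<union> J)"])
      show "\<Omega> \<union> J \<subseteq> \<Union> ((\<lambda>q. ball q (d q)) ` (\<Omega> \<union> J))" using d by auto
    qed auto
    have "dist (\<phi> w) (\<phi> z) < e" if "z \<in> \<Omega>" "w \<in> \<Omega>" "dist w z < \<delta>" for z w
    proof -
      have "z \<in> \<Omega> \<union> J" using that by blast
      from \<delta>(2)[OF this] obtain q where q: "q \<in> \<Omega> \<union> J" "ball z \<delta> \<subseteq> ball q (d q)" by blast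
      have "z \<in> ball z \<delta>" "w \<in> ball z \<delta>" using that \<delta>(1) by (auto simp: dist_commute)
      then have "z \<in> \<Omega> \<inter> ball q (d q)" "w \<in> \<Omega> \<inter> ball q (d q)" using q(2) that by blast+
      then show ?thesis using d[OF q(1)] by blast
    qed
    then show "\<exists>d>0. \<forall>x\<in>\<Omega>. \<forall>x'\<in>\<Omega>. dist x' x < d \<longrightarrow> dist (\<phi> x') (\<phi> x) < e" using \<delta>(1) by blast
  qed
  then obtain g where g: "uniformly_continuous_on (closure \<Omega>) g" "\<And>x. x \<in> \<Omega> \<Longrightarrow> \<phi> x = g x"
    by (rule uniformly_continuous_on_extension_on_closure) blast
  have cont: "continuous_on (\<Omega> \<union> J) g"
    using uniformly_continuous_imp_continuous[OF g(1)] \<Omega>_facts(5) by simp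
  have "norm (g z) = 1" if z: "z \<in> J" for z
  proof -
    have "z \<in> closure \<Omega>" using z \<Omega>_facts(5) by blast
    then obtain X where X: "\<forall>n. X n \<in> \<Omega>" "X \<longlonglongrightarrow> z" by (auto simp: closure_sequential)
    have "(\<lambda>n. g (X n)) \<longlonglongrightarrow> g z"
      using continuous_on_tendsto_compose[OF cont X(2)] z X(1) by auto
    then have "(\<lambda>n. \<phi> (X n)) \<longlonglongrightarrow> g z" using g(2) X(1) by simp
    then show ?thesis using boundary_limit_norm[of X z "g z"] X z by blast
  qed
  then show ?thesis using that[OF cont] g(2) by simp
qed

end

section \<open>Crosscuts and injectivity of the boundary extension\<close>

lemma simple_loop_eqD:
  assumes "simple_path p" "s \<in> {0..1}" "t \<in> {0..1}" "p s = p t"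
  shows "s = t \<or> s = 0 \<and> t = 1 \<or> s = 1 \<and> t = 0"
  using assms unfolding simple_path_def loop_free_def by blast

lemma simple_loop_open_arc:
  fixes p :: "real \<Rightarrow> complex"
  assumes "simple_path p" "0 \<le> s" "s < t" "t \<le> 1"
  shows "p ` {s<..<t} = path_image p - p ` ({0..s} \<union> {t..1})"
    and "openin (top_of_set (path_image p)) (p ` {s<..<t})"
proof -
  show e: "p ` {s<..<t} = path_image p - p ` ({0..s} \<union> {t..1})"
  proof (intro equalityI subsetI)
    fix x assume "x \<in> p ` {s<..<t}"
    then obtain a where a: "x = p a" "s < a" "a < t" by auto
    have "x \<notin> p ` ({0..s} \<union> {t..1})"
    proof
      assume "x \<in> p ` ({0..s} \<union> {t..1})"
      then obtain b where b: "p a = p b" "b \<in> {0..s} \<union> {t..1}" unfolding a(1) by (rule imageE)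
      have "b \<in> {0..1}" "a \<in> {0..1}" using assms(2-4) a(2,3) b(2) by auto
      from simple_loop_eqD[OF assms(1) this(2,1) b(1)] show False using a(2,3) b(2) assms(2-4) by auto
    qed
    moreover have "x \<in> path_image p" using a assms(2-4) by (auto simp: path_image_def)
    ultimately show "x \<in> path_image p - p ` ({0..s} \<union> {t..1})" by blast
  next
    fix x assume x: "x \<in> path_image p - p ` ({0..s} \<union> {t..1})"
    then have "x \<in> p ` {0..1}" by (simp add: path_image_def)
    then obtain a where a: "a \<in> {0..1}" "x = p a" by blast
    then have "a \<notin> {0..s} \<union> {t..1}" using x by blast
    then have "a \<in> {s<..<t}" using a(1) by auto
    then show "x \<in> p ` {s<..<t}" using a(2) by blast
  qed
  have "{0..s} \<union> {t..1} \<subseteq> {0..1}" using assms by auto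
  then have "continuous_on ({0..s} \<union> {t..1}) p"
    using assms(1) continuous_on_subset unfolding simple_path_def path_def by blast
  then have "compact (p ` ({0..s} \<union> {t..1}))" by (intro compact_continuous_image compact_Un compact_Icc)
  then have "open (- p ` ({0..s} \<union> {t..1}))" by (simp add: compact_imp_closed open_Compl)
  then show "openin (top_of_set (path_image p)) (p ` {s<..<t})" unfolding e Diff_eq by (rule openin_open_Int)
qed

lemma arc_path_image_split:
  "path_image \<gamma> = {pathstart \<gamma>, pathfinish \<gamma>} \<union> \<gamma> ` {0<..<1}"
proof -
  have "{0..1} = {0, 1} \<union> {0<..<1::real}" by auto
  then have "\<gamma> ` {0..1} = \<gamma> ` {0, 1} \<union> \<gamma> ` {0<..<1}" by (metis image_Un)
  then show ?thesis by (simp add: path_image_def pathstart_def pathfinish_def)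
qed

text \<open>The second arc runs backwards from \<open>p s\<close> to the base point
  \<open>p 0 = p 1\<close> and on, still backwards, to \<open>p t\<close>.\<close>

lemma simple_loop_complementary_arcs:
  fixes p :: "real \<Rightarrow> 'a::real_normed_vector"
  assumes "simple_path p" "pathfinish p = pathstart p" "0 < s" "s < t" "t < 1"
  obtains c1 c2 where "arc c1" "pathstart c1 = p s" "pathfinish c1 = p t" "path_image c1 = p ` {s..t}"
    "arc c2" "pathstart c2 = p s" "pathfinish c2 = p t" "path_image c2 = p ` {0..s} \<union> p ` {t..1}"
proof -
  note inj = simple_loop_eqD[OF assms(1)]
  have p01: "p 0 = p 1" using assms(2) by (simp add: pathstart_def pathfinish_def)
  have ar: "arc (subpath a b p)" if "a \<in> {0..1}" "b \<in> {0..1}" "p a \<noteq> p b" for a b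
    using arc_simple_path_subpath[OF assms(1)] that by blast
  have ne: "p s \<noteq> p t" "p s \<noteq> p 0" "p 1 \<noteq> p t" using inj[of s t] inj[of s 0] inj[of 1 t] assms by auto
  have "arc (subpath s 0 p +++ subpath 1 t p)"
  proof (rule arc_join)
    show "path_image (subpath s 0 p) \<inter> path_image (subpath 1 t p) \<subseteq> {pathstart (subpath 1 t p)}"
    proof
      fix x assume "x \<in> path_image (subpath s 0 p) \<inter> path_image (subpath 1 t p)"
      then have "x \<in> p ` {0..s} \<inter> p ` {t..1}" using assms by (simp add: path_image_subpath split: if_splits)
      then obtain a b where ab: "a \<in> {0..s}" "b \<in> {t..1}" "x = p a" "p a = p b" by blast
      then have "a \<in> {0..1}" "b \<in> {0..1}" using assms by auto
      from inj[OF this ab(4)] have "a = 0 \<and> b = 1" using ab(1,2) assms by auto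
      then show "x \<in> {pathstart (subpath 1 t p)}" using ab(3) p01 by simp
    qed
  qed (use ar assms ne p01 in auto)
  moreover have "path_image (subpath s 0 p +++ subpath 1 t p) = p ` {0..s} \<union> p ` {t..1}"
    using assms p01 by (subst path_image_join) (auto simp: path_image_subpath)
  moreover have "arc (subpath s t p)" using ar assms ne by auto
  moreover have "path_image (subpath s t p) = p ` {s..t}" using assms by (simp add: path_image_subpath)
  ultimately show ?thesis
    using that[of "subpath s t p" "subpath s 0 p +++ subpath 1 t p"] by simp
qed

context jordan_riemann
begin

text \<open>The theta-curve lemma splits \<open>\<Omega>\<close> into the insides of the two loops
  made of \<open>\<gamma>\<close> and one boundary arc. The closure of such an inside only adds its
  own loop, so it misses the open boundary arc on the other side.\<close>

lemma crosscut_split: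
  assumes p: "simple_path p" "pathfinish p = pathstart p" "path_image p = J"
    and st: "0 < s" "s < t" "t < 1"
    and \<gamma>: "arc \<gamma>" "pathstart \<gamma> = p s" "pathfinish \<gamma> = p t" "\<gamma> ` {0<..<1} \<subseteq> \<Omega>"
  obtains A B where "open A" "open B" "A \<inter> B = {}" "A \<union> B \<union> \<gamma> ` {0<..<1} = \<Omega>"
    "closure A \<inter> p ` ({0..<s} \<union> {t<..1}) = {}" "closure B \<inter> p ` {s<..<t} = {}"
proof -
  note inj = simple_loop_eqD[OF p(1)]
  obtain c1 c2 where c1: "arc c1" "pathstart c1 = p s" "pathfinish c1 = p t" "path_image c1 = p ` {s..t}"
    and c2: "arc c2" "pathstart c2 = p s" "pathfinish c2 = p t" "path_image c2 = p ` {0..s} \<union> p ` {t..1}"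
    by (rule simple_loop_complementary_arcs[OF p(1,2) st])
  have ne: "p s \<noteq> p t" using inj[of s t] st by auto
  have p01: "p 0 = p 1" using p(2) by (simp add: pathstart_def pathfinish_def)
  have "{0..1} = {s..t} \<union> ({0..s} \<union> {t..1})" using st by auto
  then have un: "path_image c1 \<union> path_image c2 = J"
    using p(3) c1(4) c2(4) by (simp add: path_image_def image_Un)
  have i12: "path_image c1 \<inter> path_image c2 = {p s, p t}"
  proof
    show "path_image c1 \<inter> path_image c2 \<subseteq> {p s, p t}"
    proof
      fix x assume "x \<in> path_image c1 \<inter> path_image c2"
      then have "x \<in> p ` {s..t}" "x \<in> p ` ({0..s} \<union> {t..1})" using c1(4) c2(4) by (auto simp: image_Un)
      then obtain a b where ab: "a \<in> {s..t}" "b \<in> {0..s} \<union> {t..1}" "x = p a" "p a = p b" by blast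
      then have "a \<in> {0..1}" "b \<in> {0..1}" using st by auto
      from inj[OF this ab(4)] have "a = s \<or> a = t" using ab(1,2) st by auto
      then show "x \<in> {p s, p t}" using ab(3) by blast
    qed
    show "{p s, p t} \<subseteq> path_image c1 \<inter> path_image c2" using c1(4) c2(4) st by auto
  qed
  have im\<gamma>: "path_image \<gamma> = {p s, p t} \<union> \<gamma> ` {0<..<1}" using arc_path_image_split[of \<gamma>] \<gamma>(2,3) by simp
  have \<gamma>J: "\<gamma> ` {0<..<1} \<inter> J = {}" using \<gamma>(4) \<Omega>_facts(4) by blast
  have mem: "p s \<in> path_image c1" "p t \<in> path_image c1" "p s \<in> path_image c2" "p t \<in> path_image c2" using i12 by blast+
  have i1: "path_image c1 \<inter> path_image \<gamma> = {p s, p t}" "path_image c2 \<inter> path_image \<gamma> = {p s, p t}"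
    using mem im\<gamma> \<gamma>J un by blast+
  have "path_image \<gamma> \<inter> inside (path_image c1 \<union> path_image c2) \<noteq> {}"
  proof -
    have "inside (path_image c1 \<union> path_image c2) = \<Omega>" unfolding un by (simp add: \<Omega> J)
    moreover have "\<gamma> (1/2) \<in> \<gamma> ` {0<..<1}" by (rule imageI) simp
    ultimately show ?thesis using im\<gamma> \<gamma>(4) by blast
  qed
  from split_inside_simple_closed_curve[OF arc_imp_simple_path[OF c1(1)] c1(2,3) arc_imp_simple_path[OF c2(1)] c2(2,3)
      arc_imp_simple_path[OF \<gamma>(1)] \<gamma>(2,3) ne i12 i1 this]
  have sp: "inside (path_image c1 \<union> path_image \<gamma>) \<inter> inside (path_image c2 \<union> path_image \<gamma>) = {}"
    "inside (path_image c1 \<union> path_image \<gamma>) \<union> inside (path_image c2 \<union> path_image \<gamma>) \<union> (path_image \<gamma> - {p s, p t}) = \<Omega>"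
    unfolding un by (simp_all add: J \<Omega>)
  have loop: "open (inside (path_image d \<union> path_image \<gamma>))"
    "closure (inside (path_image d \<union> path_image \<gamma>)) = inside (path_image d \<union> path_image \<gamma>) \<union> (path_image d \<union> path_image \<gamma>)"
    if d: "arc d" "pathstart d = p s" "pathfinish d = p t" "path_image d \<inter> path_image \<gamma> = {p s, p t}" for d
  proof -
    have sl: "simple_path (d +++ reversepath \<gamma>)"
      by (rule simple_path_join_loop) (use d \<gamma> in \<open>auto simp: arc_reversepath\<close>)
    have fl: "pathfinish (d +++ reversepath \<gamma>) = pathstart (d +++ reversepath \<gamma>)" using d(2) \<gamma>(2) by simp
    have "path_image (d +++ reversepath \<gamma>) = path_image d \<union> path_image \<gamma>" using d(3) \<gamma>(3) by (simp add: path_image_join)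
    with Jordan_inside_outside[OF sl fl]
    have "open (inside (path_image d \<union> path_image \<gamma>))"
      "frontier (inside (path_image d \<union> path_image \<gamma>)) = path_image d \<union> path_image \<gamma>" by simp_all
    then show "open (inside (path_image d \<union> path_image \<gamma>))"
      "closure (inside (path_image d \<union> path_image \<gamma>)) = inside (path_image d \<union> path_image \<gamma>) \<union> (path_image d \<union> path_image \<gamma>)"
      using closure_Un_frontier[of "inside (path_image d \<union> path_image \<gamma>)"] by simp_all
  qed
  note L1 = loop[OF c1(1-3) i1(1)] and L2 = loop[OF c2(1-3) i1(2)]
  have sub: "inside (path_image c1 \<union> path_image \<gamma>) \<inter> J = {}" "inside (path_image c2 \<union> path_image \<gamma>) \<inter> J = {}"
    using sp(2) \<Omega>_facts(4) by blast+
  have r1: "p ` ({0..<s} \<union> {t<..1}) \<inter> path_image c1 = {}" and r1': "p ` ({0..<s} \<union> {t<..1}) \<subseteq> J"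
  proof -
    show "p ` ({0..<s} \<union> {t<..1}) \<subseteq> J" using st unfolding p(3)[symmetric] path_image_def by auto
    show "p ` ({0..<s} \<union> {t<..1}) \<inter> path_image c1 = {}"
    proof (rule equals0I)
      fix x assume "x \<in> p ` ({0..<s} \<union> {t<..1}) \<inter> path_image c1"
      then have "x \<in> p ` ({0..<s} \<union> {t<..1})" "x \<in> p ` {s..t}" using c1(4) by auto
      then obtain a b where ab: "a \<in> {0..<s} \<union> {t<..1}" "b \<in> {s..t}" "p a = p b" by (metis imageE)
      then have "a \<in> {0..1}" "b \<in> {0..1}" using st by auto
      from inj[OF this ab(3)] show False using ab(1,2) st by auto
    qed
  qed
  have r2: "p ` {s<..<t} \<inter> path_image c2 = {}" and r2': "p ` {s<..<t} \<subseteq> J"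
    using simple_loop_open_arc(1)[OF p(1), of s t] st p(3) c2(4) by (auto simp: image_Un)
  have eps: "p s \<notin> p ` ({0..<s} \<union> {t<..1})" "p t \<notin> p ` ({0..<s} \<union> {t<..1})"
    "p s \<notin> p ` {s<..<t}" "p t \<notin> p ` {s<..<t}"
    using r1 r2 mem by blast+
  show ?thesis
  proof (rule that[OF L1(1) L2(1) sp(1)])
    have "path_image \<gamma> - {p s, p t} = \<gamma> ` {0<..<1}"
      using im\<gamma> \<gamma>J mem un by blast
    then show "inside (path_image c1 \<union> path_image \<gamma>) \<union> inside (path_image c2 \<union> path_image \<gamma>) \<union> \<gamma> ` {0<..<1} = \<Omega>"
      using sp(2) by simp
    show "closure (inside (path_image c1 \<union> path_image \<gamma>)) \<inter> p ` ({0..<s} \<union> {t<..1}) = {}"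
    proof -
      have "inside (path_image c1 \<union> path_image \<gamma>) \<inter> p ` ({0..<s} \<union> {t<..1}) = {}" using sub(1) r1' by blast
      moreover have "path_image \<gamma> \<inter> p ` ({0..<s} \<union> {t<..1}) = {}" unfolding im\<gamma> using \<gamma>J r1' eps(1,2) by blast
      moreover have "path_image c1 \<inter> p ` ({0..<s} \<union> {t<..1}) = {}" using r1 by blast
      ultimately show ?thesis unfolding L1(2) Int_Un_distrib2 by simp
    qed
    show "closure (inside (path_image c2 \<union> path_image \<gamma>)) \<inter> p ` {s<..<t} = {}"
    proof -
      have "inside (path_image c2 \<union> path_image \<gamma>) \<inter> p ` {s<..<t} = {}" using sub(2) r2' by blast
      moreover have "path_image \<gamma> \<inter> p ` {s<..<t} = {}" unfolding im\<gamma> using \<gamma>J r2' eps(3,4) by blast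
      moreover have "path_image c2 \<inter> p ` {s<..<t} = {}" using r2 by blast
      ultimately show ?thesis unfolding L2(2) Int_Un_distrib2 by simp
    qed
  qed
qed

text \<open>If \<open>g - \<zeta>\<close> vanished on a boundary arc it would have a zero in
  \<open>\<Omega>\<close>, where \<open>g\<close> takes values of modulus below 1.\<close>

lemma extension_not_constant_on_arc:
  assumes g: "continuous_on (\<Omega> \<union> J) g" "\<And>z. z \<in> \<Omega> \<Longrightarrow> g z = \<phi> z" and n: "norm \<zeta> = 1"
    and p: "simple_path p" "pathfinish p = pathstart p" "path_image p = J"
    and st: "0 \<le> s" "s < t" "t \<le> 1"
  shows "\<exists>u\<in>{s<..<t}. g (p u) \<noteq> \<zeta>"
proof (rule ccontr)
  assume "\<not> ?thesis"
  then have const: "g z = \<zeta>" if "z \<in> p ` {s<..<t}" for z using that by blast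
  have mid: "p ((s + t) / 2) \<in> p ` {s<..<t}" using st by (intro imageI) auto
  obtain T where T: "open T" "p ` {s<..<t} = J \<inter> T"
    using simple_loop_open_arc(2)[OF p(1) st] unfolding p(3) openin_open by blast
  then have "p ((s + t) / 2) \<in> T" using mid by blast
  then obtain r where r: "r > 0" "ball (p ((s + t) / 2)) r \<subseteq> T" using T(1) by (meson open_contains_ball)
  have in\<Omega>: "inside (path_image c) = \<Omega>" "path_image c = J" by (simp_all add: J \<Omega>)
  have "\<exists>w\<in>inside (path_image c). (\<lambda>z. g z - \<zeta>) w = 0"
  proof (rule vanishing_on_boundary_arc[OF c _ r(1)])
    show "p ((s + t) / 2) \<in> path_image c" using mid T(2) J by blast
    have "g holomorphic_on \<Omega>" using hol(1) g(2) holomorphic_cong[OF refl, of \<Omega> g \<phi>] by blast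
    then show "(\<lambda>z. g z - \<zeta>) holomorphic_on inside (path_image c)" unfolding in\<Omega>(1) by (intro holomorphic_intros)
    show "continuous_on (closure (inside (path_image c))) (\<lambda>z. g z - \<zeta>)"
      unfolding in\<Omega>(1) \<Omega>_facts(5) by (intro continuous_intros g(1))
    show "g z - \<zeta> = 0" if "z \<in> path_image c \<inter> ball (p ((s + t) / 2)) r" for z
      using const[of z] that T(2) r(2) unfolding in\<Omega>(2) by auto
  qed
  then obtain w where "w \<in> \<Omega>" "g w = \<zeta>" unfolding in\<Omega>(1) by auto
  then show False using \<phi>(1)[of w] g(2)[of w] n by simp
qed

text \<open>Suppose \<open>q1\<close> and \<open>q2\<close> share the value \<open>\<zeta>\<close>.
  A crosscut whose ends have other values separates them in \<open>\<Omega>\<close>, and its image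
  keeps a positive distance from \<open>\<zeta>\<close>. The part of the disc near
  \<open>\<zeta>\<close> is connected, so its preimage lies on one side of the crosscut; but it
  contains points near \<open>q1\<close> and points near \<open>q2\<close>, which lie on different
  sides.\<close>

lemma extension_injective_boundary:
  assumes g: "continuous_on (\<Omega> \<union> J) g" "\<And>z. z \<in> \<Omega> \<Longrightarrow> g z = \<phi> z" "\<And>z. z \<in> J \<Longrightarrow> norm (g z) = 1"
    and q: "q1 \<in> J" "q2 \<in> J" "g q1 = g q2"
  shows "q1 = q2"
proof (rule ccontr)
  assume ne: "q1 \<noteq> q2"
  define \<zeta> where "\<zeta> = g q1"
  have \<zeta>: "norm \<zeta> = 1" "g q1 = \<zeta>" "g q2 = \<zeta>" using g(3) q by (auto simp: \<zeta>_def)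
  obtain p where p: "simple_path p" "pathfinish p = pathstart p" "pathstart p = q1" "path_image p = J"
    using simple_loop_from[OF c, of q1] q(1) unfolding J by blast
  have "q2 \<in> p ` {0..1}" using q(2) p(4) by (simp add: path_image_def)
  then obtain \<tau> where \<tau>: "\<tau> \<in> {0..1}" "q2 = p \<tau>" by blast
  have p0: "p 0 = q1" "p 1 = q1" using p(2,3) by (auto simp: pathstart_def pathfinish_def)
  have "\<tau> \<noteq> 0" "\<tau> \<noteq> 1" using p0 \<tau>(2) ne by auto
  then have \<tau>01: "0 < \<tau>" "\<tau> < 1" using \<tau>(1) by auto
  \<comment> \<open>The ends of the crosscut are sought in this relatively open set; it meets both
    boundary arcs because the extension is not constant on either. Density of pairs of accessible
    boundary points then provides the crosscut.\<close>
  define S where "S = {z \<in> J. g z \<noteq> \<zeta>}"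
  have contJ: "continuous_on J g" using g(1) by (rule continuous_on_subset) blast
  have "openin (top_of_set J) (J \<inter> g -` (- {\<zeta>}))" by (rule continuous_openin_preimage_gen[OF contJ]) auto
  moreover have "J \<inter> g -` (- {\<zeta>}) = S" by (auto simp: S_def)
  ultimately have oS: "openin (top_of_set J) S" by simp
  let ?U = "p ` {0<..<\<tau>} \<inter> S" and ?V = "p ` {\<tau><..<1} \<inter> S"
  have oU: "openin (top_of_set J) ?U" "openin (top_of_set J) ?V"
    using simple_loop_open_arc(2)[OF p(1), of 0 \<tau>] simple_loop_open_arc(2)[OF p(1), of \<tau> 1] \<tau>01 p(4) oS
    by (auto intro: openin_Int)
  have pJ: "p u \<in> J" if "u \<in> {0..1}" for u using p(4) that by (auto simp: path_image_def)
  have neU: "?U \<noteq> {}" "?V \<noteq> {}"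
  proof -
    obtain u where u: "u \<in> {0<..<\<tau>}" "g (p u) \<noteq> \<zeta>"
      using extension_not_constant_on_arc[OF g(1,2) \<zeta>(1) p(1,2,4), of 0 \<tau>] \<tau>01 by auto
    have "p u \<in> p ` {0<..<\<tau>}" "p u \<in> J" using u(1) pJ[of u] \<tau>01 by auto
    then show "?U \<noteq> {}" using u(2) unfolding S_def by blast
    obtain u where u: "u \<in> {\<tau><..<1}" "g (p u) \<noteq> \<zeta>"
      using extension_not_constant_on_arc[OF g(1,2) \<zeta>(1) p(1,2,4), of \<tau> 1] \<tau>01 by auto
    have "p u \<in> p ` {\<tau><..<1}" "p u \<in> J" using u(1) pJ[of u] \<tau>01 by auto
    then show "?V \<noteq> {}" using u(2) unfolding S_def by blast
  qed
  have "?U \<inter> ?V = {}"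
  proof (rule equals0I)
    fix x assume "x \<in> ?U \<inter> ?V"
    then obtain a b where ab: "a \<in> {0<..<\<tau>}" "b \<in> {\<tau><..<1}" "p a = p b" by auto
    then have "a \<in> {0..1}" "b \<in> {0..1}" using \<tau>01 by auto
    from simple_loop_eqD[OF p(1) this ab(3)] show False using ab(1,2) by auto
  qed
  then have "?U \<noteq> ?V" using neU by blast
  then obtain \<gamma> where \<gamma>: "arc \<gamma>" "pathstart \<gamma> \<in> ?U" "pathfinish \<gamma> \<in> ?V" "\<gamma> ` {0<..<1} \<subseteq> \<Omega>"
    using dense_accessible_frontier_point_pairs[OF \<Omega>_facts(1,2), of ?U ?V] oU neU unfolding \<Omega>_facts(6) by blast
  obtain s where s: "0 < s" "s < \<tau>" "pathstart \<gamma> = p s" using \<gamma>(2) by auto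
  obtain t where t: "\<tau> < t" "t < 1" "pathfinish \<gamma> = p t" using \<gamma>(3) by auto
  have st: "s < t" using s t by simp
  obtain A B where AB: "open A" "open B" "A \<inter> B = {}" "A \<union> B \<union> \<gamma> ` {0<..<1} = \<Omega>"
    "closure A \<inter> p ` ({0..<s} \<union> {t<..1}) = {}" "closure B \<inter> p ` {s<..<t} = {}"
    by (rule crosscut_split[OF p(1,2,4) s(1) st t(2) \<gamma>(1) s(3) t(3) \<gamma>(4)]) (rule that; assumption)
  have "p 0 \<in> p ` ({0..<s} \<union> {t<..1})" using s by (intro imageI) auto
  then have q1A: "q1 \<notin> closure A" using AB(5) p0 by auto
  have "p \<tau> \<in> p ` {s<..<t}" using s t by (intro imageI) auto
  then have q2B: "q2 \<notin> closure B" using AB(6) \<tau>(2) by auto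
  let ?\<Sigma> = "g ` path_image \<gamma>"
  have im\<gamma>: "path_image \<gamma> = {p s, p t} \<union> \<gamma> ` {0<..<1}" using arc_path_image_split[of \<gamma>] s(3) t(3) by simp
  have "p s \<in> J" "p t \<in> J" using pJ s t \<tau>01 by auto
  then have "path_image \<gamma> \<subseteq> \<Omega> \<union> J" unfolding im\<gamma> using \<gamma>(4) by auto
  from compact_continuous_image[OF continuous_on_subset[OF g(1) this] compact_path_image[OF arc_imp_path[OF \<gamma>(1)]]]
  have "compact ?\<Sigma>" .
  moreover have "\<zeta> \<notin> ?\<Sigma>"
  proof
    assume "\<zeta> \<in> ?\<Sigma>"
    then obtain x where x: "x \<in> path_image \<gamma>" "g x = \<zeta>" by auto
    have "p s \<in> S" "p t \<in> S" using \<gamma>(2,3) unfolding s(3) t(3) by blast+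
    then have "g (p s) \<noteq> \<zeta>" "g (p t) \<noteq> \<zeta>" by (simp_all add: S_def)
    then have "x \<in> \<Omega>" using x im\<gamma> \<gamma>(4) by auto
    then show False using \<phi>(1)[of x] g(2)[of x] x(2) \<zeta>(1) by simp
  qed
  ultimately have "open (- ?\<Sigma>)" "\<zeta> \<in> - ?\<Sigma>" by (auto simp: compact_imp_closed open_Compl)
  then obtain \<delta> where \<delta>: "\<delta> > 0" "ball \<zeta> \<delta> \<subseteq> - ?\<Sigma>" by (meson open_contains_ball)
  define D where "D = ball 0 1 \<inter> ball \<zeta> \<delta>"
  have "connected D" unfolding D_def by (intro convex_connected convex_Int convex_ball)
  moreover have "continuous_on D \<psi>"
    using holomorphic_on_imp_continuous_on[OF hol(2)] by (rule continuous_on_subset) (auto simp: D_def)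
  ultimately have conD: "connected (\<psi> ` D)" by (intro connected_continuous_image)
  have Dsub: "\<psi> ` D \<subseteq> A \<union> B"
  proof
    fix x assume "x \<in> \<psi> ` D"
    then obtain y where y: "y \<in> D" "x = \<psi> y" by blast
    have yb: "y \<in> ball 0 1" using y(1) by (simp add: D_def)
    have "x \<in> \<Omega>" using \<psi>(1)[OF yb] y(2) by simp
    moreover have "x \<notin> \<gamma> ` {0<..<1}"
    proof
      assume "x \<in> \<gamma> ` {0<..<1}"
      then have "g x \<in> ?\<Sigma>" using im\<gamma> by blast
      moreover have "g x = y" using g(2)[OF \<open>x \<in> \<Omega>\<close>] \<psi>(2)[OF yb] y(2) by simp
      ultimately show False using y(1) \<delta>(2) by (auto simp: D_def)
    qed
    ultimately show "x \<in> A \<union> B" using AB(4) by blast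
  qed
  have near: "\<exists>z\<in>\<psi> ` D. z \<notin> C" if q: "q \<in> J" "g q = \<zeta>" "q \<notin> closure C" for q C
  proof -
    have "q \<in> \<Omega> \<union> J" using q(1) by blast
    with g(1) obtain d where d: "d > 0" "\<And>z. z \<in> \<Omega> \<union> J \<Longrightarrow> dist z q < d \<Longrightarrow> dist (g z) (g q) < \<delta>"
      using \<delta>(1) unfolding continuous_on_iff by metis
    have "open (ball q d \<inter> - closure C)" by auto
    moreover have "q \<in> ball q d \<inter> - closure C" using q(3) d(1) by simp
    moreover have "q \<in> closure \<Omega>" using q(1) \<Omega>_facts(5) by blast
    ultimately have "(ball q d \<inter> - closure C) \<inter> \<Omega> \<noteq> {}" using open_Int_closure_eq_empty[of "ball q d \<inter> - closure C" \<Omega>] by blast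
    then obtain z where z: "z \<in> \<Omega>" "dist z q < d" "z \<notin> closure C" by (auto simp: dist_commute)
    have "\<phi> z \<in> D"
      using \<phi>(1)[OF z(1)] d(2)[of z] z g(2)[OF z(1)] q(2) by (simp add: D_def dist_commute)
    then have "z \<in> \<psi> ` D" using \<phi>(2)[OF z(1)] by (metis image_eqI)
    moreover have "z \<notin> C" using z(3) closure_subset[of C] by blast
    ultimately show ?thesis by blast
  qed
  obtain z1 where z1: "z1 \<in> \<psi> ` D" "z1 \<notin> A" using near[OF q(1) \<zeta>(2) q1A] by blast
  obtain z2 where z2: "z2 \<in> \<psi> ` D" "z2 \<notin> B" using near[OF q(2) \<zeta>(3) q2B] by blast
  have "A \<inter> B \<inter> \<psi> ` D = {}" using AB(3) by blast
  then show False using connectedD[OF conD AB(1,2) _ Dsub] z1 z2 Dsub by blast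
qed

end

theorem caratheodory:
  fixes c :: "real \<Rightarrow> complex"
  assumes "simple_path c" "pathfinish c = pathstart c"
  defines "\<Omega> \<equiv> inside (path_image c)"
  obtains g :: "complex \<Rightarrow> complex" where "continuous_on (\<Omega> \<union> path_image c) g" "inj_on g (\<Omega> \<union> path_image c)"
    "g ` \<Omega> = ball 0 1" "g ` path_image c = sphere 0 1"
proof -
  note JO = Jordan_inside_outside[OF assms(1,2)]
  have "open \<Omega>" "\<Omega> \<noteq> {}" "bounded \<Omega>" using JO by (simp_all add: \<Omega>_def)
  moreover have "simply_connected \<Omega>" unfolding \<Omega>_def by (rule simply_connected_inside_simple_path[OF assms(1)])
  moreover have "\<Omega> \<noteq> UNIV" using \<open>bounded \<Omega>\<close> not_bounded_UNIV by blast
  ultimately obtain \<phi> \<psi> where \<phi>\<psi>: "\<phi> holomorphic_on \<Omega>" "\<psi> holomorphic_on ball 0 1"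
    "\<forall>z\<in>\<Omega>. \<phi> z \<in> ball 0 1 \<and> \<psi> (\<phi> z) = z" "\<forall>z\<in>ball 0 1. \<psi> z \<in> \<Omega> \<and> \<phi> (\<psi> z) = z"
    using Riemann_mapping_theorem[of \<Omega>] by blast
  interpret jordan_riemann c \<phi> \<psi> "path_image c" \<Omega>
    by unfold_locales (use assms \<phi>\<psi> in auto)
  obtain g where g: "continuous_on (\<Omega> \<union> path_image c) g" "\<And>z. z \<in> \<Omega> \<Longrightarrow> g z = \<phi> z"
    "\<And>z. z \<in> path_image c \<Longrightarrow> norm (g z) = 1"
    by (rule continuous_extension) (rule that; assumption)
  have g\<Omega>: "g ` \<Omega> = ball 0 1"
  proof
    show "g ` \<Omega> \<subseteq> ball 0 1" using g(2) \<phi>(1) by auto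
    show "ball 0 1 \<subseteq> g ` \<Omega>"
    proof
      fix y :: complex assume y: "y \<in> ball 0 1"
      then have "\<psi> y \<in> \<Omega>" "g (\<psi> y) = y" using \<psi> g(2) by auto
      then show "y \<in> g ` \<Omega>" by (metis image_eqI)
    qed
  qed
  have inj\<Omega>: "inj_on g \<Omega>" using g(2) \<phi>(2) by (metis inj_onI)
  have injJ: "inj_on g (path_image c)" using extension_injective_boundary[OF g] by (meson inj_onI)
  have gJ: "g ` path_image c \<subseteq> sphere 0 1" using g(3) by auto
  have inj: "inj_on g (\<Omega> \<union> path_image c)"
  proof -
    have "ball (0::complex) 1 \<inter> sphere 0 1 = {}" by auto
    then have "g ` (\<Omega> - path_image c) \<inter> g ` (path_image c - \<Omega>) = {}" using g\<Omega> gJ by blast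
    then show ?thesis unfolding inj_on_Un using inj\<Omega> injJ by blast
  qed
  \<comment> \<open>Surjectivity onto the circle comes from compactness: the image is closed and
    contains the open disc, so it contains the circle, none of which is reached from inside.\<close>
  have "compact (g ` (\<Omega> \<union> path_image c))" using \<Omega>_facts(7) g(1) compact_continuous_image by blast
  then have "closure (ball 0 1) \<subseteq> g ` (\<Omega> \<union> path_image c)"
    by (intro closure_minimal) (use g\<Omega> in \<open>auto simp: compact_imp_closed image_Un\<close>)
  then have "sphere 0 1 \<subseteq> g ` (\<Omega> \<union> path_image c)" by auto
  moreover have "sphere 0 1 \<inter> g ` \<Omega> = {}" unfolding g\<Omega> by auto
  ultimately have "g ` path_image c = sphere 0 1" using gJ by blast
  then show ?thesis by (rule that[OF g(1) inj g\<Omega>])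
qed

section \<open>Local flatness of plane arcs\<close>

text \<open>For \<open>a\<close> on the unit circle this is a Moebius transformation of the disc
  onto the upper half-plane with pole at \<open>a\<close>.\<close>

definition cayley :: "complex \<Rightarrow> complex \<Rightarrow> complex" where
  "cayley a w = \<i> * (a + w) / (a - w)"

lemma cayley_Im:
  assumes "norm a = 1" "w \<noteq> a"
  shows "Im (cayley a w) = (1 - (norm w)\<^sup>2) / (norm (a - w))\<^sup>2"
proof -
  have "Im (\<i> * (a + w) / (a - w)) = Re ((a + w) * cnj (a - w)) / (norm (a - w))\<^sup>2"
    by (simp add: Im_divide cmod_power2 algebra_simps)
  also have "Re ((a + w) * cnj (a - w)) = (norm a)\<^sup>2 - (norm w)\<^sup>2"
    unfolding cmod_power2 by (simp add: power2_eq_square algebra_simps)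
  finally show ?thesis using assms by (simp add: cayley_def)
qed

lemma cayley_inj:
  assumes "norm a = 1" "w \<noteq> a" "z \<noteq> a" "cayley a w = cayley a z"
  shows "w = z"
proof -
  have "(a + w) * (a - z) = (a + z) * (a - w)" using assms by (auto simp: cayley_def field_simps)
  then have "2 * a * (w - z) = 0" by (simp add: algebra_simps)
  then show ?thesis using assms(1) by auto
qed

lemma cayley_surj:
  assumes "norm a = 1"
  shows "\<exists>w. norm w = 1 \<and> w \<noteq> a \<and> cayley a w = of_real x"
proof -
  have a0: "a \<noteq> 0" using assms by auto
  have x: "of_real x + \<i> \<noteq> 0" "of_real x - \<i> \<noteq> (0::complex)" by (simp_all add: complex_eq_iff)
  \<comment> \<open>The solution of \<open>\<i> * (1 + \<zeta>) / (1 - \<zeta>) = of_real x\<close>;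
    multiplication by \<open>a\<close> adjusts it to the pole \<open>a\<close>.\<close>
  define \<zeta> where "\<zeta> = (of_real x - \<i>) / (of_real x + \<i>)"
  have "norm (of_real x - \<i>) = norm (of_real x + \<i>)" by (simp add: cmod_def)
  then have n: "norm \<zeta> = 1" using x by (simp add: \<zeta>_def norm_divide)
  have 1: "1 + \<zeta> = 2 * of_real x / (of_real x + \<i>)" "1 - \<zeta> = 2 * \<i> / (of_real x + \<i>)"
    using x by (simp_all add: \<zeta>_def field_simps)
  have nz: "1 - \<zeta> \<noteq> 0" unfolding 1 using x by simp
  have "cayley a (a * \<zeta>) = \<i> * (a * (1 + \<zeta>)) / (a * (1 - \<zeta>))" by (simp add: cayley_def algebra_simps)
  then have "cayley a (a * \<zeta>) = \<i> * ((1 + \<zeta>) / (1 - \<zeta>))" using a0 by simp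
  moreover have "(1 + \<zeta>) / (1 - \<zeta>) = of_real x / \<i>" unfolding 1 using x by simp
  ultimately have "cayley a (a * \<zeta>) = of_real x" by simp
  then show ?thesis using n assms a0 nz by (intro exI[of _ "a * \<zeta>"]) (auto simp: norm_mult)
qed

text \<open>The map of the closed Jordan domain onto the closed disc is followed by the Cayley
  transformation with pole at the image of the start of \<open>\<gamma>\<close>, so the rest of the
  loop becomes the real line. Removing the other common end leaves two half-lines; by connectedness
  the two open arcs each fill one of them.\<close>

lemma half_plane_map:
  fixes \<gamma> \<sigma> :: "real \<Rightarrow> complex"
  assumes \<gamma>: "arc \<gamma>" and \<sigma>: "arc \<sigma>" and ends: "pathstart \<sigma> = pathfinish \<gamma>" "pathfinish \<sigma> = pathstart \<gamma>"
    and int: "path_image \<gamma> \<inter> path_image \<sigma> = {pathstart \<gamma>, pathfinish \<gamma>}"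
  defines "\<Omega> \<equiv> inside (path_image \<gamma> \<union> path_image \<sigma>)"
  shows "\<exists>K. continuous_on (\<Omega> \<union> \<gamma> ` {0<..<1}) K \<and> inj_on K (\<Omega> \<union> \<gamma> ` {0<..<1}) \<and>
    (\<forall>z\<in>\<Omega>. 0 < Im (K z)) \<and> K ` \<gamma> ` {0<..<1} = of_real ` {0<..}"
proof -
  define c where "c = \<gamma> +++ \<sigma>"
  have c: "simple_path c" "pathfinish c = pathstart c" "path_image c = path_image \<gamma> \<union> path_image \<sigma>"
    unfolding c_def using assms by (auto intro!: simple_path_join_loop simp: path_image_join)
  note JO = Jordan_inside_outside[OF c(1,2), unfolded c(3), folded \<Omega>_def]
  obtain g :: "complex \<Rightarrow> complex" where g: "continuous_on (\<Omega> \<union> (path_image \<gamma> \<union> path_image \<sigma>)) g"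
    "inj_on g (\<Omega> \<union> (path_image \<gamma> \<union> path_image \<sigma>))" "g ` \<Omega> = ball 0 1" "g ` (path_image \<gamma> \<union> path_image \<sigma>) = sphere 0 1"
    by (rule caratheodory[OF c(1,2), unfolded c(3), folded \<Omega>_def])
  define u where "u = pathstart \<gamma>"
  define v where "v = pathfinish \<gamma>"
  define I where "I = \<gamma> ` {0<..<1}"
  define S where "S = \<sigma> ` {0<..<1}"
  have im: "path_image \<gamma> = {u, v} \<union> I" "path_image \<sigma> = {u, v} \<union> S"
    using arc_path_image_split[of \<gamma>] arc_path_image_split[of \<sigma>] ends by (auto simp: u_def v_def I_def S_def)
  define J where "J = path_image \<gamma> \<union> path_image \<sigma>"
  have JI: "J = {u, v} \<union> I \<union> S" unfolding J_def im by blast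
  have endI: "u \<notin> I" "v \<notin> I" "u \<noteq> v"
  proof -
    have inj: "inj_on \<gamma> {0..1}" using \<gamma> by (simp add: arc_def)
    show "u \<notin> I" "v \<notin> I"
      using inj by (auto simp: u_def v_def I_def pathstart_def pathfinish_def dest!: inj_onD)
    show "u \<noteq> v" using arc_distinct_ends[OF \<gamma>] by (simp add: u_def v_def)
  qed
  have endS: "u \<notin> S" "v \<notin> S"
  proof -
    have inj: "inj_on \<sigma> {0..1}" using \<sigma> by (simp add: arc_def)
    show "u \<notin> S" "v \<notin> S"
      using inj unfolding u_def v_def ends[symmetric]
      by (auto simp: S_def pathstart_def pathfinish_def dest!: inj_onD)
  qed
  have dJ: "\<Omega> \<inter> J = {}" using JO by (auto simp: J_def)
  define a where "a = g u"
  have uJ: "u \<in> J" "v \<in> J" using JI by auto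
  have na: "norm a = 1" using g(4) uJ(1) by (auto simp: a_def J_def)
  have g_ne: "g z \<noteq> a" if "z \<in> \<Omega> \<union> J - {u}" for z
    using inj_onD[OF g(2)[folded J_def], of z u] that uJ by (auto simp: a_def)
  define T where "T = (\<lambda>z. cayley a (g z))"
  \<comment> \<open>The translation puts the other end of \<open>\<gamma>\<close> at 0, so the sign
    of the real part distinguishes the two open arcs.\<close>
  define K where "K = (\<lambda>z. T z - T v)"
  have contT: "continuous_on (\<Omega> \<union> J - {u}) T"
  proof -
    have "continuous_on (\<Omega> \<union> J - {u}) g" using g(1)[folded J_def] by (rule continuous_on_subset) blast
    then show ?thesis unfolding T_def cayley_def using g_ne by (intro continuous_intros) auto
  qed
  have ImT: "0 < Im (T z)" if "z \<in> \<Omega>" for z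
  proof -
    have "norm (g z) < 1" using g(3) that by auto
    then have "(norm (g z))\<^sup>2 < 1" by (simp add: power_less_one_iff)
    moreover have "g z \<noteq> a" using that g_ne[of z] dJ uJ by blast
    ultimately show ?thesis using cayley_Im[OF na, of "g z"] by (simp add: T_def)
  qed
  have ReT: "Im (T z) = 0" if "z \<in> J - {u}" for z
  proof -
    have "norm (g z) = 1" using g(4) that by (auto simp: J_def)
    then show ?thesis using cayley_Im[OF na, of "g z"] g_ne[of z] that by (simp add: T_def)
  qed
  have injK: "inj_on K (\<Omega> \<union> J - {u})"
  proof (rule inj_onI)
    fix x y assume xy: "x \<in> \<Omega> \<union> J - {u}" "y \<in> \<Omega> \<union> J - {u}" "K x = K y"
    then have "g x = g y" using cayley_inj[OF na g_ne[OF xy(1)] g_ne[OF xy(2)]] by (simp add: K_def T_def)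
    then show "x = y" using inj_onD[OF g(2)[folded J_def]] xy by blast
  qed
  have contK: "continuous_on (\<Omega> \<union> J - {u}) K" unfolding K_def by (intro continuous_intros contT)
  have v0: "Im (T v) = 0" "K v = 0" using ReT uJ endI(3) by (auto simp: K_def)
  have ImK: "0 < Im (K z)" if "z \<in> \<Omega>" for z using ImT[OF that] v0 by (simp add: K_def)
  have ImK0: "Im (K z) = 0" if "z \<in> J - {u}" for z using ReT[OF that] v0 by (simp add: K_def)
  have surj: "\<exists>z\<in>J - {u}. K z = of_real x" for x
  proof -
    obtain w where w: "norm w = 1" "w \<noteq> a" "cayley a w = of_real (x + Re (T v))" using cayley_surj[OF na] by blast
    then have "w \<in> g ` J" using g(4)[folded J_def] by simp
    then obtain z where z: "z \<in> J" "w = g z" by blast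
    then have "z \<noteq> u" using w(2) by (auto simp: a_def)
    moreover have "K z = of_real x" using w(3) z(2) v0(1) by (simp add: K_def T_def complex_eq_iff)
    ultimately show ?thesis using z(1) by blast
  qed
  have subs: "I \<subseteq> J - {u}" "S \<subseteq> J - {u}" using JI endI endS by auto
  have nz: "Re (K z) \<noteq> 0" if "z \<in> I \<union> S" for z
  proof
    assume "Re (K z) = 0"
    moreover have "z \<in> J - {u}" using that subs by blast
    note ImK0[OF this]
    ultimately have "K z = K v" unfolding v0(2) by (simp add: complex_eq_iff)
    moreover have "z \<in> \<Omega> \<union> J - {u}" "v \<in> \<Omega> \<union> J - {u}" using that subs uJ endI(3) by auto
    ultimately have "z = v" using inj_onD[OF injK] by blast
    then show False using that endI endS by blast
  qed
  have contRe: "continuous_on (J - {u}) (\<lambda>z. Re (K z))"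
    by (intro continuous_intros continuous_on_subset[OF contK]) auto
  have sign: "(\<forall>z\<in>E. 0 < Re (K z)) \<or> (\<forall>z\<in>E. Re (K z) < 0)" if E: "connected E" "E \<subseteq> I \<union> S" for E
  proof (rule ccontr)
    assume neg: "\<not> ?thesis"
    have EJ: "E \<subseteq> J - {u}" using E(2) subs by blast
    have "connected ((\<lambda>z. Re (K z)) ` E)"
      by (rule connected_continuous_image[OF continuous_on_subset[OF contRe EJ] E(1)])
    moreover obtain x y where xy: "x \<in> E" "y \<in> E" "Re (K x) \<le> 0" "0 \<le> Re (K y)" using neg by (auto simp: not_less)
    ultimately have "0 \<in> (\<lambda>z. Re (K z)) ` E" using connectedD_interval by blast
    then show False using nz E(2) by force
  qed
  have conn: "connected (\<tau> ` {0<..<1::real})" if "arc \<tau>" for \<tau> :: "real \<Rightarrow> complex"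
  proof (rule connected_continuous_image)
    have "continuous_on {0..1} \<tau>" using that by (simp add: arc_def path_def)
    then show "continuous_on {0<..<1} \<tau>" by (rule continuous_on_subset) auto
  qed auto
  have signI: "(\<forall>z\<in>I. 0 < Re (K z)) \<or> (\<forall>z\<in>I. Re (K z) < 0)" using sign[of I] conn[OF \<gamma>] by (simp add: I_def)
  have signS: "(\<forall>z\<in>S. 0 < Re (K z)) \<or> (\<forall>z\<in>S. Re (K z) < 0)" using sign[of S] conn[OF \<sigma>] by (simp add: S_def)
  have cover: "\<exists>z\<in>I \<union> S. K z = of_real x" if "x \<noteq> 0" for x
  proof -
    obtain z where z: "z \<in> J - {u}" "K z = of_real x" using surj by blast
    then have "z \<noteq> v" using v0(2) that by auto
    then show ?thesis using z JI by blast
  qed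
  have sub: "\<Omega> \<union> I \<subseteq> \<Omega> \<union> J - {u}" using subs dJ uJ by blast
  have contI: "continuous_on (\<Omega> \<union> I) K" and injI': "inj_on K (\<Omega> \<union> I)"
    using continuous_on_subset[OF contK sub] inj_on_subset[OF injK sub] .
  have realI: "K z = of_real (Re (K z))" if "z \<in> I" for z
  proof -
    have "z \<in> J - {u}" using that subs by blast
    from ImK0[OF this] show ?thesis by (simp add: complex_eq_iff)
  qed
  show ?thesis
    unfolding I_def[symmetric]
  proof (cases "\<forall>z\<in>I. 0 < Re (K z)")
    case True
    have "\<forall>z\<in>S. Re (K z) < 0"
    proof (rule ccontr)
      assume "\<not> ?thesis"
      then have "\<forall>z\<in>S. 0 < Re (K z)" using signS by blast
      moreover obtain z where "z \<in> I \<union> S" "K z = of_real (-1)" using cover[of "-1"] by auto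
      ultimately show False using True by auto
    qed
    moreover have "K ` I \<subseteq> of_real ` {0<..}" using True realI by (metis greaterThan_iff image_eqI image_subsetI)
    moreover have "of_real x \<in> K ` I" if "0 < x" for x
    proof -
      obtain z where z: "z \<in> I \<union> S" "K z = of_real x" using cover[of x] \<open>0 < x\<close> by auto
      then have "z \<in> I" using \<open>\<forall>z\<in>S. Re (K z) < 0\<close> \<open>0 < x\<close> by force
      then show ?thesis using z(2) by (metis image_eqI)
    qed
    ultimately have "K ` I = of_real ` {0<..}" by auto
    then show "\<exists>K. continuous_on (\<Omega> \<union> I) K \<and> inj_on K (\<Omega> \<union> I) \<and> (\<forall>z\<in>\<Omega>. 0 < Im (K z)) \<and> K ` I = of_real ` {0<..}"
      using contI injI' ImK by blast
  next
    case False
    then have neg: "\<forall>z\<in>I. Re (K z) < 0" using signI by blast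
    have pos: "\<forall>z\<in>S. 0 < Re (K z)"
    proof (rule ccontr)
      assume "\<not> ?thesis"
      then have "\<forall>z\<in>S. Re (K z) < 0" using signS by blast
      moreover obtain z where "z \<in> I \<union> S" "K z = of_real 1" using cover[of 1] by auto
      ultimately show False using neg by force
    qed
    \<comment> \<open>Reflection in the imaginary axis preserves the upper half-plane and exchanges
      the half-lines.\<close>
    define K' where "K' = (\<lambda>z. - cnj (K z))"
    have K'I: "K' z = of_real (- Re (K z))" if "z \<in> I" for z
      using realI[OF that] by (metis K'_def complex_cnj_complex_of_real of_real_minus)
    have "K' ` I \<subseteq> of_real ` {0<..}"
    proof (rule image_subsetI)
      fix z assume "z \<in> I"
      then show "K' z \<in> of_real ` {0<..}" unfolding K'I[OF \<open>z \<in> I\<close>] using neg by (intro imageI) auto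
    qed
    moreover have "of_real x \<in> K' ` I" if "0 < x" for x
    proof -
      obtain z where z: "z \<in> I \<union> S" "K z = of_real (- x)" using cover[of "- x"] \<open>0 < x\<close> by auto
      then have "z \<in> I" using pos \<open>0 < x\<close> by force
      then have "K' z = of_real x" using K'I[of z] z(2) by simp
      then show ?thesis using \<open>z \<in> I\<close> by (metis image_eqI)
    qed
    ultimately have "K' ` I = of_real ` {0<..}" by auto
    moreover have "continuous_on (\<Omega> \<union> I) K'" unfolding K'_def by (intro continuous_intros contI)
    moreover have "inj_on K' (\<Omega> \<union> I)" using injI' by (simp add: K'_def inj_on_def)
    moreover have "\<forall>z\<in>\<Omega>. 0 < Im (K' z)" using ImK by (simp add: K'_def)
    ultimately show "\<exists>K. continuous_on (\<Omega> \<union> I) K \<and> inj_on K (\<Omega> \<union> I) \<and> (\<forall>z\<in>\<Omega>. 0 < Im (K z)) \<and> K ` I = of_real ` {0<..}"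
      by blast
  qed
qed

text \<open>The logarithm turns the positive half-line into the whole real line and keeps positive
  imaginary parts. With the whole line as target, the coordinates from the two sides of an arc
  differ by a self-map of the reals.\<close>

lemma strip_map:
  fixes \<gamma> \<sigma> :: "real \<Rightarrow> complex"
  assumes "arc \<gamma>" "arc \<sigma>" "pathstart \<sigma> = pathfinish \<gamma>" "pathfinish \<sigma> = pathstart \<gamma>"
    and "path_image \<gamma> \<inter> path_image \<sigma> = {pathstart \<gamma>, pathfinish \<gamma>}"
  defines "\<Omega> \<equiv> inside (path_image \<gamma> \<union> path_image \<sigma>)"
  shows "\<exists>L. continuous_on (\<Omega> \<union> \<gamma> ` {0<..<1}) L \<and> inj_on L (\<Omega> \<union> \<gamma> ` {0<..<1}) \<and>
    (\<forall>z\<in>\<Omega>. 0 < Im (L z)) \<and> L ` \<gamma> ` {0<..<1} = range of_real"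
proof -
  let ?I = "\<gamma> ` {0<..<1}"
  from half_plane_map[OF assms(1-5), folded \<Omega>_def]
  obtain K where "continuous_on (\<Omega> \<union> ?I) K \<and> inj_on K (\<Omega> \<union> ?I) \<and> (\<forall>z\<in>\<Omega>. 0 < Im (K z)) \<and>
    K ` ?I = of_real ` {0<..}" by (rule exE)
  then have K: "continuous_on (\<Omega> \<union> ?I) K" "inj_on K (\<Omega> \<union> ?I)" "\<And>z. z \<in> \<Omega> \<Longrightarrow> 0 < Im (K z)"
    "K ` ?I = of_real ` {0<..}" by simp_all
  have nonpos: "K z \<notin> \<real>\<^sub>\<le>\<^sub>0" if "z \<in> \<Omega> \<union> ?I" for z
  proof (cases "z \<in> \<Omega>")
    case True
    then show ?thesis using K(3)[of z] by (auto simp: complex_nonpos_Reals_iff)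
  next
    case False
    then have "K z \<in> of_real ` {0<..}" using that K(4) by blast
    then show ?thesis by (auto simp: complex_nonpos_Reals_iff)
  qed
  then have nz: "K z \<noteq> 0" if "z \<in> \<Omega> \<union> ?I" for z using that by fastforce
  have "continuous_on (\<Omega> \<union> ?I) (\<lambda>z. Ln (K z))" using K(1) nonpos by (intro continuous_on_Ln') auto
  moreover have "inj_on (\<lambda>z. Ln (K z)) (\<Omega> \<union> ?I)"
  proof (rule inj_onI)
    fix x y assume xy: "x \<in> \<Omega> \<union> ?I" "y \<in> \<Omega> \<union> ?I" "Ln (K x) = Ln (K y)"
    then have "K x = K y" using nz exp_Ln by metis
    then show "x = y" using K(2) xy by (auto dest: inj_onD)
  qed
  moreover have "\<forall>z\<in>\<Omega>. 0 < Im (Ln (K z))" using K(3) Im_Ln_pos_lt_imp by blast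
  moreover have "(\<lambda>z. Ln (K z)) ` ?I = range of_real"
  proof -
    have "(\<lambda>z. Ln (K z)) ` ?I = Ln ` of_real ` {0<..}" unfolding K(4)[symmetric] by (simp add: image_image)
    also have "\<dots> = of_real ` ln ` {0<..}" unfolding image_image by (rule image_cong) (auto simp: Ln_of_real)
    also have "ln ` {0<..} = (UNIV :: real set)"
    proof -
      have "x \<in> ln ` {0<..}" for x :: real by (rule image_eqI[of _ _ "exp x"]) auto
      then show ?thesis by blast
    qed
    finally show ?thesis .
  qed
  ultimately show ?thesis by blast
qed

text \<open>The coordinates \<open>L\<close> and \<open>M\<close> need not agree on the common arc.
  Their transition \<open>\<theta>\<close> on the real line is extended to the side of
  \<open>B\<close> by acting on real parts alone; after reflecting that side downwards the two maps
  fit together.\<close>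

lemma glue_along_arc:
  fixes \<gamma> :: "real \<Rightarrow> complex"
  assumes \<gamma>: "arc \<gamma>" and op: "open A" "open B" and dis: "A \<inter> B = {}" "A \<inter> \<gamma> ` {0<..<1} = {}" "B \<inter> \<gamma> ` {0<..<1} = {}"
    and L: "continuous_on (A \<union> \<gamma> ` {0<..<1}) L" "inj_on L (A \<union> \<gamma> ` {0<..<1})" "\<And>z. z \<in> A \<Longrightarrow> 0 < Im (L z)" "L ` \<gamma> ` {0<..<1} = range of_real"
    and M: "continuous_on (B \<union> \<gamma> ` {0<..<1}) M" "inj_on M (B \<union> \<gamma> ` {0<..<1})" "\<And>z. z \<in> B \<Longrightarrow> 0 < Im (M z)" "M ` \<gamma> ` {0<..<1} = range of_real"
  shows "\<exists>G. continuous_on (A \<union> B \<union> \<gamma> ` {0<..<1}) G \<and> inj_on G (A \<union> B \<union> \<gamma> ` {0<..<1}) \<and>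
    (\<forall>z\<in>\<gamma> ` {0<..<1}. Im (G z) = 0)"
proof -
  define I where "I = \<gamma> ` {0<..<1}"
  note dis = dis[folded I_def] and L = L[folded I_def] and M = M[folded I_def]
  have cont\<gamma>: "continuous_on {0<..<1} \<gamma>"
  proof -
    have "continuous_on {0..1} \<gamma>" using \<gamma> by (simp add: arc_def path_def)
    then show ?thesis by (rule continuous_on_subset) auto
  qed
  have inj\<gamma>: "inj_on \<gamma> {0<..<1}" using \<gamma> unfolding arc_def by (meson greaterThanLessThan_subseteq_atLeastAtMost_iff inj_on_subset order_refl)
  have LI: "L z = of_real (Re (L z))" if "z \<in> I" for z
  proof -
    have "L z \<in> range of_real" using L(4) that by blast
    then show ?thesis by auto
  qed
  have MI: "M z = of_real (Re (M z))" if "z \<in> I" for z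
  proof -
    have "M z \<in> range of_real" using M(4) that by blast
    then show ?thesis by auto
  qed
  define k where "k = (\<lambda>t. Re (M (\<gamma> t)))"
  have "continuous_on {0<..<1} (\<lambda>t. M (\<gamma> t))"
    by (rule continuous_on_compose2[OF M(1) cont\<gamma>]) (auto simp: I_def)
  then have contk: "continuous_on {0<..<1} k" unfolding k_def by (intro continuous_intros)
  have injk: "inj_on k {0<..<1}"
  proof (rule inj_onI)
    fix s t assume st: "s \<in> {0<..<1}" "t \<in> {0<..<1}" "k s = k t"
    then have mem: "\<gamma> s \<in> I" "\<gamma> t \<in> I" by (auto simp: I_def)
    then have "M (\<gamma> s) = M (\<gamma> t)" using MI[OF mem(1)] MI[OF mem(2)] st(3) by (simp add: k_def)
    then have "\<gamma> s = \<gamma> t" using inj_onD[OF M(2)] mem by blast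
    then show "s = t" using inj_onD[OF inj\<gamma>] st by blast
  qed
  have ksurj: "k ` {0<..<1} = UNIV"
  proof -
    have "x \<in> k ` {0<..<1}" for x
    proof -
      have "of_real x \<in> M ` I" using M(4) by blast
      then obtain t where "t \<in> {0<..<1}" "M (\<gamma> t) = of_real x" by (auto simp: I_def)
      then show ?thesis by (auto simp: k_def intro!: image_eqI[of _ _ t])
    qed
    then show ?thesis by blast
  qed
  obtain ki where ki: "homeomorphism {0<..<1} UNIV k ki"
    using invariance_of_domain_homeomorphism[OF open_greaterThanLessThan contk _ injk] ksurj by auto
  \<comment> \<open>The transition from the real coordinate given by \<open>M\<close> to the one
    given by \<open>L\<close>, passing through the parameter of the arc.\<close>
  define \<theta> where "\<theta> = (\<lambda>x. Re (L (\<gamma> (ki x))))"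
  have ki01: "ki x \<in> {0<..<1}" "k (ki x) = x" for x using ki by (auto simp: homeomorphism_def)
  have kik: "ki (k t) = t" if "t \<in> {0<..<1}" for t using ki that by (auto simp: homeomorphism_def)
  have cont\<theta>: "continuous_on UNIV \<theta>"
  proof -
    have "continuous_on UNIV ki" using ki by (simp add: homeomorphism_def)
    from continuous_on_compose2[OF cont\<gamma> this] have "continuous_on UNIV (\<lambda>x. \<gamma> (ki x))" using ki01 by blast
    moreover have "range (\<lambda>x. \<gamma> (ki x)) \<subseteq> A \<union> I" using ki01(1) unfolding I_def by blast
    ultimately have "continuous_on UNIV (\<lambda>x. L (\<gamma> (ki x)))" by (rule continuous_on_compose2[OF L(1)])
    then show ?thesis unfolding \<theta>_def by (intro continuous_intros)
  qed
  have inj\<theta>: "inj \<theta>"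
  proof (rule injI)
    fix x y assume "\<theta> x = \<theta> y"
    moreover have mem: "\<gamma> (ki x) \<in> I" "\<gamma> (ki y) \<in> I" using ki01 by (auto simp: I_def)
    ultimately have "L (\<gamma> (ki x)) = L (\<gamma> (ki y))" using LI[OF mem(1)] LI[OF mem(2)] by (simp add: \<theta>_def)
    then have "\<gamma> (ki x) = \<gamma> (ki y)" using inj_onD[OF L(2)] mem by blast
    then have "ki x = ki y" using inj_onD[OF inj\<gamma>] ki01 by blast
    then show "x = y" using ki01(2) by metis
  qed
  define N where "N = (\<lambda>z. Complex (\<theta> (Re (M z))) (- Im (M z)))"
  have NI: "N z = L z" if zI: "z \<in> I" for z
  proof -
    obtain t where t: "t \<in> {0<..<1}" "z = \<gamma> t" using zI unfolding I_def by blast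
    have "Im (M z) = 0" using MI[OF zI] by (metis Im_complex_of_real)
    moreover have "Re (M z) = k t" by (simp add: k_def t(2))
    moreover have "\<theta> (k t) = Re (L z)" by (simp add: \<theta>_def kik[OF t(1)] t(2))
    ultimately have "N z = of_real (Re (L z))" by (simp add: N_def complex_of_real_def)
    then show ?thesis using LI[OF zI] by simp
  qed
  have contN: "continuous_on (B \<union> I) N"
  proof -
    have c1: "continuous_on (B \<union> I) (\<lambda>z. \<theta> (Re (M z)))"
      by (rule continuous_on_compose2[OF cont\<theta>]) (auto intro!: continuous_intros M(1))
    have c2: "continuous_on (B \<union> I) (\<lambda>z. - Im (M z))" by (intro continuous_intros M(1))
    show ?thesis unfolding N_def Complex_eq by (intro continuous_on_add continuous_on_mult continuous_on_of_real continuous_on_const c1 c2)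
  qed
  have injN: "inj_on N (B \<union> I)"
  proof (rule inj_onI)
    fix x y assume xy: "x \<in> B \<union> I" "y \<in> B \<union> I" "N x = N y"
    then have "\<theta> (Re (M x)) = \<theta> (Re (M y))" "Im (M x) = Im (M y)" by (auto simp: N_def)
    then have "M x = M y" using inj\<theta> by (simp add: inj_eq complex_eq_iff)
    then show "x = y" using inj_onD[OF M(2)] xy by blast
  qed
  have ImN: "Im (N z) < 0" if "z \<in> B" for z using M(3)[OF that] by (simp add: N_def)
  have ImL: "Im (L z) = 0" if "z \<in> I" for z using LI[OF that] by (metis Im_complex_of_real)
  define G where "G = (\<lambda>z. if z \<in> A \<union> I then L z else N z)"
  have un: "A \<union> B \<union> I = (A \<union> I) \<union> (B \<union> I)" by blast
  have GA: "G z = L z" if "z \<in> A \<union> I" for z using that by (simp add: G_def)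
  have GB: "G z = N z" if "z \<in> B \<union> I" for z using that dis NI by (auto simp: G_def)
  \<comment> \<open>Pasting over closed sets works because \<open>A\<close> and \<open>B\<close> are
    open and disjoint: each of \<open>A \<union> I\<close> and \<open>B \<union> I\<close> is the
    complement of the other open side within the union.\<close>
  have "continuous_on ((A \<union> I) \<union> (B \<union> I)) G"
    unfolding G_def
  proof (rule continuous_on_cases_local[OF _ _ L(1) contN])
    have "A \<union> I = ((A \<union> I) \<union> (B \<union> I)) \<inter> - B" "B \<union> I = ((A \<union> I) \<union> (B \<union> I)) \<inter> - A" using dis by blast+
    then show "closedin (top_of_set ((A \<union> I) \<union> (B \<union> I))) (A \<union> I)" "closedin (top_of_set ((A \<union> I) \<union> (B \<union> I))) (B \<union> I)"
      using op closedin_closed closed_Compl by metis+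
    show "L x = N x" if "x \<in> A \<union> I \<and> x \<notin> A \<union> I \<or> x \<in> B \<union> I \<and> x \<in> A \<union> I" for x
      using that dis NI by auto
  qed
  moreover have "inj_on G (A \<union> B \<union> I)"
  proof (rule inj_onI)
    fix x y assume xy: "x \<in> A \<union> B \<union> I" "y \<in> A \<union> B \<union> I" "G x = G y"
    have ImG: "z \<in> B \<longleftrightarrow> Im (G z) < 0" if "z \<in> A \<union> B \<union> I" for z
    proof (cases "z \<in> B")
      case True
      then show ?thesis using ImN[OF True] GB[of z] by simp
    next
      case False
      then have "z \<in> A \<union> I" using that by blast
      then have "0 \<le> Im (G z)" using GA[of z] L(3)[of z] ImL[of z] by auto
      then show ?thesis using False by simp
    qed
    then have "x \<in> B \<longleftrightarrow> y \<in> B" using xy by metis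
    then consider "x \<in> B \<union> I" "y \<in> B \<union> I" | "x \<in> A \<union> I" "y \<in> A \<union> I" using xy(1,2) by blast
    then show "x = y"
    proof cases
      case 1
      then show ?thesis using GB xy(3) inj_onD[OF injN, of x y] by simp
    next
      case 2
      then show ?thesis using GA xy(3) inj_onD[OF L(2), of x y] by simp
    qed
  qed
  moreover have "\<forall>z\<in>I. Im (G z) = 0" using GA ImL by simp
  ultimately show ?thesis unfolding un I_def[symmetric] by blast
qed

section \<open>Flattening an arc inside a round disc\<close>

lemma arc_crosses_ball:
  fixes g :: "real \<Rightarrow> 'a::euclidean_space"
  assumes g: "arc g" "0 < s" "s < 1"
  obtains r a b where "r > 0" "0 \<le> a" "a < s" "s < b" "b \<le> 1" "g a \<in> sphere (g s) r" "g b \<in> sphere (g s) r"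
    "g ` {a<..<b} \<subseteq> ball (g s) r"
proof -
  have contg: "continuous_on {0..1} g" and injg: "inj_on g {0..1}" using g(1) by (simp_all add: arc_def path_def)
  define p where "p = g s"
  have ne: "g 0 \<noteq> p" "g 1 \<noteq> p" using inj_onD[OF injg, of 0 s] inj_onD[OF injg, of 1 s] g(2,3) by (auto simp: p_def)
  \<comment> \<open>The smaller distance to the two ends ensures that the arc leaves the open ball
    in both directions; \<open>a\<close> and \<open>b\<close> are the last parameter before
    \<open>s\<close> and the first after \<open>s\<close> at distance at least
    \<open>r\<close>.\<close>
  define r where "r = min (dist p (g 0)) (dist p (g 1))"
  have r: "r > 0" "r \<le> dist p (g 0)" "r \<le> dist p (g 1)" using ne by (auto simp: r_def)
  have contd: "continuous_on {0..1} (\<lambda>t. dist p (g t))" by (intro continuous_intros contg)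
  define S1 where "S1 = {t \<in> {0..s}. r \<le> dist p (g t)}"
  define S2 where "S2 = {t \<in> {s..1}. r \<le> dist p (g t)}"
  have cS: "compact S1" "compact S2"
  proof -
    have "closed ({0..s} \<inter> (\<lambda>t. dist p (g t)) -` {r..})" "closed ({s..1} \<inter> (\<lambda>t. dist p (g t)) -` {r..})"
      using g(2,3) by (auto intro!: continuous_closed_preimage continuous_on_subset[OF contd])
    moreover have "S1 = {0..s} \<inter> ({0..s} \<inter> (\<lambda>t. dist p (g t)) -` {r..})" "S2 = {s..1} \<inter> ({s..1} \<inter> (\<lambda>t. dist p (g t)) -` {r..})"
      by (auto simp: S1_def S2_def)
    ultimately show "compact S1" "compact S2" by (metis compact_Icc compact_Int_closed)+
  qed
  have "0 \<in> S1" "1 \<in> S2" using r g(2,3) by (simp_all add: S1_def S2_def)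
  then have neS: "S1 \<noteq> {}" "S2 \<noteq> {}" by blast+
  obtain a where a: "a \<in> S1" "\<forall>t\<in>S1. t \<le> a" using compact_attains_sup[OF cS(1) neS(1)] by blast
  obtain b where b: "b \<in> S2" "\<forall>t\<in>S2. b \<le> t" using compact_attains_inf[OF cS(2) neS(2)] by blast
  have ds: "dist p (g s) = 0" by (simp add: p_def)
  have as: "a \<noteq> s" "b \<noteq> s" using a(1) b(1) ds r(1) by (auto simp: S1_def S2_def)
  have ab: "0 \<le> a" "a < s" "s < b" "b \<le> 1" using a(1) b(1) as by (auto simp: S1_def S2_def)
  have inside: "dist p (g t) < r" if "a < t" "t < b" for t
  proof (rule ccontr)
    assume "\<not> dist p (g t) < r"
    then have "t \<in> S1 \<or> t \<in> S2" using that ab by (auto simp: S1_def S2_def)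
    then show False using a(2) b(2) that by auto
  qed
  have lim: "dist p (g c) \<le> r" if c: "c \<in> closure {a<..<b}" for c
  proof -
    have "closure {a<..<b} \<subseteq> {0..1}" using ab by simp
    then have "continuous_on (closure {a<..<b}) (\<lambda>t. dist p (g t))" using contd continuous_on_subset by blast
    then show ?thesis by (rule continuous_le_on_closure[OF _ c]) (use inside in \<open>auto intro: less_imp_le\<close>)
  qed
  have "a \<in> closure {a<..<b}" "b \<in> closure {a<..<b}" using ab by simp_all
  then have "dist p (g a) = r" "dist p (g b) = r" using lim a(1) b(1) by (auto simp: S1_def S2_def intro: antisym)
  then have "g a \<in> sphere (g s) r" "g b \<in> sphere (g s) r" by (simp_all add: p_def)
  moreover have "g ` {a<..<b} \<subseteq> ball (g s) r" using inside by (auto simp: p_def)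
  ultimately show ?thesis by (rule that[OF r(1) ab])
qed

text \<open>The subarc through \<open>g s\<close> is a crosscut of a round disc. Each side is a
  Jordan domain bounded by the subarc and an arc of the circle; the strip coordinates of the two
  sides are glued along the subarc into an embedding of the whole disc.\<close>

theorem arc_locally_flat:
  fixes g :: "real \<Rightarrow> complex"
  assumes g: "arc g" "0 < s" "s < 1"
  obtains U V G where "open U" "open V" "g s \<in> V" "V \<subseteq> U" "continuous_on U G" "inj_on G U"
    "\<And>z. z \<in> path_image g \<inter> V \<Longrightarrow> Im (G z) = 0"
proof -
  have contg: "continuous_on {0..1} g" and injg: "inj_on g {0..1}" using g(1) by (simp_all add: arc_def path_def)
  obtain r a b where r: "r > 0" and ab: "0 \<le> a" "a < s" "s < b" "b \<le> 1"
    and sph: "g a \<in> sphere (g s) r" "g b \<in> sphere (g s) r" and ball: "g ` {a<..<b} \<subseteq> ball (g s) r"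
    by (rule arc_crosses_ball[OF g])
  define \<gamma> where "\<gamma> = subpath a b g"
  have \<gamma>: "arc \<gamma>" "pathstart \<gamma> = g a" "pathfinish \<gamma> = g b"
    unfolding \<gamma>_def using arc_subpath_arc[OF g(1)] ab by auto
  have "\<gamma> ` {0<..<1} = g ` ((\<lambda>x. (b - a) * x + a) ` {0<..<1})" by (simp add: \<gamma>_def subpath_def image_image)
  also have "(\<lambda>x. (b - a) * x + a) ` {0<..<1} = {a<..<b}"
  proof (intro equalityI subsetI)
    fix y assume y: "y \<in> {a<..<b}"
    then show "y \<in> (\<lambda>x. (b - a) * x + a) ` {0<..<1}"
      using ab by (intro image_eqI[of _ _ "(y - a) / (b - a)"]) (auto simp: field_simps)
  next
    fix y assume "y \<in> (\<lambda>x. (b - a) * x + a) ` {0<..<1}"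
    then obtain x where x: "0 < x" "x < 1" "y = (b - a) * x + a" by auto
    then have "0 < (b - a) * x" "(b - a) * x < (b - a) * 1" using ab by (auto intro: mult_strict_left_mono)
    then show "y \<in> {a<..<b}" using x(3) by auto
  qed
  finally have I: "\<gamma> ` {0<..<1} = g ` {a<..<b}" .
  have circ: "simple_path (circlepath (g s) r)" "pathfinish (circlepath (g s) r) = pathstart (circlepath (g s) r)"
    "path_image (circlepath (g s) r) = sphere (g s) r"
    using r by (auto simp: simple_path_circlepath path_image_circlepath)
  have gab: "g a \<noteq> g b" using inj_onD[OF injg, of a b] ab by auto
  obtain u d where ud: "arc u" "arc d" "pathstart u = g a" "pathfinish u = g b" "pathstart d = g b" "pathfinish d = g a"
    "path_image u \<inter> path_image d = {g a, g b}" "path_image u \<union> path_image d = sphere (g s) r"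
    using exists_double_arc[OF circ(1,2), of "g a" "g b"] sph gab unfolding circ(3) by blast
  define d' where "d' = reversepath d"
  have d': "arc d'" "pathstart d' = g a" "pathfinish d' = g b" "path_image d' = path_image d"
    using ud by (simp_all add: d'_def arc_reversepath)
  have im\<gamma>: "path_image \<gamma> = {g a, g b} \<union> \<gamma> ` {0<..<1}" using arc_path_image_split[of \<gamma>] \<gamma>(2,3) by simp
  have dis: "\<gamma> ` {0<..<1} \<inter> sphere (g s) r = {}" using ball unfolding I by auto
  have aux: "X \<inter> path_image \<gamma> = {g a, g b}" if "X \<subseteq> sphere (g s) r" "g a \<in> X" "g b \<in> X" for X
  proof -
    have "X \<inter> \<gamma> ` {0<..<1} = {}" using dis that(1) by blast
    then show ?thesis unfolding im\<gamma> Int_Un_distrib using that(2,3) by auto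
  qed
  have ab_mem: "g a \<in> path_image u" "g b \<in> path_image u" "g a \<in> path_image d" "g b \<in> path_image d"
    using ud(7) by blast+
  have ints: "path_image u \<inter> path_image \<gamma> = {g a, g b}" "path_image d' \<inter> path_image \<gamma> = {g a, g b}"
    unfolding d'(4) using ab_mem ud(8) by (intro aux; blast)+
  have insph: "inside (path_image u \<union> path_image d') = ball (g s) r"
    unfolding d'(4) ud(8) using inside_frontier_eq_interior[of "cball (g s) r"] by simp
  have "path_image \<gamma> \<inter> inside (path_image u \<union> path_image d') \<noteq> {}"
  proof -
    have "g s \<in> g ` {a<..<b}" using ab by (intro imageI) auto
    then have "g s \<in> path_image \<gamma>" unfolding im\<gamma> I by blast
    moreover have "g s \<in> ball (g s) r" using r by simp
    ultimately show ?thesis unfolding insph by blast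
  qed
  moreover have "path_image u \<inter> path_image d' = {g a, g b}" using ud(7) d'(4) by simp
  ultimately have sp: "inside (path_image u \<union> path_image \<gamma>) \<inter> inside (path_image d' \<union> path_image \<gamma>) = {}"
    "inside (path_image u \<union> path_image \<gamma>) \<union> inside (path_image d' \<union> path_image \<gamma>) \<union> (path_image \<gamma> - {g a, g b}) = ball (g s) r"
    using split_inside_simple_closed_curve[OF arc_imp_simple_path[OF ud(1)] ud(3,4) arc_imp_simple_path[OF d'(1)] d'(2,3)
      arc_imp_simple_path[OF \<gamma>(1)] \<gamma>(2,3) gab _ ints] unfolding insph by simp_all
  have key: "open (inside (path_image e \<union> path_image \<gamma>)) \<and> inside (path_image e \<union> path_image \<gamma>) \<inter> path_image \<gamma> = {} \<and>
      (\<exists>L. continuous_on (inside (path_image e \<union> path_image \<gamma>) \<union> \<gamma> ` {0<..<1}) L \<and>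
         inj_on L (inside (path_image e \<union> path_image \<gamma>) \<union> \<gamma> ` {0<..<1}) \<and>
         (\<forall>z\<in>inside (path_image e \<union> path_image \<gamma>). 0 < Im (L z)) \<and> L ` \<gamma> ` {0<..<1} = range of_real)"
    if e: "arc e" "pathstart e = g a" "pathfinish e = g b" "path_image e \<inter> path_image \<gamma> = {g a, g b}" for e
  proof -
    have rev: "arc (reversepath e)" "pathstart (reversepath e) = pathfinish \<gamma>" "pathfinish (reversepath e) = pathstart \<gamma>"
      "path_image \<gamma> \<inter> path_image (reversepath e) = {pathstart \<gamma>, pathfinish \<gamma>}"
      using e \<gamma> by (auto simp: arc_reversepath)
    have "\<exists>L. continuous_on (inside (path_image e \<union> path_image \<gamma>) \<union> \<gamma> ` {0<..<1}) L \<and>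
         inj_on L (inside (path_image e \<union> path_image \<gamma>) \<union> \<gamma> ` {0<..<1}) \<and>
         (\<forall>z\<in>inside (path_image e \<union> path_image \<gamma>). 0 < Im (L z)) \<and> L ` \<gamma> ` {0<..<1} = range of_real"
      using strip_map[OF \<gamma>(1) rev] by (simp add: Un_commute)
    moreover have "closed (path_image e \<union> path_image \<gamma>)"
      using e(1) \<gamma>(1) by (simp add: arc_imp_path closed_Un closed_path_image)
    then have "open (inside (path_image e \<union> path_image \<gamma>))" by (rule open_inside)
    moreover have "inside (path_image e \<union> path_image \<gamma>) \<inter> path_image \<gamma> = {}"
      using inside_no_overlap[of "path_image e \<union> path_image \<gamma>"] by blast
    ultimately show ?thesis by blast
  qed
  note ku = key[OF ud(1,3,4) ints(1)] and kd = key[OF d'(1-3) ints(2)]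
  have sub: "\<gamma> ` {0<..<1} \<subseteq> path_image \<gamma>" using im\<gamma> by blast
  have "g a \<notin> \<gamma> ` {0<..<1}" "g b \<notin> \<gamma> ` {0<..<1}" using dis sph by blast+
  then have diff: "path_image \<gamma> - {g a, g b} = \<gamma> ` {0<..<1}" unfolding im\<gamma> by blast
  obtain L where L: "continuous_on (inside (path_image u \<union> path_image \<gamma>) \<union> \<gamma> ` {0<..<1}) L"
    "inj_on L (inside (path_image u \<union> path_image \<gamma>) \<union> \<gamma> ` {0<..<1})"
    "\<And>z. z \<in> inside (path_image u \<union> path_image \<gamma>) \<Longrightarrow> 0 < Im (L z)" "L ` \<gamma> ` {0<..<1} = range of_real"
    using ku by blast
  obtain M where M: "continuous_on (inside (path_image d' \<union> path_image \<gamma>) \<union> \<gamma> ` {0<..<1}) M"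
    "inj_on M (inside (path_image d' \<union> path_image \<gamma>) \<union> \<gamma> ` {0<..<1})"
    "\<And>z. z \<in> inside (path_image d' \<union> path_image \<gamma>) \<Longrightarrow> 0 < Im (M z)" "M ` \<gamma> ` {0<..<1} = range of_real"
    using kd by blast
  have d1: "inside (path_image u \<union> path_image \<gamma>) \<inter> \<gamma> ` {0<..<1} = {}" "inside (path_image d' \<union> path_image \<gamma>) \<inter> \<gamma> ` {0<..<1} = {}"
    using ku kd sub by blast+
  obtain G where G: "continuous_on (ball (g s) r) G" "inj_on G (ball (g s) r)" "\<And>z. z \<in> \<gamma> ` {0<..<1} \<Longrightarrow> Im (G z) = 0"
    using glue_along_arc[OF \<gamma>(1) conjunct1[OF ku] conjunct1[OF kd] sp(1) d1 L M] unfolding sp(2)[unfolded diff] by blast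
  have "continuous_on ({0..a} \<union> {b..1}) g" by (rule continuous_on_subset[OF contg]) (use ab in auto)
  then have cR: "compact (g ` ({0..a} \<union> {b..1}))" by (intro compact_continuous_image compact_Un compact_Icc)
  \<comment> \<open>The rest of \<open>g\<close> may enter the disc again; it is compact and misses
    \<open>g s\<close>, so it is cut away.\<close>
  define V where "V = ball (g s) r - g ` ({0..a} \<union> {b..1})"
  have "g s \<notin> g ` ({0..a} \<union> {b..1})"
  proof
    assume "g s \<in> g ` ({0..a} \<union> {b..1})"
    then obtain t where t: "g s = g t" "t \<in> {0..a} \<union> {b..1}" by (rule imageE)
    then have "t \<in> {0..1}" "s \<in> {0..1}" using ab g(2,3) by auto
    then have "s = t" using inj_onD[OF injg t(1)] by blast
    then show False using t(2) ab by auto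
  qed
  show ?thesis
  proof (rule that[of "ball (g s) r" V G])
    show "open V" unfolding V_def using cR by (intro open_Diff open_ball compact_imp_closed)
    show "g s \<in> V" using r \<open>g s \<notin> _\<close> by (simp add: V_def)
    show "V \<subseteq> ball (g s) r" by (auto simp: V_def)
    show "Im (G z) = 0" if zV: "z \<in> path_image g \<inter> V" for z
    proof -
      obtain t where t: "z = g t" "t \<in> {0..1}" using zV unfolding path_image_def by blast
      then have "t \<notin> {0..a} \<union> {b..1}" using zV unfolding V_def by blast
      then have "t \<in> {a<..<b}" using t(2) by auto
      then show ?thesis using G(3) I t(1) by blast
    qed
  qed (use G in auto)
qed

section \<open>Compacta over plane arcs\<close>

text \<open>The cover by complements of the three sides has no refinement of order 2. Such a
  refinement gives three functions, the i-th vanishing on side i, never all positive and never all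
  zero. Their normalisation with the coordinates shifted cyclically has a Brouwer fixed point, where
  the vanishing of one function propagates to all three.\<close>

lemma triangle_covering_dim:
  fixes P :: "'a::euclidean_space set" and \<psi> :: "real \<times> real \<Rightarrow> 'a"
  defines "\<Delta> \<equiv> {z. 0 \<le> fst z \<and> 0 \<le> snd z \<and> fst z + snd z \<le> 1}"
  assumes P: "compact P" and \<psi>: "continuous_on \<Delta> \<psi>" "inj_on \<psi> \<Delta>" "\<psi> ` \<Delta> \<subseteq> P"
  shows "\<not> covering_dim_le (top_of_set P) 1"
proof
  assume dim: "covering_dim_le (top_of_set P) 1"
  have closed\<Delta>: "closed \<Delta>"
    unfolding \<Delta>_def by (intro closed_Collect_conj closed_Collect_le continuous_intros)
  have "\<Delta> \<subseteq> cbox (0, 0) (1, 1)" by (auto simp: \<Delta>_def)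
  then have compact\<Delta>: "compact \<Delta>" using closed\<Delta> bounded_cbox bounded_subset compact_eq_bounded_closed by blast
  have convex\<Delta>: "convex \<Delta>"
  proof -
    have "\<Delta> = {z. (-1, 0) \<bullet> z \<le> 0} \<inter> {z. (0, -1) \<bullet> z \<le> 0} \<inter> {z. (1, 1) \<bullet> z \<le> 1}"
      by (auto simp: \<Delta>_def inner_prod_def)
    then show ?thesis by (simp add: convex_Int convex_halfspace_le)
  qed
  \<comment> \<open>Barycentric coordinates of the triangle, index 0 belonging to the vertex at the
    origin.\<close>
  define \<beta> :: "nat \<Rightarrow> real \<times> real \<Rightarrow> real" where
    "\<beta> = (\<lambda>i z. if i = 0 then 1 - fst z - snd z else if i = 1 then fst z else snd z)"
  define F where "F = (\<lambda>i. {z \<in> \<Delta>. \<beta> i z = 0})"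
  have cF: "compact (\<psi> ` F i)" for i
  proof -
    have "closed {z. \<beta> i z = 0}" unfolding \<beta>_def
      by (cases "i = 0"; cases "i = 1"; simp; intro closed_Collect_eq continuous_intros)
    then have "compact (F i)" unfolding F_def Collect_conj_eq using compact\<Delta> by (simp add: compact_Int_closed)
    then show ?thesis
      by (intro compact_continuous_image continuous_on_subset[OF \<psi>(1)]) (auto simp: F_def)
  qed
  define U where "U = (\<lambda>i. P - \<psi> ` F i)"
  have oU: "openin (top_of_set P) (U i)" for i
    unfolding U_def using cF[of i] by (simp add: Diff_eq compact_imp_closed open_Compl openin_open_Int)
  have "\<Union>(U ` {0, 1, 2}) = P"
  proof -
    have "x \<in> \<Union>(U ` {0, 1, 2})" if "x \<in> P" for x
    proof (rule ccontr)
      assume "x \<notin> \<Union>(U ` {0, 1, 2})"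
      then have "x \<in> \<psi> ` F 0" and "x \<in> \<psi> ` F 1" and "x \<in> \<psi> ` F 2" using that by (auto simp: U_def)
      then obtain z0 z1 z2 where z: "z0 \<in> F 0" "z1 \<in> F 1" "z2 \<in> F 2" "x = \<psi> z0" "x = \<psi> z1" "x = \<psi> z2"
        by (elim imageE)
      have m: "z0 \<in> \<Delta>" "z1 \<in> \<Delta>" "z2 \<in> \<Delta>" using z(1-3) unfolding F_def by blast+
      have "\<psi> z0 = \<psi> z1" "\<psi> z0 = \<psi> z2" unfolding z(4)[symmetric] by (fact z(5,6))+
      then have "z0 = z1" "z0 = z2" using inj_onD[OF \<psi>(2)] m by blast+
      then show False using z(1-3) by (auto simp: F_def \<beta>_def)
    qed
    then show ?thesis by (auto simp: U_def)
  qed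
  moreover define \<U> where "\<U> = U ` {0, 1, 2}"
  ultimately have "finite \<U> \<and> (\<forall>W\<in>\<U>. openin (top_of_set P) W) \<and> \<Union>\<U> = topspace (top_of_set P)"
    using oU by auto
  with dim[unfolded covering_dim_le_def, THEN conjunct2, rule_format, of \<U>]
  obtain \<V> where V: "finite \<V>" "\<forall>V\<in>\<V>. openin (top_of_set P) V" "\<Union>\<V> = topspace (top_of_set P)"
    "\<forall>V\<in>\<V>. \<exists>W\<in>\<U>. V \<subseteq> W" "\<forall>x\<in>topspace (top_of_set P). int (card {V\<in>\<V>. x \<in> V}) \<le> 1 + 1"
    by blast
  have "\<forall>V\<in>\<V>. \<exists>i. i < 3 \<and> V \<subseteq> U i"
  proof
    fix V assume "V \<in> \<V>"
    then obtain i where "i \<in> {0, 1, 2}" "V \<subseteq> U i" using V(4) unfolding \<U>_def by blast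
    then show "\<exists>i. i < 3 \<and> V \<subseteq> U i" by (intro exI[of _ i]) auto
  qed
  then obtain \<iota> where \<iota>: "\<And>V. V \<in> \<V> \<Longrightarrow> \<iota> V < (3::nat) \<and> V \<subseteq> U (\<iota> V)" by metis
  \<comment> \<open>Members of the refinement are grouped by the side they avoid, leaving three open
    sets.\<close>
  define W where "W = (\<lambda>i. \<Union>{V\<in>\<V>. \<iota> V = i})"
  have WU: "W i \<subseteq> U i" for i using \<iota> by (auto simp: W_def)
  have oW: "openin (top_of_set P) (W i)" for i unfolding W_def using V(2) by (intro openin_Union) auto
  have clW: "closed (P - W i)" for i
  proof -
    have "closedin (top_of_set P) (P - W i)" using oW[of i] by (simp add: closedin_def openin_imp_subset double_diff)
    then show ?thesis using closedin_closed_trans compact_imp_closed[OF P] by blast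
  qed
  \<comment> \<open>\<open>infdist\<close> to the empty set is 0, so these complements must be
    nonempty before a zero of \<open>w i\<close> can be read as lying outside \<open>W i\<close>;
    any point of side i serves.\<close>
  have Wne: "P - W i \<noteq> {}" if "i < 3" for i
  proof -
    have "(if i = 0 then (1, 0) else (0, 0)) \<in> F i" if "i \<noteq> 2" using \<open>i < 3\<close> that by (auto simp: F_def \<beta>_def \<Delta>_def)
    moreover have "(0, 0) \<in> F 2" by (auto simp: F_def \<beta>_def \<Delta>_def)
    ultimately obtain z where z: "z \<in> F i" by blast
    then have "\<psi> z \<in> P - W i" using WU[of i] \<psi>(3) by (auto simp: U_def F_def)
    then show ?thesis by blast
  qed
  define w where "w = (\<lambda>i z. infdist (\<psi> z) (P - W i))"
  have w0: "w i z = 0 \<longleftrightarrow> \<psi> z \<notin> W i" if "i < 3" "z \<in> \<Delta>" for i z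
    using in_closed_iff_infdist_zero[OF clW Wne[OF that(1)], of "\<psi> z"] \<psi>(3) that(2) by (auto simp: w_def)
  have wnn: "0 \<le> w i z" for i z by (simp add: w_def infdist_nonneg)
  have wF: "w i z = 0" if "i < 3" "z \<in> \<Delta>" "\<beta> i z = 0" for i z
    using that WU[of i] w0[OF that(1,2)] by (auto simp: U_def F_def)
  have contw: "continuous_on \<Delta> (w i)" for i unfolding w_def by (intro continuous_intros \<psi>(1))
  define \<Sigma> where "\<Sigma> = (\<lambda>z. w 0 z + w 1 z + w 2 z)"
  have \<Sigma>pos: "\<Sigma> z > 0" if "z \<in> \<Delta>" for z
  proof -
    have "\<psi> z \<in> \<Union>\<V>" using V(3) \<psi>(3) that by auto
    then obtain V where "V \<in> \<V>" "\<psi> z \<in> V" by blast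
    then have "\<psi> z \<in> W (\<iota> V)" "\<iota> V < 3" using \<iota> by (auto simp: W_def)
    then have "w (\<iota> V) z > 0" using w0[of "\<iota> V" z] that wnn[of "\<iota> V" z] by linarith
    moreover have "\<iota> V = 0 \<or> \<iota> V = 1 \<or> \<iota> V = 2" using \<open>\<iota> V < 3\<close> by auto
    ultimately show ?thesis using wnn[of 0 z] wnn[of 1 z] wnn[of 2 z] unfolding \<Sigma>_def by auto
  qed
  \<comment> \<open>A point in all three groups would lie in three different members, against order
    at most \<open>1 + 1\<close>.\<close>
  have some0: "\<exists>i<3. w i z = 0" if z: "z \<in> \<Delta>" for z
  proof (rule ccontr)
    assume "\<not> ?thesis"
    then have "\<psi> z \<in> W i" if "i < 3" for i using w0[OF that z] that by blast
    then have "\<exists>V\<in>\<V>. \<iota> V = i \<and> \<psi> z \<in> V" if "i < 3" for i using that by (auto simp: W_def)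
    then obtain v where v: "\<And>i. i < 3 \<Longrightarrow> v i \<in> \<V> \<and> \<iota> (v i) = i \<and> \<psi> z \<in> v i" by metis
    have "card (v ` {..<3}) = 3"
    proof -
      have "inj_on v {..<3}" using v by (metis inj_onI lessThan_iff)
      then show ?thesis by (simp add: card_image)
    qed
    moreover have "card (v ` {..<3}) \<le> card {V\<in>\<V>. \<psi> z \<in> V}" using V(1) v by (intro card_mono) auto
    moreover have "card {V\<in>\<V>. \<psi> z \<in> V} \<le> 2" using V(5) \<psi>(3) z by fastforce
    ultimately show False by simp
  qed
  \<comment> \<open>The pair \<open>(fst, snd)\<close> holds coordinates 1 and 2 but receives the
    weights 0 and 1. This cyclic shift is what makes the fixed point useful: weight i there is
    coordinate i + 1 modulo 3.\<close>
  define f where "f = (\<lambda>z. (w 0 z / \<Sigma> z, w 1 z / \<Sigma> z))"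
  have cont\<Sigma>: "continuous_on \<Delta> \<Sigma>" unfolding \<Sigma>_def by (intro continuous_intros contw)
  have contf: "continuous_on \<Delta> f" unfolding f_def
    by (intro continuous_intros contw cont\<Sigma>) (use \<Sigma>pos in force)+
  have f\<Delta>: "f ` \<Delta> \<subseteq> \<Delta>"
  proof (rule image_subsetI)
    fix z assume z: "z \<in> \<Delta>"
    have "w 0 z / \<Sigma> z + w 1 z / \<Sigma> z \<le> 1"
      using \<Sigma>pos[OF z] wnn[of 2 z] by (simp add: add_divide_distrib[symmetric] \<Sigma>_def)
    then show "f z \<in> \<Delta>" using \<Sigma>pos[OF z] wnn by (simp add: \<Delta>_def f_def less_imp_le)
  qed
  have "(0, 0) \<in> \<Delta>" by (simp add: \<Delta>_def)
  then have "\<Delta> \<noteq> {}" by blast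
  moreover have "f \<in> \<Delta> \<rightarrow> \<Delta>" using f\<Delta> by blast
  ultimately obtain z where z: "z \<in> \<Delta>" "f z = z"
    using brouwer[OF compact\<Delta> convex\<Delta> _ contf] by blast
  have bz: "\<beta> 1 z = w 0 z / \<Sigma> z" "\<beta> 2 z = w 1 z / \<Sigma> z" "\<beta> 0 z = w 2 z / \<Sigma> z"
  proof -
    have "fst z = w 0 z / \<Sigma> z" "snd z = w 1 z / \<Sigma> z" using z(2) by (metis f_def fst_conv snd_conv)+
    then show "\<beta> 1 z = w 0 z / \<Sigma> z" "\<beta> 2 z = w 1 z / \<Sigma> z" "\<beta> 0 z = w 2 z / \<Sigma> z"
      using \<Sigma>pos[OF z(1)] by (auto simp: \<beta>_def \<Sigma>_def field_simps)
  qed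
  have cyc: "w 0 z = 0 \<Longrightarrow> w 1 z = 0" "w 1 z = 0 \<Longrightarrow> w 2 z = 0" "w 2 z = 0 \<Longrightarrow> w 0 z = 0"
    using wF[OF _ z(1)] bz by auto
  obtain i where "i < 3" "w i z = 0" using some0[OF z(1)] by blast
  then have "i = 0 \<or> i = 1 \<or> i = 2" by auto
  then have "w 0 z = 0" "w 1 z = 0" "w 2 z = 0" using \<open>w i z = 0\<close> cyc by auto
  then show False using \<Sigma>pos[OF z(1)] by (simp add: \<Sigma>_def)
qed

text \<open>Three vertices of a simplex of dimension at least 2 span an embedded triangle in
  \<open>P\<close>.\<close>

lemma polyhedron_simplex_dim:
  fixes P :: "'a::euclidean_space set"
  assumes "compact P" "covering_dim_le (top_of_set P) 1" "n simplex S" "S \<subseteq> P"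
  shows "n \<le> 1"
proof (rule ccontr)
  assume "\<not> n \<le> 1"
  obtain C where C: "\<not> affine_dependent C" "int (card C) = n + 1" "S = convex hull C"
    using assms(3) by (auto simp: simplex_def)
  have "3 \<le> card C" using C(2) \<open>\<not> n \<le> 1\<close> by linarith
  then obtain D where D: "D \<subseteq> C" "card D = 3" by (meson obtain_subset_with_card_n)
  then obtain p q r where pqr: "D = {p, q, r}" "p \<noteq> q" "p \<noteq> r" "q \<noteq> r" by (auto simp: card_3_iff)
  have ind: "\<not> affine_dependent {p, q, r}" using C(1) D(1) affine_dependent_subset pqr(1) by blast
  define \<Delta> where "\<Delta> = {z :: real \<times> real. 0 \<le> fst z \<and> 0 \<le> snd z \<and> fst z + snd z \<le> 1}"
  define \<psi> where "\<psi> = (\<lambda>z :: real \<times> real. p + fst z *\<^sub>R (q - p) + snd z *\<^sub>R (r - p))"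
  have "independent {q - p, r - p}"
  proof -
    have "independent ((\<lambda>x. x - p) ` ({p, q, r} - {p}))"
      using ind affine_dependent_iff_dependent2[of p "{p, q, r}"] by (simp add: image_def)
    moreover have "{p, q, r} - {p} = {q, r}" using pqr by auto
    ultimately show ?thesis by simp
  qed
  then have lin: "s = 0 \<and> t = 0" if "s *\<^sub>R (q - p) + t *\<^sub>R (r - p) = 0" for s t
  proof -
    have ne: "q - p \<noteq> r - p" using pqr by simp
    define u where "u = (\<lambda>v. if v = q - p then s else t)"
    have "(\<Sum>v\<in>{q - p, r - p}. u v *\<^sub>R v) = 0" using that ne by (simp add: u_def)
    then have "\<forall>v\<in>{q - p, r - p}. u v = 0"
      using \<open>independent {q - p, r - p}\<close> independentD[of "{q - p, r - p}" "{q - p, r - p}" u] by auto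
    then show ?thesis using ne by (auto simp: u_def)
  qed
  have "inj_on \<psi> \<Delta>"
  proof (rule inj_onI)
    fix y z assume "\<psi> y = \<psi> z"
    then have "(fst y - fst z) *\<^sub>R (q - p) + (snd y - snd z) *\<^sub>R (r - p) = 0"
      by (simp add: \<psi>_def algebra_simps)
    then show "y = z" using lin by (force simp: prod_eq_iff)
  qed
  moreover have "continuous_on \<Delta> \<psi>" unfolding \<psi>_def by (intro continuous_intros)
  moreover have "\<psi> ` \<Delta> \<subseteq> P"
  proof -
    have "\<psi> z \<in> convex hull {p, q, r}" if "z \<in> \<Delta>" for z
      unfolding convex_hull_3_alt using that by (auto simp: \<psi>_def \<Delta>_def)
    moreover have "convex hull {p, q, r} \<subseteq> P" using assms(4) C(3) D(1) pqr(1) hull_mono by blast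
    ultimately show ?thesis by blast
  qed
  ultimately show False using triangle_covering_dim[of P \<psi>] assms(1,2) unfolding \<Delta>_def by blast
qed

section \<open>Orthonormal coordinates on the plane and movability over arcs\<close>

locale plane_coordinates =
  fixes a e1 e2 :: "'a::euclidean_space"
  assumes e: "norm e1 = 1" "norm e2 = 1" "e1 \<bullet> e2 = 0"
begin

definition proj :: "'a \<Rightarrow> complex" where
  "proj x = Complex ((x - a) \<bullet> e1) ((x - a) \<bullet> e2)"

definition emb :: "complex \<Rightarrow> 'a" where
  "emb z = Re z *\<^sub>R e1 + Im z *\<^sub>R e2"

lemma ee: "e1 \<bullet> e1 = 1" "e2 \<bullet> e2 = 1" "e2 \<bullet> e1 = 0"
  using e by (simp_all add: dot_square_norm inner_commute)

lemma proj_add_emb: "proj (x + emb z) = proj x + z"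
  by (simp add: proj_def emb_def complex_eq_iff inner_diff_left inner_add_left ee e(3))

lemma continuous_proj: "continuous_on S proj"
  unfolding proj_def Complex_eq by (intro continuous_intros)

lemma continuous_emb: "continuous_on S emb"
  unfolding emb_def by (intro continuous_intros)

lemma movable_proj_constant:
  assumes "zdim L" "\<And>x. x \<in> L \<Longrightarrow> proj x = z"
  shows "movable L"
proof (rule movable_in_hyperplane[OF assms(1) e(1)])
  fix x assume "x \<in> L"
  then have "(x - a) \<bullet> e1 = Re z" using assms(2)[of x] by (simp add: proj_def complex_eq_iff)
  then show "x \<bullet> e1 = Re z + a \<bullet> e1" by (simp add: inner_diff_left)
qed

text \<open>\<open>h\<close> changes only the plane coordinates, replacing \<open>proj x\<close> by
  \<open>G (proj x)\<close>. It is a continuous injection on the open set over \<open>U\<close>,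
  hence a homeomorphism onto an open set, and it takes \<open>L\<close> into the hyperplane on which
  the second plane coordinate vanishes.\<close>

lemma movable_flattened:
  assumes "zdim L" "open U" "continuous_on U G" "inj_on G U" "\<And>x. x \<in> L \<Longrightarrow> proj x \<in> U \<and> Im (G (proj x)) = 0"
  shows "movable L"
proof -
  define h where "h = (\<lambda>x. x + emb (G (proj x) - proj x))"
  define V where "V = proj -` U"
  have oV: "open V" unfolding V_def using continuous_proj assms(2) by (intro open_vimage)
  have ph: "proj (h x) = G (proj x)" for x by (simp add: h_def proj_add_emb)
  have conth: "continuous_on V h"
  proof -
    have "continuous_on V (\<lambda>x. G (proj x))"
      by (rule continuous_on_compose2[OF assms(3) continuous_proj]) (auto simp: V_def)
    then have "continuous_on V (\<lambda>x. emb (G (proj x) - proj x))"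
      by (intro continuous_on_compose2[OF continuous_emb[of UNIV]] continuous_intros continuous_proj) auto
    then show ?thesis unfolding h_def by (intro continuous_intros)
  qed
  have injh: "inj_on h V"
  proof (rule inj_onI)
    fix x y assume xy: "x \<in> V" "y \<in> V" "h x = h y"
    then have "G (proj x) = G (proj y)" using ph by metis
    then have "proj x = proj y" using assms(4) xy(1,2) by (auto simp: V_def dest: inj_onD)
    then show "x = y" using xy(3) by (simp add: h_def)
  qed
  obtain k where k: "homeomorphism V (h ` V) h k"
    using invariance_of_domain_homeomorphism[OF oV conth _ injh] by auto
  have oh: "open (h ` V)" by (rule invariance_of_domain[OF conth oV injh])
  have LV: "L \<subseteq> V" using assms(5) by (auto simp: V_def)
  have "movable (h ` L)"
  proof (rule movable_in_hyperplane[OF _ e(2)])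
    show "zdim (h ` L)" using zdim_image[OF assms(1)] conth injh LV by (meson continuous_on_subset inj_on_subset)
    fix y assume "y \<in> h ` L"
    then obtain x where "x \<in> L" "y = h x" by blast
    then have "Im (proj y) = 0" using ph assms(5) by simp
    then show "y \<bullet> e2 = a \<bullet> e2" by (simp add: proj_def inner_diff_left)
  qed
  then show ?thesis using movable_homeomorphism[OF oV oh k LV] by blast
qed

text \<open>The flat charts exist only at interior points of the arc. The fibres over the two ends
  are therefore moved first; a compact part of \<open>L\<close> away from them is movable because it
  is so locally.\<close>

lemma movable_over_arc:
  assumes "zdim L" "arc g" "proj ` L \<subseteq> path_image g"
  shows "movable L"
proof -
  define A where "A = L \<inter> proj -` {g 0, g 1}"
  have cl: "closed (proj -` Z)" if "closed Z" for Z using that continuous_proj by (intro closed_vimage)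
  have cA: "compact A" unfolding A_def using zdim_compact[OF assms(1)] cl by (simp add: compact_Int_closed)
  show ?thesis
  proof (rule movable_extend[OF assms(1) cA])
    show "A \<subseteq> L" by (auto simp: A_def)
    show "movable A"
    proof (rule movable_finite_Union[of "{proj -` {g 0}, proj -` {g 1}}"])
      show "zdim A" using zdim_subset[OF assms(1) cA] by (auto simp: A_def)
      show "A \<subseteq> \<Union>{proj -` {g 0}, proj -` {g 1}}" by (auto simp: A_def)
      show "closed B" if "B \<in> {proj -` {g 0}, proj -` {g 1}}" for B using that cl by auto
      show "movable M" if "B \<in> {proj -` {g 0}, proj -` {g 1}}" "compact M" "M \<subseteq> A \<inter> B" for B M
      proof -
        have "zdim M" using zdim_subset[OF assms(1) that(2)] that(3) by (auto simp: A_def)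
        then show ?thesis using movable_proj_constant[of M "g 0"] movable_proj_constant[of M "g 1"] that by auto
      qed
    qed simp
    fix N assume N: "compact N" "N \<subseteq> L - A"
    show "movable N"
    proof (rule movable_local)
      show zN: "zdim N" using zdim_subset[OF assms(1) N(1)] N(2) by blast
      fix x assume x: "x \<in> N"
      then have "x \<in> L" "x \<notin> A" using N(2) by blast+
      then have "proj x \<in> path_image g" "proj x \<noteq> g 0" "proj x \<noteq> g 1"
        using assms(3) unfolding A_def by blast+
      moreover from this(1) obtain s where s: "s \<in> {0..1}" "proj x = g s" unfolding path_image_def by blast
      ultimately have "s \<noteq> 0" "s \<noteq> 1" by auto
      then have s01: "0 < s" "s < 1" using s(1) by auto
      obtain U V G where UV: "open U" "open V" "g s \<in> V" "V \<subseteq> U" "continuous_on U G" "inj_on G U"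
        "\<And>z. z \<in> path_image g \<inter> V \<Longrightarrow> Im (G z) = 0"
        by (rule arc_locally_flat[OF assms(2) s01]) (rule that; assumption)
      have "movable M" if "compact M" "M \<subseteq> N \<inter> proj -` V" for M
      proof (rule movable_flattened[OF _ UV(1,5,6)])
        show "zdim M" using zdim_subset[OF zN that(1)] that(2) by blast
        fix y assume "y \<in> M"
        then have "proj y \<in> V" "proj y \<in> path_image g" using that(2) N(2) assms(3) by auto
        then show "proj y \<in> U \<and> Im (G (proj y)) = 0" using UV(4,7) by blast
      qed
      moreover have "open (proj -` V)" using continuous_proj UV(2) by (intro open_vimage)
      ultimately show "\<exists>W. open W \<and> x \<in> W \<and> (\<forall>M. compact M \<and> M \<subseteq> N \<inter> W \<longrightarrow> movable M)"
        using UV(3) s(2) by (intro exI[of _ "proj -` V"]) auto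
    qed
  qed
qed

end

lemma two_plane_coordinates:
  fixes H :: "'a::euclidean_space set"
  assumes "two_plane H"
  obtains a e1 e2 where "norm e1 = 1" "norm e2 = 1" "e1 \<bullet> e2 = 0"
    "H = range (\<lambda>(s, t). a + s *\<^sub>R e1 + t *\<^sub>R e2)"
proof -
  have aff: "affine H" "aff_dim H = 2" using assms by (simp_all add: two_plane_def)
  then obtain a where a: "a \<in> H" by fastforce
  define T where "T = (+) (- a) ` H"
  have T: "subspace T" unfolding T_def using affine_diffs_subspace[OF aff(1) a] by simp
  have "dim T = 2" using aff_dim_eq_dim[of a H] aff(2) a by (simp add: T_def hull_inc)
  then obtain B where B: "B \<subseteq> T" "pairwise orthogonal B" "\<And>x. x \<in> B \<Longrightarrow> norm x = 1" "card B = 2" "span B = T"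
    using orthonormal_basis_subspace[OF T] by metis
  then obtain e1 e2 where e: "B = {e1, e2}" "e1 \<noteq> e2" by (auto simp: card_2_iff)
  have "H = range (\<lambda>(s, t). a + s *\<^sub>R e1 + t *\<^sub>R e2)"
  proof (intro equalityI subsetI)
    fix x assume "x \<in> H"
    then have "x - a \<in> span {e1, e2}" using B(5) e(1) by (force simp: T_def)
    then obtain s where "x - a - s *\<^sub>R e1 \<in> span {e2}" by (auto simp: span_breakdown_eq)
    then obtain t where "x - a - s *\<^sub>R e1 = t *\<^sub>R e2" by (auto simp: span_singleton)
    then have "x = a + s *\<^sub>R e1 + t *\<^sub>R e2" by (simp add: algebra_simps)
    then show "x \<in> range (\<lambda>(s, t). a + s *\<^sub>R e1 + t *\<^sub>R e2)" by (intro image_eqI[of _ _ "(s, t)"]) auto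
  next
    fix x assume "x \<in> range (\<lambda>(s, t). a + s *\<^sub>R e1 + t *\<^sub>R e2)"
    then obtain s t where x: "x = a + s *\<^sub>R e1 + t *\<^sub>R e2" by auto
    have "s *\<^sub>R e1 + t *\<^sub>R e2 \<in> span B" using e(1) by (intro span_add span_mul span_base) auto
    then have "s *\<^sub>R e1 + t *\<^sub>R e2 \<in> (+) (- a) ` H" unfolding B(5) T_def .
    then obtain y where "y \<in> H" "s *\<^sub>R e1 + t *\<^sub>R e2 = - a + y" by blast
    then show "x \<in> H" using x by (simp add: algebra_simps)
  qed
  moreover have "norm e1 = 1" "norm e2 = 1" using B(3) e(1) by auto
  moreover have "e1 \<bullet> e2 = 0" using B(2) e by (auto simp: pairwise_def orthogonal_def)
  ultimately show ?thesis using that by blast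
qed

lemma (in plane_coordinates) orth_proj_eq:
  assumes "H = range (\<lambda>(s, t). a + s *\<^sub>R e1 + t *\<^sub>R e2)" "affine H"
  shows "orth_proj H x = a + emb (proj x)"
proof -
  have mem: "y \<in> H \<longleftrightarrow> (\<exists>s t. y = a + s *\<^sub>R e1 + t *\<^sub>R e2)" for y using assms(1) by auto
  have "a + emb (proj x) \<in> H" unfolding mem emb_def by (metis add.assoc)
  moreover have "orthogonal (x - (a + emb (proj x))) (u - v)" if uvH: "u \<in> H" "v \<in> H" for u v
  proof -
    obtain s t s' t' where "u = a + s *\<^sub>R e1 + t *\<^sub>R e2" "v = a + s' *\<^sub>R e1 + t' *\<^sub>R e2" using uvH mem by blast
    then have uv: "u - v = (s - s') *\<^sub>R e1 + (t - t') *\<^sub>R e2" by (simp add: algebra_simps)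
    have "(x - (a + emb (proj x))) \<bullet> e1 = 0" "(x - (a + emb (proj x))) \<bullet> e2 = 0"
      by (simp_all add: emb_def proj_def inner_diff_left inner_add_left ee e(3))
    then show ?thesis unfolding orthogonal_def uv by (simp add: inner_add_right)
  qed
  ultimately show ?thesis
    unfolding orth_proj_def using assms
    by (intro the1_equality orth_proj_unique_exists) auto
qed

lemma homeomorphic_segment_arc:
  fixes S :: "'a::euclidean_space set" and f :: "'a \<Rightarrow> complex"
  assumes "S = closed_segment p q" "p \<noteq> q" "continuous_on S f" "inj_on f S"
  shows "\<exists>g. arc g \<and> path_image g = f ` S"
proof (intro exI conjI)
  have im: "path_image (linepath p q) = S" using assms(1) by simp
  have "inj_on (linepath p q) {0..1}" using arc_linepath[OF assms(2)] by (simp add: arc_def)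
  then have "inj_on (f \<circ> linepath p q) {0..1}" using assms(4) im by (intro comp_inj_on) (simp_all add: path_image_def)
  moreover have "path (f \<circ> linepath p q)" using assms(3) im by (intro path_continuous_image) simp_all
  ultimately show "arc (f \<circ> linepath p q)" by (simp add: arc_def)
  show "path_image (f \<circ> linepath p q) = f ` S" using assms(1) by (simp add: path_image_compose)
qed

text \<open>The plane coordinates carry the polyhedron injectively into the complex plane by
  \<open>F\<close>. Each simplex becomes the empty set, a point or an arc, and \<open>K\<close> is
  covered by the closed preimages of these finitely many images. The argument is run for every
  compact \<open>L\<close> inside \<open>K\<close>, as the passage from movability to tameness
  demands.\<close>

theorem corollary7p3:
  fixes K H X :: "(real ^ 'n) set"
    and P :: "(real ^ 'm) set"
  assumes "CARD('n) \<ge> 3"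
    and "compact K"
    and "has_covering_dim (top_of_set K) 0"
    and "two_plane H"
    and "X \<subseteq> H"
    and "simplicial_polyhedron P"
    and "has_covering_dim (top_of_set P) 1"
    and "X homeomorphic P"
    and "orth_proj H ` K \<subseteq> X"
  shows "tame K"
proof -
  have zK: "zdim K"
    using covering_dim_zero_imp_zdim[OF assms(2)] assms(3) by (simp add: has_covering_dim_def)
  obtain a e1 e2 where ae: "norm e1 = 1" "norm e2 = 1" "e1 \<bullet> e2 = 0"
    and H: "H = range (\<lambda>(s, t). a + s *\<^sub>R e1 + t *\<^sub>R e2)"
    by (rule two_plane_coordinates[OF assms(4)])
  interpret plane_coordinates a e1 e2 by unfold_locales (fact ae)+
  have affH: "affine H" using assms(4) by (simp add: two_plane_def)
  obtain \<S> where \<S>: "finite \<S>" "\<And>S. S \<in> \<S> \<Longrightarrow> \<exists>d. d simplex S" "P = \<Union>\<S>"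
    using assms(6) unfolding simplicial_polyhedron_def by blast
  have cS: "compact S" if "S \<in> \<S>" for S
    using \<S>(2)[OF that] compact_simplex by blast
  have cP: "compact P" unfolding \<S>(3) using \<S>(1) cS by (intro compact_Union) auto
  have dimP: "covering_dim_le (top_of_set P) 1" using assms(7) by (simp add: has_covering_dim_def)
  obtain f f' where f: "homeomorphism P X f f'" using assms(8) homeomorphic_sym unfolding homeomorphic_def by blast
  have contf: "continuous_on P f" and fX: "f ` P = X" and injf: "inj_on f P"
    using f by (auto simp: homeomorphism_def intro: inj_on_inverseI)
  define F where "F = (\<lambda>y. proj (f y))"
  have injH: "inj_on proj H"
  proof (rule inj_onI)
    fix x y assume xy: "x \<in> H" "y \<in> H" "proj x = proj y"
    have "z = a + emb (proj z)" if z: "z \<in> H" for z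
    proof -
      obtain s t where st: "z = a + s *\<^sub>R e1 + t *\<^sub>R e2" using z unfolding H by auto
      then have "proj z = Complex s t" by (simp add: proj_def inner_add_left ee ae(3))
      then show ?thesis using st by (simp add: emb_def)
    qed
    then show "x = y" using xy by metis
  qed
  have contF: "continuous_on P F" unfolding F_def
    by (rule continuous_on_compose2[OF continuous_proj[of UNIV] contf]) simp
  have injF: "inj_on F P"
  proof (rule inj_onI)
    fix x y assume xy: "x \<in> P" "y \<in> P" "F x = F y"
    then have "f x = f y" using injH fX assms(5) unfolding F_def by (metis image_eqI inj_onD subsetD)
    then show "x = y" using injf xy by (auto dest: inj_onD)
  qed
  have projK: "proj ` K \<subseteq> F ` P"
  proof (rule image_subsetI)
    fix x assume "x \<in> K"
    then have "a + emb (proj x) \<in> X" using assms(9) orth_proj_eq[OF H affH] by auto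
    then obtain y where y: "y \<in> P" "f y = a + emb (proj x)" using fX by (metis imageE)
    have "proj (a + emb (proj x)) = proj a + proj x" by (rule proj_add_emb)
    moreover have "proj a = 0" by (simp add: proj_def complex_eq_iff)
    ultimately have "F y = proj x" by (simp add: F_def y(2))
    then show "proj x \<in> F ` P" using y(1) by (metis image_eqI)
  qed
  have piece: "movable L" if S: "S \<in> \<S>" and L: "zdim L" "proj ` L \<subseteq> F ` S" for S L
  proof -
    obtain d where d: "d simplex S" using \<S>(2)[OF S] by blast
    have SP: "S \<subseteq> P" using S \<S>(3) by blast
    have "d \<le> 1" by (rule polyhedron_simplex_dim[OF cP dimP d SP])
    obtain C where C: "int (card C) = d + 1" "S = convex hull C" "\<not> affine_dependent C"
      using d by (auto simp: simplex_def)
    have finC: "finite C" using aff_independent_finite[OF C(3)] .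
    \<comment> \<open>The dimension \<open>d\<close> is an integer that may be -1, the dimension of
      the empty simplex; this is the case of no vertices.\<close>
    have "card C = 0 \<or> card C = 1 \<or> card C = 2" using C(1) \<open>d \<le> 1\<close> by linarith
    then consider "C = {}" | p where "C = {p}" | p q where "C = {p, q}" "p \<noteq> q"
      using finC by (auto simp: card_1_singleton_iff card_2_iff)
    then show ?thesis
    proof cases
      case 1
      then have "L = {}" using L(2) C(2) by simp
      then show ?thesis using movable_proj_constant[OF L(1)] by blast
    next
      case 2
      then have "proj x = F p" if "x \<in> L" for x using L(2) C(2) that by auto
      then show ?thesis by (rule movable_proj_constant[OF L(1)])
    next
      case 3
      then have seg: "S = closed_segment p q" using C(2) by (simp add: segment_convex_hull)
      obtain g where "arc g" "path_image g = F ` S"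
        using homeomorphic_segment_arc[OF seg 3(2) continuous_on_subset[OF contF SP] inj_on_subset[OF injF SP]] by (elim exE conjE)
      then show ?thesis using movable_over_arc[OF L(1), of g] L(2) by simp
    qed
  qed
  have "movable L" if L: "compact L" "L \<subseteq> K" for L
  proof (rule movable_finite_Union[of "(\<lambda>S. proj -` (F ` S)) ` \<S>"])
    show "finite ((\<lambda>S. proj -` (F ` S)) ` \<S>)" using \<S>(1) by simp
    show zL: "zdim L" by (rule zdim_subset[OF zK L])
    show "L \<subseteq> \<Union>((\<lambda>S. proj -` (F ` S)) ` \<S>)"
    proof
      fix x assume "x \<in> L"
      then have "proj x \<in> F ` P" using projK L(2) by blast
      then obtain y S where "y \<in> S" "S \<in> \<S>" "proj x = F y" unfolding \<S>(3) by blast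
      then show "x \<in> \<Union>((\<lambda>S. proj -` (F ` S)) ` \<S>)" by blast
    qed
    show "closed A" if "A \<in> (\<lambda>S. proj -` (F ` S)) ` \<S>" for A
    proof -
      obtain S where S: "S \<in> \<S>" "A = proj -` (F ` S)" using \<open>A \<in> _\<close> by blast
      have "S \<subseteq> P" using S(1) \<S>(3) by blast
      from compact_continuous_image[OF continuous_on_subset[OF contF this] cS[OF S(1)]]
      have "compact (F ` S)" .
      then show ?thesis unfolding S(2) using continuous_proj by (intro closed_vimage compact_imp_closed)
    qed
    show "movable M" if M: "A \<in> (\<lambda>S. proj -` (F ` S)) ` \<S>" "compact M" "M \<subseteq> L \<inter> A" for A M
    proof -
      obtain S where S: "S \<in> \<S>" "A = proj -` (F ` S)" using M(1) by blast
      have "zdim M" using zdim_subset[OF zL M(2)] M(3) by blast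
      moreover have "proj ` M \<subseteq> F ` S" using M(3) S(2) by blast
      ultimately show ?thesis by (rule piece[OF S(1)])
    qed
  qed
  then show ?thesis by (rule movable_imp_tame[OF zK])
qed

end
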